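(* A modal formula $\varphi$ is valid in the modal logic S5 if and only if the first-order formula $\varphi^\ast$ abbreviated by $\varphi$ has a combinatorial proof, i.e. there exist a fonet $N$ and a skew bifibration $f:N\to\mathcal G(\varphi^\ast)$.
   Context: A modal formula is built from nullary predicate symbols and the constants $1,0$ by $\wedge,\vee$ and the modal operators $\Box,\Diamond$ (negation by De Morgan duality; each predicate symbol $p$ has a dual $\bar p\neq p$, $\bar{\bar p}=p$). It abbreviates the first-order formula $\varphi^\ast$ obtained by replacing every $\Box$ by $\forall x$, every $\Diamond$ by $\exists x$ and every predicate symbol $p$ by $px$ (then taking a rectified form, i.e. renaming bound variables to be distinct). Graph $\mathcal G(\psi)$ of a rectified first-order formula: single $\alpha$-labelled vertex for an atom $\alpha$; $\mathcal G(\psi\vee\chi)$ disjoint union; $\mathcal G(\psi\wedge\chi)$ join (disjoint union plus all edges between the two parts); $\mathcal G(\forall x\psi)=x\sqcup\mathcal G(\psi)$, $\mathcal G(\exists x\psi)=x\ast\mathcal G(\psi)$ with $x$ a single $x$-labelled vertex. Variable-labelled vertices are binders, atom-labelled ones literals. A cograph has no induced four-vertex path; a logical cograph is a cograph with each vertex labelled by a variable or atom and at least one literal. A module is a vertex set $M$ with $N(v)\setminus M=N(w)\setminus M$ for $v,w\in M$; strong if every module is disjoint from, inside, or contains it; proper if $|M|\ge2$. The scope of a binder is the smallest proper strong module containing it; a binder is existential (universal) if adjacent to every (no) other vertex of its scope. An $x$-binder is legal if its scope contains a literal and no other $x$-binder; a fograph is a logical cograph with all binders legal. An $x$-binder binds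 the literals in its scope whose atom contains $x$; the binding graph is the directed graph of these bindings. A rectified fograph has each $x$-binder unique and binding all $x$-literals. Skew fibration $f:G\to H$: homomorphism such that for all $v$ and $wf(v)\in E(H)$ exists $\hat w$ with $\hat w v\in E(G)$, $f(\hat w)w\notin E(H)$. Directed fibration: for all $v$ and target edge $(w,f(v))$ a unique $\hat w$ with $(\hat w,v)$ an edge and $f(\hat w)=w$. Skew bifibration of fographs: label- and existential-preserving homomorphism that is a skew fibration and a fibration of binding graphs. A linked fograph: fograph with a partition of some vertices into links, each a pair of non-adjacent literals with dual predicate symbols, every literal labelled $1$ or in a link. For a rectified linked fograph, a dualizer assigns terms to existential-binder variables so that each link's two atoms become dual after substitution; a dependency is an existential binder $x$ and universal binder $y$ such that every dualizer's term for $x$ contains $y$; leaps are links and dependencies. A set induces a bimatching if it induces a perfect matching (nonempty, each vertex exactly one neighbour) both in the graph and in the leap graph. A fonet is a linked fograph with a dualizer and no induced bimatching. *)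

theory Defs
  imports Main
begin

section \<open>Predicate symbols, terms, formulas\<close>

(* Symbols come in dual pairs: Pos p and Neg p. *)
datatype 'p psym = Pos 'p | Neg 'p

fun dual_psym :: "'p psym \<Rightarrow> 'p psym" where
  "dual_psym (Pos p) = Neg p"
| "dual_psym (Neg p) = Pos p"

datatype ('f, tm_vars: 'v) tm = Var 'v | Fn 'f "('f, 'v) tm list"

(* As usual, a function or predicate symbol together with the length of its argument list
   plays the role of a symbol of that arity.  Tru and Fls are the constants 1 and 0,
   which are dual nullary predicate symbols. *)
datatype ('f, 'p, atom_vars: 'v) atom = Tru | Fls | Pred "'p psym" "('f, 'v) tm list"

primrec dual_atom :: "('f, 'p, 'v) atom \<Rightarrow> ('f, 'p, 'v) atom" where
  "dual_atom Tru = Fls"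
| "dual_atom Fls = Tru"
| "dual_atom (Pred p ts) = Pred (dual_psym p) ts"

(* The predicate symbols are dual (in particular of the same arity); arguments are arbitrary. *)
fun predual :: "('f, 'p, 'v) atom \<Rightarrow> ('f, 'p, 'v) atom \<Rightarrow> bool" where
  "predual Tru Fls = True"
| "predual Fls Tru = True"
| "predual (Pred p ts) (Pred q us) = (q = dual_psym p \<and> length us = length ts)"
| "predual _ _ = False"

primrec subst_tm :: "('v \<Rightarrow> ('f, 'v) tm) \<Rightarrow> ('f, 'v) tm \<Rightarrow> ('f, 'v) tm" where
  "subst_tm \<sigma> (Var x) = \<sigma> x"
| "subst_tm \<sigma> (Fn g ts) = Fn g (map (subst_tm \<sigma>) ts)"

primrec subst_atom :: "('v \<Rightarrow> ('f, 'v) tm) \<Rightarrow> ('f, 'p, 'v) atom \<Rightarrow> ('f, 'p, 'v) atom" where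
  "subst_atom \<sigma> Tru = Tru"
| "subst_atom \<sigma> Fls = Fls"
| "subst_atom \<sigma> (Pred p ts) = Pred p (map (subst_tm \<sigma>) ts)"

datatype ('f, 'p, 'v) fm =
    Atm "('f, 'p, 'v) atom"
  | Conj "('f, 'p, 'v) fm" "('f, 'p, 'v) fm"
  | Disj "('f, 'p, 'v) fm" "('f, 'p, 'v) fm"
  | All 'v "('f, 'p, 'v) fm"
  | Ex 'v "('f, 'p, 'v) fm"

primrec free_vars :: "('f, 'p, 'v) fm \<Rightarrow> 'v set" where
  "free_vars (Atm a) = atom_vars a"
| "free_vars (Conj \<phi> \<psi>) = free_vars \<phi> \<union> free_vars \<psi>"
| "free_vars (Disj \<phi> \<psi>) = free_vars \<phi> \<union> free_vars \<psi>"
| "free_vars (All x \<phi>) = free_vars \<phi> - {x}"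
| "free_vars (Ex x \<phi>) = free_vars \<phi> - {x}"

(* with multiplicity: one entry per quantifier occurrence *)
primrec bound_vars :: "('f, 'p, 'v) fm \<Rightarrow> 'v list" where
  "bound_vars (Atm a) = []"
| "bound_vars (Conj \<phi> \<psi>) = bound_vars \<phi> @ bound_vars \<psi>"
| "bound_vars (Disj \<phi> \<psi>) = bound_vars \<phi> @ bound_vars \<psi>"
| "bound_vars (All x \<phi>) = x # bound_vars \<phi>"
| "bound_vars (Ex x \<phi>) = x # bound_vars \<phi>"

definition rectified :: "('f, 'p, 'v) fm \<Rightarrow> bool" where
  "rectified \<phi> \<longleftrightarrow> distinct (bound_vars \<phi>) \<and> set (bound_vars \<phi>) \<inter> free_vars \<phi> = {}"

(* Alpha-equivalence.  The list records the pairs of variables bound by the quantifiers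
   passed so far, innermost first. *)
fun var_eq :: "('v \<times> 'v) list \<Rightarrow> 'v \<Rightarrow> 'v \<Rightarrow> bool" where
  "var_eq [] x y = (x = y)"
| "var_eq ((a, b) # e) x y = (if x = a \<or> y = b then x = a \<and> y = b else var_eq e x y)"

fun alpha_eq :: "('v \<times> 'v) list \<Rightarrow> ('f, 'p, 'v) fm \<Rightarrow> ('f, 'p, 'v) fm \<Rightarrow> bool" where
  "alpha_eq e (Atm a) (Atm b) = rel_atom (=) (=) (var_eq e) a b"
| "alpha_eq e (Conj \<phi> \<psi>) (Conj \<phi>' \<psi>') = (alpha_eq e \<phi> \<phi>' \<and> alpha_eq e \<psi> \<psi>')"
| "alpha_eq e (Disj \<phi> \<psi>) (Disj \<phi>' \<psi>') = (alpha_eq e \<phi> \<phi>' \<and> alpha_eq e \<psi> \<psi>')"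
| "alpha_eq e (All x \<phi>) (All y \<phi>') = alpha_eq ((x, y) # e) \<phi> \<phi>'"
| "alpha_eq e (Ex x \<phi>) (Ex y \<phi>') = alpha_eq ((x, y) # e) \<phi> \<phi>'"
| "alpha_eq e _ _ = False"

definition rectified_form :: "('f, 'p, 'v) fm \<Rightarrow> ('f, 'p, 'v) fm \<Rightarrow> bool" where
  "rectified_form \<phi> \<psi> \<longleftrightarrow> alpha_eq [] \<phi> \<psi> \<and> rectified \<psi>"

(* Every formula over infinitely many variables has a rectified form. *)

lemma alpha_eq_rename_exists:
  fixes \<phi> :: "('f, 'p, 'v) fm"
  assumes "infinite (UNIV :: 'v set)" "finite A" "finite B"
    and "\<forall>x\<in>free_vars \<phi>. \<exists>y\<in>A. var_eq e x y"
  shows "\<exists>\<psi>. alpha_eq e \<phi> \<psi> \<and> distinct (bound_vars \<psi>) \<and> set (bound_vars \<psi>) \<inter> B = {}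
             \<and> free_vars \<psi> \<subseteq> A"
  using assms(2-4)
proof (induction \<phi> arbitrary: e A B)
  case (Atm a)
  then obtain r where r: "\<forall>x\<in>atom_vars a. r x \<in> A \<and> var_eq e x (r x)"
    by simp metis
  have "rel_atom (=) (=) (var_eq e) (map_atom id id id a) (map_atom id id r a)"
    unfolding atom.rel_map using r by (intro atom.rel_refl_strong) auto
  then have "alpha_eq e (Atm a) (Atm (map_atom id id r a))"
    by (simp add: atom.map_id)
  moreover have "atom_vars (map_atom id id r a) \<subseteq> A"
    using r by (auto simp: atom.set_map)
  ultimately show ?case
    by (intro exI[of _ "Atm (map_atom id id r a)"]) simp
next
  case (Conj \<phi>1 \<phi>2)
  obtain \<psi>1 where 1: "alpha_eq e \<phi>1 \<psi>1" "distinct (bound_vars \<psi>1)"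
    "set (bound_vars \<psi>1) \<inter> B = {}" "free_vars \<psi>1 \<subseteq> A"
    using Conj.IH(1)[of A B e] Conj.prems by auto
  obtain \<psi>2 where 2: "alpha_eq e \<phi>2 \<psi>2" "distinct (bound_vars \<psi>2)"
    "set (bound_vars \<psi>2) \<inter> (B \<union> set (bound_vars \<psi>1)) = {}" "free_vars \<psi>2 \<subseteq> A"
    using Conj.IH(2)[of A "B \<union> set (bound_vars \<psi>1)" e] Conj.prems by auto
  from 1 2 show ?case
    by (intro exI[of _ "Conj \<psi>1 \<psi>2"]) auto
next
  case (Disj \<phi>1 \<phi>2)
  obtain \<psi>1 where 1: "alpha_eq e \<phi>1 \<psi>1" "distinct (bound_vars \<psi>1)"
    "set (bound_vars \<psi>1) \<inter> B = {}" "free_vars \<psi>1 \<subseteq> A"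
    using Disj.IH(1)[of A B e] Disj.prems by auto
  obtain \<psi>2 where 2: "alpha_eq e \<phi>2 \<psi>2" "distinct (bound_vars \<psi>2)"
    "set (bound_vars \<psi>2) \<inter> (B \<union> set (bound_vars \<psi>1)) = {}" "free_vars \<psi>2 \<subseteq> A"
    using Disj.IH(2)[of A "B \<union> set (bound_vars \<psi>1)" e] Disj.prems by auto
  from 1 2 show ?case
    by (intro exI[of _ "Disj \<psi>1 \<psi>2"]) auto
next
  case (All x \<phi>)
  obtain y where y: "y \<notin> A \<union> B"
    using ex_new_if_finite[OF assms(1), of "A \<union> B"] All.prems by auto
  have "\<forall>z\<in>free_vars \<phi>. \<exists>w\<in>insert y A. var_eq ((x, y) # e) z w"
    using All.prems y by (auto split: if_splits)
  then obtain \<psi> where "alpha_eq ((x, y) # e) \<phi> \<psi>" "distinct (bound_vars \<psi>)"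
    "set (bound_vars \<psi>) \<inter> insert y B = {}" "free_vars \<psi> \<subseteq> insert y A"
    using All.IH[of "insert y A" "insert y B" "(x, y) # e"] All.prems by blast
  then show ?case
    using y by (intro exI[of _ "All y \<psi>"]) auto
next
  case (Ex x \<phi>)
  obtain y where y: "y \<notin> A \<union> B"
    using ex_new_if_finite[OF assms(1), of "A \<union> B"] Ex.prems by auto
  have "\<forall>z\<in>free_vars \<phi>. \<exists>w\<in>insert y A. var_eq ((x, y) # e) z w"
    using Ex.prems y by (auto split: if_splits)
  then obtain \<psi> where "alpha_eq ((x, y) # e) \<phi> \<psi>" "distinct (bound_vars \<psi>)"
    "set (bound_vars \<psi>) \<inter> insert y B = {}" "free_vars \<psi> \<subseteq> insert y A"
    using Ex.IH[of "insert y A" "insert y B" "(x, y) # e"] Ex.prems by blast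
  then show ?case
    using y by (intro exI[of _ "Ex y \<psi>"]) auto
qed

lemma finite_tm_vars: "finite (tm_vars t)"
  by (induction t) auto

lemma finite_atom_vars: "finite (atom_vars a)"
  by (cases a) (auto simp: finite_tm_vars)

lemma finite_free_vars: "finite (free_vars \<phi>)"
  by (induction \<phi>) (auto simp: finite_atom_vars)

lemma rectified_form_exists:
  fixes \<phi> :: "('f, 'p, 'v) fm"
  assumes "infinite (UNIV :: 'v set)"
  shows "\<exists>\<psi>. rectified_form \<phi> \<psi>"
  using alpha_eq_rename_exists[OF assms finite_free_vars finite_free_vars, of \<phi> \<phi> "[]"]
  unfolding rectified_form_def rectified_def by force

section \<open>Modal formulas and S5\<close>

datatype 'p modal =
    MPred "'p psym"
  | MTru
  | MFls
  | MConj "'p modal" "'p modal"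
  | MDisj "'p modal" "'p modal"
  | Box "'p modal"
  | Dia "'p modal"

primrec sat :: "('w \<times> 'w) set \<Rightarrow> ('w \<Rightarrow> 'p \<Rightarrow> bool) \<Rightarrow> 'w \<Rightarrow> 'p modal \<Rightarrow> bool" where
  "sat R V w (MPred P) = (case P of Pos p \<Rightarrow> V w p | Neg p \<Rightarrow> \<not> V w p)"
| "sat R V w MTru = True"
| "sat R V w MFls = False"
| "sat R V w (MConj \<phi> \<psi>) = (sat R V w \<phi> \<and> sat R V w \<psi>)"
| "sat R V w (MDisj \<phi> \<psi>) = (sat R V w \<phi> \<or> sat R V w \<psi>)"
| "sat R V w (Box \<phi>) = (\<forall>u. (w, u) \<in> R \<longrightarrow> sat R V u \<phi>)"
| "sat R V w (Dia \<phi>) = (\<exists>u. (w, u) \<in> R \<and> sat R V u \<phi>)"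

(* Truth at every world of every Kripke model whose accessibility relation is an equivalence
   relation and whose set of worlds W is drawn from the type 'w. *)
definition S5_valid :: "'w itself \<Rightarrow> 'p modal \<Rightarrow> bool" where
  "S5_valid _ \<phi> \<longleftrightarrow> (\<forall>(W :: 'w set) R V. equiv W R \<longrightarrow> (\<forall>w\<in>W. sat R V w \<phi>))"

(* The unrectified first-order formula abbreviated by a modal formula, all quantifiers
   being over the one variable x. *)
primrec star :: "'v \<Rightarrow> 'p modal \<Rightarrow> ('f, 'p, 'v) fm" where
  "star x (MPred p) = Atm (Pred p [Var x])"
| "star x MTru = Atm Tru"
| "star x MFls = Atm Fls"
| "star x (MConj \<phi> \<psi>) = Conj (star x \<phi>) (star x \<psi>)"
| "star x (MDisj \<phi> \<psi>) = Disj (star x \<phi>) (star x \<psi>)"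
| "star x (Box \<phi>) = All x (star x \<phi>)"
| "star x (Dia \<phi>) = Ex x (star x \<phi>)"

section \<open>Labelled graphs and graphs of formulas\<close>

record ('a, 'l) lgraph =
  verts :: "'a set"
  edges :: "'a set set"
  label :: "'a \<Rightarrow> 'l"

definition graph :: "('a, 'l) lgraph \<Rightarrow> bool" where
  "graph G \<longleftrightarrow> finite (verts G) \<and> (\<forall>e\<in>edges G. e \<subseteq> verts G \<and> card e = 2)"

definition single :: "'a \<Rightarrow> 'l \<Rightarrow> ('a, 'l) lgraph" where
  "single v l = \<lparr>verts = {v}, edges = {}, label = (\<lambda>_. l)\<rparr>"

(* Both operations are only used for graphs with disjoint vertex sets. *)
definition gunion :: "('a, 'l) lgraph \<Rightarrow> ('a, 'l) lgraph \<Rightarrow> ('a, 'l) lgraph" where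
  "gunion G H = \<lparr>verts = verts G \<union> verts H, edges = edges G \<union> edges H,
     label = (\<lambda>v. if v \<in> verts G then label G v else label H v)\<rparr>"

definition gjoin :: "('a, 'l) lgraph \<Rightarrow> ('a, 'l) lgraph \<Rightarrow> ('a, 'l) lgraph" where
  "gjoin G H = \<lparr>verts = verts G \<union> verts H,
     edges = edges G \<union> edges H \<union> {{v, w} |v w. v \<in> verts G \<and> w \<in> verts H},
     label = (\<lambda>v. if v \<in> verts G then label G v else label H v)\<rparr>"

definition tag :: "bool \<Rightarrow> (bool list, 'l) lgraph \<Rightarrow> (bool list, 'l) lgraph" where
  "tag i G = \<lparr>verts = Cons i ` verts G, edges = (\<lambda>e. Cons i ` e) ` edges G,
     label = (\<lambda>v. label G (tl v))\<rparr>"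

datatype ('f, 'p, 'v) vlabel = Binder 'v | Literal "('f, 'p, 'v) atom"

(* The vertices are positions in the formula: each atom or quantifier occurrence is the
   path leading to it. *)
primrec graph_of :: "('f, 'p, 'v) fm \<Rightarrow> (bool list, ('f, 'p, 'v) vlabel) lgraph" where
  "graph_of (Atm a) = single [] (Literal a)"
| "graph_of (Conj \<phi> \<psi>) = gjoin (tag False (graph_of \<phi>)) (tag True (graph_of \<psi>))"
| "graph_of (Disj \<phi> \<psi>) = gunion (tag False (graph_of \<phi>)) (tag True (graph_of \<psi>))"
| "graph_of (All x \<phi>) = gunion (single [] (Binder x)) (tag True (graph_of \<phi>))"
| "graph_of (Ex x \<phi>) = gjoin (single [] (Binder x)) (tag True (graph_of \<phi>))"

section \<open>Fographs\<close>

definition cograph :: "('a, 'l) lgraph \<Rightarrow> bool" where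
  "cograph G \<longleftrightarrow> graph G \<and>
     \<not> (\<exists>a b c d. {a, b, c, d} \<subseteq> verts G \<and> distinct [a, b, c, d] \<and>
          {a, b} \<in> edges G \<and> {b, c} \<in> edges G \<and> {c, d} \<in> edges G \<and>
          {a, c} \<notin> edges G \<and> {b, d} \<notin> edges G \<and> {a, d} \<notin> edges G)"

definition neighbours :: "('a, 'l) lgraph \<Rightarrow> 'a \<Rightarrow> 'a set" where
  "neighbours G v = {w \<in> verts G. {v, w} \<in> edges G}"

definition graph_module :: "('a, 'l) lgraph \<Rightarrow> 'a set \<Rightarrow> bool" where
  "graph_module G M \<longleftrightarrow> M \<subseteq> verts G \<and>
     (\<forall>v\<in>M. \<forall>w\<in>M. neighbours G v - M = neighbours G w - M)"

definition strong_module :: "('a, 'l) lgraph \<Rightarrow> 'a set \<Rightarrow> bool" where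
  "strong_module G M \<longleftrightarrow> graph_module G M \<and>
     (\<forall>M'. graph_module G M' \<longrightarrow> M' \<inter> M = {} \<or> M' \<subseteq> M \<or> M \<subseteq> M')"

definition proper_strong_module :: "('a, 'l) lgraph \<Rightarrow> 'a set \<Rightarrow> bool" where
  "proper_strong_module G M \<longleftrightarrow> strong_module G M \<and> card M \<ge> 2"

type_synonym ('a, 'f, 'p, 'v) fograph = "('a, ('f, 'p, 'v) vlabel) lgraph"

definition literals :: "('a, 'f, 'p, 'v) fograph \<Rightarrow> 'a set" where
  "literals G = {v \<in> verts G. \<exists>a. label G v = Literal a}"

definition binders :: "('a, 'f, 'p, 'v) fograph \<Rightarrow> 'a set" where
  "binders G = {v \<in> verts G. \<exists>x. label G v = Binder x}"

definition logical_cograph :: "('a, 'f, 'p, 'v) fograph \<Rightarrow> bool" where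
  "logical_cograph G \<longleftrightarrow> cograph G \<and> literals G \<noteq> {}"

(* smallest with respect to inclusion *)
definition scope :: "('a, 'f, 'p, 'v) fograph \<Rightarrow> 'a \<Rightarrow> 'a set" where
  "scope G b = (LEAST M. proper_strong_module G M \<and> b \<in> M)"

definition existential :: "('a, 'f, 'p, 'v) fograph \<Rightarrow> 'a \<Rightarrow> bool" where
  "existential G b \<longleftrightarrow> b \<in> binders G \<and> (\<forall>v \<in> scope G b - {b}. {b, v} \<in> edges G)"

definition universal :: "('a, 'f, 'p, 'v) fograph \<Rightarrow> 'a \<Rightarrow> bool" where
  "universal G b \<longleftrightarrow> b \<in> binders G \<and> (\<forall>v \<in> scope G b - {b}. {b, v} \<notin> edges G)"

definition legal :: "('a, 'f, 'p, 'v) fograph \<Rightarrow> 'a \<Rightarrow> bool" where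
  "legal G b \<longleftrightarrow> scope G b \<inter> literals G \<noteq> {} \<and>
     (\<forall>c \<in> scope G b \<inter> binders G. label G c = label G b \<longrightarrow> c = b)"

definition fograph :: "('a, 'f, 'p, 'v) fograph \<Rightarrow> bool" where
  "fograph G \<longleftrightarrow> logical_cograph G \<and> (\<forall>b \<in> binders G. legal G b)"

definition binds :: "('a, 'f, 'p, 'v) fograph \<Rightarrow> 'a \<Rightarrow> 'a \<Rightarrow> bool" where
  "binds G b l \<longleftrightarrow> (\<exists>x a. b \<in> binders G \<and> label G b = Binder x \<and>
     l \<in> literals G \<inter> scope G b \<and> label G l = Literal a \<and> x \<in> atom_vars a)"

definition binding_graph :: "('a, 'f, 'p, 'v) fograph \<Rightarrow> ('a \<times> 'a) set" where
  "binding_graph G = {(b, l). binds G b l}"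

definition rectified_fograph :: "('a, 'f, 'p, 'v) fograph \<Rightarrow> bool" where
  "rectified_fograph G \<longleftrightarrow> fograph G \<and>
     (\<forall>b \<in> binders G. \<forall>x. label G b = Binder x \<longrightarrow>
        (\<forall>c \<in> binders G. label G c = Binder x \<longrightarrow> c = b) \<and>
        (\<forall>l \<in> literals G. \<forall>a. label G l = Literal a \<and> x \<in> atom_vars a \<longrightarrow> binds G b l))"

section \<open>Skew bifibrations\<close>

definition graph_hom ::
  "('a, 'l) lgraph \<Rightarrow> ('b, 'm) lgraph \<Rightarrow> ('a \<Rightarrow> 'b) \<Rightarrow> bool" where
  "graph_hom G H f \<longleftrightarrow> f ` verts G \<subseteq> verts H \<and>
     (\<forall>v\<in>verts G. \<forall>w\<in>verts G. {v, w} \<in> edges G \<longrightarrow> {f v, f w} \<in> edges H)"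

definition skew_fibration ::
  "('a, 'l) lgraph \<Rightarrow> ('b, 'm) lgraph \<Rightarrow> ('a \<Rightarrow> 'b) \<Rightarrow> bool" where
  "skew_fibration G H f \<longleftrightarrow> graph_hom G H f \<and>
     (\<forall>v\<in>verts G. \<forall>w\<in>verts H. {w, f v} \<in> edges H \<longrightarrow>
        (\<exists>w'\<in>verts G. {w', v} \<in> edges G \<and> {f w', w} \<notin> edges H))"

(* Directed graphs are given by a vertex set V and an edge set E. *)
definition directed_fibration ::
  "'a set \<Rightarrow> ('a \<times> 'a) set \<Rightarrow> 'b set \<Rightarrow> ('b \<times> 'b) set \<Rightarrow> ('a \<Rightarrow> 'b) \<Rightarrow> bool" where
  "directed_fibration V E V' E' f \<longleftrightarrow> f ` V \<subseteq> V' \<and>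
     (\<forall>(v, w)\<in>E. (f v, f w) \<in> E') \<and>
     (\<forall>v\<in>V. \<forall>w\<in>V'. (w, f v) \<in> E' \<longrightarrow> (\<exists>!w'. w' \<in> V \<and> (w', v) \<in> E \<and> f w' = w))"

definition skew_bifibration ::
  "('a, 'f, 'p, 'v) fograph \<Rightarrow> ('b, 'f, 'p, 'v) fograph \<Rightarrow> ('a \<Rightarrow> 'b) \<Rightarrow> bool" where
  "skew_bifibration G H f \<longleftrightarrow>
     fograph G \<and> fograph H \<and>
     (\<forall>v\<in>verts G. label H (f v) = label G v) \<and>
     (\<forall>b\<in>verts G. existential G b \<longrightarrow> existential H (f b)) \<and>
     skew_fibration G H f \<and>
     directed_fibration (verts G) (binding_graph G) (verts H) (binding_graph H) f"

section \<open>Fonets\<close>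

(* The set L of links is the partition. *)
definition linked_fograph :: "('a, 'f, 'p, 'v) fograph \<Rightarrow> 'a set set \<Rightarrow> bool" where
  "linked_fograph G L \<longleftrightarrow> fograph G \<and>
     (\<forall>k\<in>L. \<exists>v w a b. k = {v, w} \<and> v \<noteq> w \<and> v \<in> verts G \<and> w \<in> verts G \<and> {v, w} \<notin> edges G \<and>
        label G v = Literal a \<and> label G w = Literal b \<and> predual a b) \<and>
     (\<forall>k\<in>L. \<forall>k'\<in>L. k \<noteq> k' \<longrightarrow> k \<inter> k' = {}) \<and>
     (\<forall>v\<in>literals G. label G v = Literal Tru \<or> v \<in> \<Union>L)"

definition existential_vars :: "('a, 'f, 'p, 'v) fograph \<Rightarrow> 'v set" where
  "existential_vars G = {x. \<exists>b. existential G b \<and> label G b = Binder x}"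

(* Only the values of \<delta> at the variables of existential binders matter. *)
definition dualizer ::
  "('a, 'f, 'p, 'v) fograph \<Rightarrow> 'a set set \<Rightarrow> ('v \<Rightarrow> ('f, 'v) tm) \<Rightarrow> bool" where
  "dualizer G L \<delta> \<longleftrightarrow>
     (let \<sigma> = (\<lambda>x. if x \<in> existential_vars G then \<delta> x else Var x) in
      \<forall>v w a b. {v, w} \<in> L \<and> label G v = Literal a \<and> label G w = Literal b \<longrightarrow>
        subst_atom \<sigma> b = dual_atom (subst_atom \<sigma> a))"

definition dependencies :: "('a, 'f, 'p, 'v) fograph \<Rightarrow> 'a set set \<Rightarrow> 'a set set" where
  "dependencies G L = {{b, c} |b c. \<exists>x y. existential G b \<and> universal G c \<and>
     label G b = Binder x \<and> label G c = Binder y \<and>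
     (\<forall>\<delta>. dualizer G L \<delta> \<longrightarrow> y \<in> tm_vars (\<delta> x))}"

definition leap_edges :: "('a, 'f, 'p, 'v) fograph \<Rightarrow> 'a set set \<Rightarrow> 'a set set" where
  "leap_edges G L = L \<union> dependencies G L"

definition induces_matching :: "'a set set \<Rightarrow> 'a set \<Rightarrow> bool" where
  "induces_matching E W \<longleftrightarrow> W \<noteq> {} \<and> (\<forall>v\<in>W. \<exists>!w. w \<in> W \<and> {v, w} \<in> E)"

definition induces_bimatching ::
  "('a, 'f, 'p, 'v) fograph \<Rightarrow> 'a set set \<Rightarrow> 'a set \<Rightarrow> bool" where
  "induces_bimatching G L W \<longleftrightarrow> W \<subseteq> verts G \<and>
     induces_matching (edges G) W \<and> induces_matching (leap_edges G L) W"

(* In a fograph no binder lies in the scope of another one for the same variable, so each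
   occurrence of a variable in a literal is bound by at most one binder. *)
definition binds_var :: "('a, 'f, 'p, 'v) fograph \<Rightarrow> 'a \<Rightarrow> 'v \<Rightarrow> 'a \<Rightarrow> bool" where
  "binds_var G b x l \<longleftrightarrow> binds G b l \<and> label G b = Binder x"

definition graph_free_vars :: "('a, 'f, 'p, 'v) fograph \<Rightarrow> 'v set" where
  "graph_free_vars G = {x. \<exists>l a. l \<in> literals G \<and> label G l = Literal a \<and> x \<in> atom_vars a \<and>
     \<not> (\<exists>b. binds_var G b x l)}"

(* Each binder b gets the new variable r b, and so do the occurrences that b binds. *)
definition rename_binders ::
  "('a \<Rightarrow> 'v) \<Rightarrow> ('a, 'f, 'p, 'v) fograph \<Rightarrow> ('a, 'f, 'p, 'v) fograph" where
  "rename_binders r G = \<lparr>verts = verts G, edges = edges G,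
     label = (\<lambda>v. case label G v of
         Binder x \<Rightarrow> Binder (r v)
       | Literal a \<Rightarrow> Literal (map_atom id id
           (\<lambda>x. if \<exists>b. binds_var G b x v then r (THE b. binds_var G b x v) else x) a))\<rparr>"

definition rectified_form_graph ::
  "('a, 'f, 'p, 'v) fograph \<Rightarrow> ('a, 'f, 'p, 'v) fograph \<Rightarrow> bool" where
  "rectified_form_graph G H \<longleftrightarrow> rectified_fograph H \<and>
     (\<exists>r. r ` binders G \<inter> graph_free_vars G = {} \<and> H = rename_binders r G)"

(* Dualizers and leaps only make sense for rectified fographs.  A skew bifibration preserves
   labels, so its source is in general not rectified, and it is a fonet if a rectified form
   of it, which is unique up to the choice of the new variables, is one. *)
definition fonet :: "('a, 'f, 'p, 'v) fograph \<Rightarrow> 'a set set \<Rightarrow> bool" where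
  "fonet G L \<longleftrightarrow> linked_fograph G L \<and>
     (\<exists>H. rectified_form_graph G H \<and> (\<exists>\<delta>. dualizer H L \<delta>) \<and>
          \<not> (\<exists>W. induces_bimatching H L W))"

end

theory Submission
  imports Defs
begin

text \<open>A literal of the first-order form of a modal formula contains only the variable of the innermost
  quantifier around it. So every quantified subformula is closed and its truth value does not depend
  on the values of the outer variables.

  Soundness. In a model refuting the formula, the witnesses of all universal quantifiers can be fixed
  in advance, and the dualizer then gives a value to every binder of the fonet. If a maximal clique of
  the fonet consists of existential binders and true literals, its image meets a refuting maximal
  stable set of the formula, since skew fibrations of cographs pull back maximal stable sets to
  maximal stable sets. Otherwise some maximal stable set contains neither; its literals are false, so
  each is linked to a literal outside, which is adjacent to another literal of the set. A shortest
  cycle among these literals induces a bimatching because the graph has no induced four-vertex path.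

  Completeness. A search with labelled formulas, in which each universal quantifier is decomposed at
  most once per branch, ends in a countermodel or in a proof. The proof is read as a net: a conjunction
  joins the parts of two nets, a quantifier adds one vertex. A join creates no bimatching for reasons
  of parity, and an existential binder has no dependency at the time at which it gets its edges.\<close>

section \<open>Cographs\<close>

text \<open>Scopes are read off the modules of the graph, and this shapes completeness. A scope can
  be much larger than the body of its quantifier, so two copies of one universal binder that lie
  side by side can be in each other's scope and hence illegal. Copies of an existential binder
  exclude each other: the binder is adjacent to its whole scope, but never to a vertex with the same
  image. Copies of a universal binder need a neighbour that tells them apart. Therefore each
  universal quantifier is opened once per branch, and conjunctions wait until no disjunction or
  universal quantifier is left; every universal binder outside the parts to be joined then has a
  neighbour already. The leaps of the finished fonet depend on all its dualizers, but the
  construction knows only one. So the absence of bimatchings is carried along for every subset of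
  the leaps of that one. In soundness, universal variables get their values first because the terms
  of the dualizer contain them. The values of existential variables also depend on the clique at
  hand, since one quantifier can have many preimages.\<close>

definition p4_free :: "'a set \<Rightarrow> ('a \<Rightarrow> 'a \<Rightarrow> bool) \<Rightarrow> bool" where
  "p4_free V E \<longleftrightarrow> (\<forall>a\<in>V. \<forall>b\<in>V. \<forall>c\<in>V. \<forall>d\<in>V. distinct [a, b, c, d] \<and> E a b \<and> E b c \<and> E c d
     \<longrightarrow> E a c \<or> E b d \<or> E a d)"

lemma p4_freeD:
  assumes "p4_free V E" "a \<in> V" "b \<in> V" "c \<in> V" "d \<in> V" "E a b" "E b c" "E c d"
    "\<not> E a c" "\<not> E b d" "\<not> E a d" "distinct [a, b, c, d]"
  shows False
  using assms unfolding p4_free_def by blast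

lemma p4_free_subset: "p4_free V E \<Longrightarrow> A \<subseteq> V \<Longrightarrow> p4_free A E"
  unfolding p4_free_def by (meson subsetD)

definition compl_rel :: "('a \<Rightarrow> 'a \<Rightarrow> bool) \<Rightarrow> 'a \<Rightarrow> 'a \<Rightarrow> bool" where
  "compl_rel E u v \<longleftrightarrow> u \<noteq> v \<and> \<not> E u v"

text \<open>The complement of a path on four vertices is again such a path, in the order
  \<open>b\<close>, \<open>d\<close>, \<open>a\<close>, \<open>c\<close>.\<close>

lemma p4_free_compl:
  assumes "p4_free V E" "symp E"
  shows "p4_free V (compl_rel E)"
  unfolding p4_free_def
proof (intro ballI impI)
  fix a b c d assume V: "a \<in> V" "b \<in> V" "c \<in> V" "d \<in> V"
    and h: "distinct [a, b, c, d] \<and> compl_rel E a b \<and> compl_rel E b c \<and> compl_rel E c d"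
  show "compl_rel E a c \<or> compl_rel E b d \<or> compl_rel E a d"
  proof (rule ccontr)
    assume "\<not> ?thesis"
    then have "E a c" "E b d" "E a d" using h by (auto simp: compl_rel_def)
    then show False
      using p4_freeD[OF assms(1) V(2) V(4) V(1) V(3)] h sympD[OF assms(2)]
      unfolding compl_rel_def distinct.simps list.set by blast
  qed
qed

text \<open>Disconnectedness of the graph \<open>(V, E)\<close>. With \<open>compl_rel E\<close> in
  place of \<open>E\<close> it says that the graph is a join of two nonempty parts.\<close>

definition splits :: "'a set \<Rightarrow> ('a \<Rightarrow> 'a \<Rightarrow> bool) \<Rightarrow> bool" where
  "splits V E \<longleftrightarrow> (\<exists>A B. A \<union> B = V \<and> A \<inter> B = {} \<and> A \<noteq> {} \<and> B \<noteq> {} \<and> (\<forall>a\<in>A. \<forall>b\<in>B. \<not> E a b))"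

lemma splitsI:
  "A \<subseteq> V \<Longrightarrow> A \<noteq> {} \<Longrightarrow> A \<noteq> V \<Longrightarrow> (\<And>a b. a \<in> A \<Longrightarrow> b \<in> V \<Longrightarrow> b \<notin> A \<Longrightarrow> \<not> E a b) \<Longrightarrow> splits V E"
  unfolding splits_def by (rule exI[of _ A], rule exI[of _ "V - A"]) auto

text \<open>If \<open>v\<close> is adjacent to everything, it is isolated in the complement; if it
  has no neighbour in one of the two parts, this part stays separated. Otherwise one part contains a
  non-neighbour of \<open>v\<close> and the other a neighbour \<open>b\<close>. Then the
  non-neighbours of \<open>v\<close> in the first part are separated: an edge from such an
  \<open>x\<close> to a neighbour \<open>y\<close> of \<open>v\<close> in that part would extend to
  the induced path \<open>x\<close>, \<open>y\<close>, \<open>v\<close>, \<open>b\<close>.\<close>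

lemma splits_add_vertex:
  assumes p4: "p4_free (insert v V) E" and sym: "symp E" and v: "v \<notin> V" and s: "splits V E"
  shows "splits (insert v V) E \<or> splits (insert v V) (compl_rel E)"
proof -
  obtain A B where AB: "A \<union> B = V" "A \<inter> B = {}" "A \<noteq> {}" "B \<noteq> {}" "\<forall>a\<in>A. \<forall>b\<in>B. \<not> E a b"
    using s unfolding splits_def by blast
  have one: "splits (insert v V) E"
    if AB: "A \<union> B = V" "A \<inter> B = {}" "\<forall>a\<in>A. \<forall>b\<in>B. \<not> E a b"
      and a: "a \<in> A" "\<not> E a v" and b: "b \<in> B" "E b v" for A B a b
  proof -
    define A0 where "A0 = {a \<in> A. \<not> E a v}"
    have no: "\<not> E x y" if x: "x \<in> A0" and y: "y \<in> A - A0" for x y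
    proof
      assume "E x y"
      then show False
        using p4_freeD[OF p4, of x y v b] x y a b AB v sympD[OF sym, of b v]
        unfolding A0_def distinct.simps list.set by blast
    qed
    show ?thesis
    proof (rule splitsI[of A0])
      fix x y assume "x \<in> A0" "y \<in> insert v V" "y \<notin> A0"
      then show "\<not> E x y" using no AB unfolding A0_def by blast
    qed (use AB a v in \<open>auto simp: A0_def\<close>)
  qed
  have sep: ?thesis if A: "A \<subseteq> V" "A \<noteq> {}" "\<forall>a\<in>A. \<not> E a v" "\<And>a b. a \<in> A \<Longrightarrow> b \<in> V \<Longrightarrow> b \<notin> A \<Longrightarrow> \<not> E a b" for A
    using splitsI[of A "insert v V" E] A v by blast
  have BA: "\<forall>b\<in>B. \<forall>a\<in>A. \<not> E b a" using AB(5) sympD[OF sym] by blast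
  show ?thesis
  proof (cases "\<forall>u\<in>V. E u v")
    case True
    show ?thesis
    proof (rule disjI2, rule splitsI[of V])
      show "V \<noteq> insert v V" using v by auto
    qed (use True AB in \<open>auto simp: compl_rel_def\<close>)
  next
    case False
    have "?thesis" if "\<forall>a\<in>A. \<not> E a v" using sep[of A] that AB by blast
    moreover have "?thesis" if "\<forall>b\<in>B. \<not> E b v" using sep[of B] that AB BA by blast
    moreover have "?thesis" if "a \<in> A" "\<not> E a v" "b \<in> B" "E b v" for a b
      using one[OF AB(1,2,5)] that by blast
    moreover have "?thesis" if "a \<in> A" "E a v" "b \<in> B" "\<not> E b v" for a b
      using one[of B A, OF _ _ BA] AB that by blast
    ultimately show ?thesis using False AB(1) by blast
  qed
qed

lemma compl_compl: "compl_rel (compl_rel E) u v \<longleftrightarrow> u \<noteq> v \<and> E u v"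
  by (auto simp: compl_rel_def)

lemma splits_compl_compl: "splits V (compl_rel (compl_rel E)) \<longleftrightarrow> splits V E"
  unfolding splits_def compl_compl by (metis disjoint_iff)

text \<open>Seinsche's theorem on cographs, by adding one vertex at a time. Both alternatives of the
  induction hypothesis are handled by \<open>splits_add_vertex\<close>, once for the graph and once
  for its complement.\<close>

lemma p4_free_splits:
  assumes "finite V" "card V \<ge> 2" "symp E" "p4_free V E"
  shows "splits V E \<or> splits V (compl_rel E)"
  using assms
proof (induction V rule: finite_induct)
  case (insert v V)
  have p: "p4_free V E" using insert.prems(3) p4_free_subset by blast
  have sc: "symp (compl_rel E)" using insert.prems(2) by (auto simp: symp_def compl_rel_def)
  show ?case
  proof (cases "card V \<ge> 2")
    case True
    then consider "splits V E" | "splits V (compl_rel E)"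
      using insert.IH insert.prems p by blast
    then show ?thesis
    proof cases
      case 1
      then show ?thesis
        using splits_add_vertex[OF insert.prems(3,2) insert.hyps(2)] by blast
    next
      case 2
      then show ?thesis
        using splits_add_vertex[OF p4_free_compl[OF insert.prems(3,2)] sc insert.hyps(2)]
        unfolding splits_compl_compl by blast
    qed
  next
    case False
    then have "card V = 1" using insert by auto
    then obtain u where u: "V = {u}" by (auto simp: card_1_singleton_iff)
    have "u \<noteq> v" using u insert by auto
    then have "splits {v, u} E'" if "\<not> E' u v" for E'
      using that by (intro splitsI[of "{u}"]) auto
    from this[of E] this[of "compl_rel E"] show ?thesis unfolding u compl_rel_def by blast
  qed
qed simp

section \<open>Maximal stable sets and maximal cliques of cographs\<close>

definition max_stable :: "'a set \<Rightarrow> ('a \<Rightarrow> 'a \<Rightarrow> bool) \<Rightarrow> 'a set \<Rightarrow> bool" where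
  "max_stable V E K \<longleftrightarrow> K \<subseteq> V \<and> (\<forall>u\<in>K. \<forall>v\<in>K. u \<noteq> v \<longrightarrow> \<not> E u v) \<and> (\<forall>v\<in>V - K. \<exists>u\<in>K. E u v)"

abbreviation max_clique :: "'a set \<Rightarrow> ('a \<Rightarrow> 'a \<Rightarrow> bool) \<Rightarrow> 'a set \<Rightarrow> bool" where
  "max_clique V E C \<equiv> max_stable V (compl_rel E) C"

lemma max_stable_compl_compl: "max_stable V (compl_rel (compl_rel E)) K \<longleftrightarrow> max_stable V E K"
  unfolding max_stable_def compl_rel_def by (intro conj_cong refl ball_cong bex_cong) auto

lemma max_stable_no_edge:
  assumes "max_stable V E K" "\<And>v. \<not> E v v" "u \<in> K" "v \<in> K"
  shows "\<not> E u v"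
  using assms unfolding max_stable_def by metis

lemma max_stable_nonempty: "max_stable V E K \<Longrightarrow> V \<noteq> {} \<Longrightarrow> K \<noteq> {}"
  unfolding max_stable_def by blast

lemma max_stable_Un:
  assumes "max_stable A E K" "max_stable B E K'" "\<forall>a\<in>A. \<forall>b\<in>B. \<not> E a b" "symp E"
  shows "max_stable (A \<union> B) E (K \<union> K')"
proof -
  have n: "\<not> E b a" if "a \<in> A" "b \<in> B" for a b using assms(3,4) that sympD by metis
  show ?thesis
    unfolding max_stable_def
  proof (intro conjI ballI impI)
    show "K \<union> K' \<subseteq> A \<union> B" using assms unfolding max_stable_def by blast
  next
    fix u v assume "u \<in> K \<union> K'" "v \<in> K \<union> K'" "u \<noteq> v"
    then show "\<not> E u v" using assms(1-3) n unfolding max_stable_def by blast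
  next
    fix v assume "v \<in> A \<union> B - (K \<union> K')"
    then show "\<exists>u\<in>K \<union> K'. E u v" using assms(1,2) unfolding max_stable_def by blast
  qed
qed

text \<open>\<open>K\<close> is nonempty and no vertex of \<open>B\<close> is adjacent to it, so no
  vertex of \<open>B\<close> extends the clique.\<close>

lemma max_clique_disjoint_union:
  assumes "max_stable A (compl_rel E) K" "A \<noteq> {}" "\<forall>a\<in>A. \<forall>b\<in>B. \<not> E a b" "A \<inter> B = {}"
  shows "max_stable (A \<union> B) (compl_rel E) K"
proof -
  have "K \<noteq> {}" "K \<subseteq> A" using assms max_stable_nonempty unfolding max_stable_def by metis+
  show ?thesis
    unfolding max_stable_def
  proof (intro conjI ballI impI)
    fix v assume v: "v \<in> A \<union> B - K"
    show "\<exists>u\<in>K. compl_rel E u v"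
    proof (cases "v \<in> A")
      case True
      then show ?thesis using v assms(1) unfolding max_stable_def by blast
    next
      case False
      obtain u where "u \<in> K" using \<open>K \<noteq> {}\<close> by blast
      then have "compl_rel E u v" using False v assms(3,4) \<open>K \<subseteq> A\<close> unfolding compl_rel_def by blast
      then show ?thesis using \<open>u \<in> K\<close> by blast
    qed
  qed (use assms(1) in \<open>auto simp: max_stable_def\<close>)
qed

text \<open>The disjunctive and the conjunctive normal form of a cograph agree.\<close>

lemma max_clique_or_max_stable:
  assumes "finite V" "V \<noteq> {}" "symp E" "p4_free V E"
  shows "(\<exists>C. max_clique V E C \<and> C \<subseteq> T) \<or> (\<exists>K. max_stable V E K \<and> K \<inter> T = {})"
  using assms
proof (induction "card V" arbitrary: V E T rule: less_induct)
  case less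
  have step: "(\<exists>C. max_clique V E C \<and> C \<subseteq> T) \<or> (\<exists>K. max_stable V E K \<and> K \<inter> T = {})"
    if s: "splits V E" and E: "symp E" "p4_free V E" for E T
  proof -
    obtain A B where AB: "A \<union> B = V" "A \<inter> B = {}" "A \<noteq> {}" "B \<noteq> {}" "\<forall>a\<in>A. \<forall>b\<in>B. \<not> E a b"
      using s unfolding splits_def by blast
    have c: "card A < card V" "card B < card V"
      using AB less.prems(1) by (auto intro!: psubset_card_mono)
    have sub: "finite A" "finite B" "p4_free A E" "p4_free B E"
      using AB less.prems(1) finite_subset p4_free_subset[OF E(2)] by (metis Un_upper1 Un_upper2)+
    note A = less.hyps[OF c(1) sub(1) AB(3) E(1) sub(3), of T]
    note B = less.hyps[OF c(2) sub(2) AB(4) E(1) sub(4), of T]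
    from A show ?thesis
    proof
      assume "\<exists>C. max_clique A E C \<and> C \<subseteq> T"
      then show ?thesis using max_clique_disjoint_union[of A E _ B] AB by blast
    next
      assume KA: "\<exists>K. max_stable A E K \<and> K \<inter> T = {}"
      from B show ?thesis
      proof
        assume "\<exists>C. max_clique B E C \<and> C \<subseteq> T"
        then show ?thesis using max_clique_disjoint_union[of B E _ A] AB sympD[OF E(1)]
          unfolding Un_commute[of A B] Int_commute[of A B] by blast
      next
        assume "\<exists>K. max_stable B E K \<and> K \<inter> T = {}"
        then show ?thesis using KA max_stable_Un[of A E _ B] AB E(1)
          by (metis Int_Un_distrib2 Un_empty_right)
      qed
    qed
  qed
  have sc: "symp (compl_rel E)" using less.prems(3) by (auto simp: symp_def compl_rel_def)
  show ?case
  proof (cases "card V \<ge> 2")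
    case True
    then have "splits V E \<or> splits V (compl_rel E)" using p4_free_splits less.prems by blast
    then show ?thesis
    proof
      assume "splits V E" then show ?thesis using step less.prems by blast
    next
      assume "splits V (compl_rel E)"
      \<comment> \<open>Complementing exchanges cliques and stable sets, so the target set is
        complemented too: a maximal clique of the complement inside \<open>- T\<close> is a maximal
        stable set that avoids \<open>T\<close>.\<close>
      from step[OF this sc p4_free_compl[OF less.prems(4,3)], of "- T"]
      show ?thesis unfolding max_stable_compl_compl by blast
    qed
  next
    case False
    then have "card V = 1" using less.prems by (metis One_nat_def Suc_1 Suc_leI card_gt_0_iff le_antisym not_less_eq_eq)
    then obtain u where u: "V = {u}" by (auto simp: card_1_singleton_iff)
    show ?thesis
      unfolding u max_stable_def by (cases "u \<in> T") (auto intro!: exI[of _ "{u}"])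
  qed
qed

text \<open>Neighbourhoods in a stable set are laminar, and nested for adjacent vertices.\<close>

lemma stable_nbrs:
  assumes "p4_free V E" "symp E" "K \<subseteq> V" "\<forall>u\<in>K. \<forall>v\<in>K. \<not> E u v" "a \<in> V" "b \<in> V" "a \<noteq> b"
    and "a \<notin> K" "b \<notin> K"
    and "u \<in> K" "E u a" "\<not> E u b" "w \<in> K" "\<not> E w a" "E w b"
  shows "\<not> E a b" "\<And>t. t \<in> K \<Longrightarrow> E t a \<Longrightarrow> E t b \<Longrightarrow> False"
proof -
  note s = sympD[OF assms(2)]
  have ne: "u \<noteq> w" using assms by auto
  have wu: "u \<in> V" "w \<in> V" "\<not> E u w" "\<not> E a w" using assms s by blast+
  have d: "distinct [u, a, b, w]" using ne assms by auto
  show nab: "\<not> E a b"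
  proof
    assume "E a b"
    then show False
      using p4_freeD[OF assms(1), of u a b w] d assms(1,5,6,11,12,15) wu s[of w b]
      by blast
  qed
  fix t assume t: "t \<in> K" "E t a" "E t b"
  have "distinct [u, a, t, b]" using t d assms by auto
  then show False
    using p4_freeD[OF assms(1), of u a t b] t nab assms s[of t a] by blast
qed

text \<open>If \<open>C\<close> and \<open>K\<close> were disjoint, choose \<open>c\<close> in
  \<open>C\<close> with the fewest neighbours in \<open>K\<close>. Adjacent vertices have nested
  neighbourhoods in \<open>K\<close> by \<open>stable_nbrs\<close>, so a neighbour \<open>k\<close>
  of \<open>c\<close> in \<open>K\<close> is adjacent to all of \<open>C\<close>, against the
  maximality of the clique.\<close>

lemma max_clique_meets_max_stable:
  assumes fin: "finite V" and p4: "p4_free V E" and sym: "symp E" and ne: "V \<noteq> {}"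
    and C: "max_clique V E C" and K: "max_stable V E K" and irr: "\<And>v. \<not> E v v"
  shows "C \<inter> K \<noteq> {}"
proof
  assume dis: "C \<inter> K = {}"
  define N where "N c = {k \<in> K. E k c}" for c
  have Ks: "K \<subseteq> V" "\<forall>u\<in>K. \<forall>v\<in>K. \<not> E u v" using K max_stable_no_edge[OF K irr] unfolding max_stable_def by auto
  have CV: "C \<subseteq> V" using C unfolding max_stable_def by auto
  have Cne: "C \<noteq> {}" using max_stable_nonempty[OF C ne] .
  have finN: "finite (N c)" for c using Ks(1) fin unfolding N_def by (auto intro: finite_subset)
  obtain c where c: "c \<in> C" "\<And>d. d \<in> C \<Longrightarrow> card (N c) \<le> card (N d)"
    using ex_min_if_finite[of "(\<lambda>c. card (N c)) ` C"] Cne CV fin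
    by (metis (mono_tags, lifting) arg_min_if_finite(1) arg_min_least finite_subset)
  have Nne: "\<exists>k\<in>K. E k d" if "d \<in> C" for d
    using K that CV dis unfolding max_stable_def by blast
  obtain k where k: "k \<in> K" "E k c" using Nne c by blast
  have all: "E k d" if d: "d \<in> C" for d
  proof (rule ccontr)
    assume nk: "\<not> E k d"
    then have cd: "c \<noteq> d" using k by auto
    then have Ecd: "E c d" using C c d unfolding max_stable_def compl_rel_def by blast
    have "\<not> N d \<subset> N c" using c(2)[OF d] finN by (metis not_le psubset_card_mono)
    moreover have "k \<in> N c - N d" using k nk unfolding N_def by auto
    ultimately obtain w where w: "w \<in> N d - N c" by blast
    have "\<not> E c d"
      using stable_nbrs(1)[OF p4 sym Ks, of c d k w] w cd k nk c d CV dis unfolding N_def by blast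
    then show False using Ecd by simp
  qed
  have "k \<in> V - C" using k Ks dis by auto
  then obtain u where "u \<in> C" "compl_rel E u k" using C unfolding max_stable_def by blast
  then show False using all sympD[OF sym] unfolding compl_rel_def by blast
qed

section \<open>Preimages of maximal stable sets under skew fibrations\<close>

definition skew_fib :: "'a set \<Rightarrow> ('a \<Rightarrow> 'a \<Rightarrow> bool) \<Rightarrow> 'b set \<Rightarrow> ('b \<Rightarrow> 'b \<Rightarrow> bool) \<Rightarrow> ('a \<Rightarrow> 'b) \<Rightarrow> bool" where
  "skew_fib V E V' E' f \<longleftrightarrow> f ` V \<subseteq> V' \<and> (\<forall>u\<in>V. \<forall>v\<in>V. E u v \<longrightarrow> E' (f u) (f v)) \<and>
     (\<forall>v\<in>V. \<forall>w\<in>V'. E' w (f v) \<longrightarrow> (\<exists>u\<in>V. E u v \<and> \<not> E' (f u) w))"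

text \<open>Stability of the preimage is clear from the homomorphism. Domination of \<open>v\<close>
  goes by induction on the number of neighbours of \<open>f v\<close> in \<open>K\<close>. Suppose
  no neighbour of \<open>v\<close> is mapped into \<open>K\<close>, and let \<open>z\<close> be the
  neighbour of \<open>v\<close> whose image has the fewest neighbours in \<open>K\<close>. By
  skewness these are fewer than those of \<open>f v\<close>, so by induction \<open>z\<close> has a
  neighbour \<open>t\<close> with \<open>f t\<close> in \<open>K\<close>. Some \<open>k\<close> in
  \<open>K\<close> is adjacent to both \<open>f z\<close> and \<open>f v\<close>, and skewness gives
  a neighbour \<open>y\<close> of \<open>v\<close> with \<open>f y\<close> not adjacent to
  \<open>k\<close>. By minimality the neighbourhoods of \<open>f y\<close> and \<open>f z\<close> in
  \<open>K\<close> are incomparable, hence disjoint, and \<open>f y\<close>, \<open>f z\<close> are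
  not adjacent. So \<open>t\<close>, \<open>z\<close>, \<open>v\<close>, \<open>y\<close> is an
  induced path.\<close>

lemma skew_fib_max_stable:
  assumes fin: "finite V'" and p4: "p4_free V E" "p4_free V' E'" and sym: "symp E" "symp E'"
    and irr: "\<And>v. \<not> E v v" "\<And>v. \<not> E' v v"
    and f: "skew_fib V E V' E' f" and K: "max_stable V' E' K"
  shows "max_stable V E {v \<in> V. f v \<in> K}"
proof -
  note s = sympD[OF sym(1)] and s' = sympD[OF sym(2)]
  define N where "N w = {k \<in> K. E' k w}" for w
  have Ks: "K \<subseteq> V'" "\<forall>u\<in>K. \<forall>v\<in>K. \<not> E' u v" using K max_stable_no_edge[OF K irr(2)] unfolding max_stable_def by auto
  have fV: "f v \<in> V'" if "v \<in> V" for v using f that unfolding skew_fib_def by auto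
  have hom: "E' (f u) (f v)" if "u \<in> V" "v \<in> V" "E u v" for u v
    using f that unfolding skew_fib_def by auto
  have skew: "\<exists>u\<in>V. E u v \<and> \<not> E' (f u) w" if "v \<in> V" "w \<in> V'" "E' w (f v)" for v w
    using f that unfolding skew_fib_def by blast
  have finN: "finite (N w)" for w using Ks(1) fin unfolding N_def by (auto intro: finite_subset)
  have Nne: "N w \<noteq> {}" if "w \<in> V'" "w \<notin> K" for w
    using K that unfolding max_stable_def N_def by blast
  have "\<exists>u\<in>V. f u \<in> K \<and> E u v" if "v \<in> V" "f v \<notin> K" for v
    using that
  proof (induction "card (N (f v))" arbitrary: v rule: less_induct)
    case less
    have sub: "N (f z) \<subset> N (f v)"
      if z: "z \<in> V" "E z v" "f z \<notin> K" and k: "k \<in> N (f v)" "k \<notin> N (f z)" for z k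
    proof (rule ccontr)
      assume "\<not> N (f z) \<subset> N (f v)"
      then obtain w where w: "w \<in> N (f z)" "w \<notin> N (f v)" using k by blast
      have ne: "f v \<noteq> f z" using w by auto
      have "\<not> E' (f v) (f z)"
        using stable_nbrs(1)[OF p4(2) sym(2) Ks fV[OF less.prems(1)] fV[OF z(1)] ne, of k w] k w z less.prems
        unfolding N_def by blast
      then show False using hom[OF less.prems(1) z(1) s[OF z(2)]] by simp
    qed
    define Z where "Z = {z \<in> V. E z v}"
    obtain k0 where k0: "k0 \<in> N (f v)" using Nne less.prems fV by blast
    then obtain z0 where z0: "z0 \<in> V" "E z0 v" "\<not> E' (f z0) k0"
      using skew[OF less.prems(1), of k0] Ks unfolding N_def by blast
    show ?case
    proof (rule ccontr)
      assume no: "\<not> ?case"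
      have ZK: "f z \<notin> K" if "z \<in> Z" for z using no that unfolding Z_def by blast
      have z0Z: "z0 \<in> Z" using z0 unfolding Z_def by auto
      define z where "z = (ARG_MIN (\<lambda>z. card (N (f z))) z. z \<in> Z)"
      have z: "z \<in> Z" "\<And>y. y \<in> Z \<Longrightarrow> card (N (f z)) \<le> card (N (f y))"
        using arg_min_natI[of "\<lambda>z. z \<in> Z" z0] arg_min_nat_le[of "\<lambda>z. z \<in> Z"] z0Z
        unfolding z_def by auto
      have "N (f z0) \<subset> N (f v)"
        using sub[OF z0(1,2) ZK[OF z0Z] k0] z0(3) s' unfolding N_def by blast
      then have "card (N (f z0)) < card (N (f v))" using finN by (simp add: psubset_card_mono)
      then have lt: "card (N (f z)) < card (N (f v))" using z(2)[OF z0Z] by simp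
      have zV: "z \<in> V" "E z v" using z(1) unfolding Z_def by auto
      obtain t where t: "t \<in> V" "f t \<in> K" "E t z" using less.hyps[OF lt zV(1) ZK[OF z(1)]] by blast
      have ftz: "f t \<in> N (f z)" using t zV hom unfolding N_def by auto
      obtain k where k: "k \<in> N (f v)" "k \<in> N (f z)"
      proof -
        have "\<exists>k. k \<in> N (f v) \<and> k \<notin> N (f z)"
        proof (rule ccontr)
          assume "\<nexists>k. k \<in> N (f v) \<and> k \<notin> N (f z)"
          then have "N (f v) \<subseteq> N (f z)" by blast
          then show False using lt finN by (meson card_mono not_le)
        qed
        then have "N (f z) \<subset> N (f v)" using sub[OF zV ZK[OF z(1)]] by blast
        then show ?thesis using that ftz by blast
      qed
      obtain y where y: "y \<in> V" "E y v" "\<not> E' (f y) k"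
        using skew[OF less.prems(1), of k] k(1) Ks unfolding N_def by blast
      have yZ: "y \<in> Z" using y unfolding Z_def by auto
      have ky: "k \<notin> N (f y)" using y(3) s' unfolding N_def by blast
      have "\<not> N (f y) \<subset> N (f z)" using z(2)[OF yZ] finN by (metis not_le psubset_card_mono)
      then obtain w where w: "w \<in> N (f y)" "w \<notin> N (f z)" using ky k(2) by blast
      have ne: "f z \<noteq> f y" using w by auto
      have kk: "k \<in> K" "E' k (f z)" "\<not> E' k (f y)" "w \<in> K" "\<not> E' w (f z)" "E' w (f y)"
        using k(2) ky w unfolding N_def by auto
      note lam = stable_nbrs[OF p4(2) sym(2) Ks fV[OF zV(1)] fV[OF y(1)] ne ZK[OF z(1)] ZK[OF yZ] kk]
      have nzy: "\<not> E z y" using lam(1) hom zV y by blast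
      have nty: "\<not> E t y" using lam(2)[OF t(2)] hom t(1) y(1) t(3) zV(1) by blast
      have ntv: "\<not> E t v" using no t by blast
      have "t \<noteq> y" "z \<noteq> y" "t \<noteq> v" "t \<noteq> z" "z \<noteq> v" "v \<noteq> y"
        using t ZK[OF yZ] ne less.prems irr zV y by auto
      then show False
        using p4_freeD[OF p4(1), of t z v y] t zV y less.prems nzy nty ntv s[of y v] by auto
    qed
  qed
  then show ?thesis
    using Ks hom unfolding max_stable_def by (intro conjI ballI impI) blast+
qed

section \<open>Scopes\<close>

abbreviation adj :: "('a, 'l) lgraph \<Rightarrow> 'a \<Rightarrow> 'a \<Rightarrow> bool" where
  "adj G u v \<equiv> {u, v} \<in> edges G"

lemma symp_adj: "symp (adj G)"
  by (auto simp: symp_def insert_commute)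

lemma adj_commute: "adj G u v \<longleftrightarrow> adj G v u"
  by (simp add: insert_commute)

lemma adj_verts:
  assumes "graph G" "adj G u v"
  shows "u \<in> verts G" "v \<in> verts G" "u \<noteq> v"
  using assms unfolding graph_def by (fastforce simp: card_insert_if)+

lemma adj_irrefl: "graph G \<Longrightarrow> \<not> adj G v v"
  using adj_verts(3) by fastforce

lemma cographD: "cograph G \<Longrightarrow> graph G" "cograph G \<Longrightarrow> p4_free (verts G) (adj G)"
  unfolding cograph_def p4_free_def by (blast, fastforce)

lemma graph_module_iff:
  "graph_module G M \<longleftrightarrow> M \<subseteq> verts G \<and> (\<forall>u\<in>M. \<forall>v\<in>M. \<forall>w\<in>verts G - M. adj G u w \<longleftrightarrow> adj G v w)"
  unfolding graph_module_def neighbours_def by blast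

lemma graph_module_verts: "graph_module G M \<Longrightarrow> M \<subseteq> verts G"
  unfolding graph_module_def by (rule conjunct1)

lemma graph_moduleD:
  assumes "graph_module G M" "u \<in> M" "v \<in> M" "w \<in> verts G" "w \<notin> M" "adj G u w"
  shows "adj G v w"
  using assms unfolding graph_module_iff by blast

lemma proper_strong_module_verts: "card (verts G) \<ge> 2 \<Longrightarrow> proper_strong_module G (verts G)"
  unfolding proper_strong_module_def strong_module_def graph_module_iff by blast

lemma strong_module_comparable:
  assumes "strong_module G M" "graph_module G M'" "b \<in> M" "b \<in> M'"
  shows "M \<subseteq> M' \<or> M' \<subseteq> M"
  using assms unfolding strong_module_def by blast

lemma strong_moduleD: "strong_module G M \<Longrightarrow> graph_module G M"
  unfolding strong_module_def by blast

text \<open>Strong modules through \<open>b\<close> are comparable, so one of least cardinality is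
  least for inclusion, as \<open>scope\<close> demands.\<close>

lemma scope_least:
  assumes "graph G" "card (verts G) \<ge> 2" "b \<in> verts G"
  shows "proper_strong_module G (scope G b)" "b \<in> scope G b"
    "\<And>M. proper_strong_module G M \<Longrightarrow> b \<in> M \<Longrightarrow> scope G b \<subseteq> M"
proof -
  let ?P = "\<lambda>M. proper_strong_module G M \<and> b \<in> M"
  define S where "S = (ARG_MIN card M. ?P M)"
  have PV: "?P (verts G)" using proper_strong_module_verts assms by blast
  have S: "?P S" "\<And>M. ?P M \<Longrightarrow> card S \<le> card M"
    using arg_min_natI[of ?P, OF PV] arg_min_nat_le[of ?P] unfolding S_def by blast+
  have least: "S \<subseteq> M" if M: "?P M" for M
  proof -
    have "M \<subseteq> verts G"
      using M strong_moduleD[of G M] graph_module_verts[of G M] unfolding proper_strong_module_def by blast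
    then have "finite M" using assms(1) unfolding graph_def by (auto intro: finite_subset)
    moreover have "S \<subseteq> M \<or> M \<subseteq> S"
      using strong_module_comparable[of G S M b] S(1) M strong_moduleD[of G M]
      unfolding proper_strong_module_def by blast
    moreover have "finite S" using S(1) unfolding proper_strong_module_def by (auto intro: card_ge_0_finite)
    ultimately show ?thesis using S(2)[OF M] card_seteq by blast
  qed
  have "scope G b = S" unfolding scope_def using S(1) least by (intro Least_equality) auto
  then show "proper_strong_module G (scope G b)" "b \<in> scope G b"
    "\<And>M. proper_strong_module G M \<Longrightarrow> b \<in> M \<Longrightarrow> scope G b \<subseteq> M"
    using S least by auto
qed

text \<open>A body overlaps every proper strong module that contains its binder but not all of it.\<close>

lemma body_subset_scope:
  assumes "graph G" "graph_module G B" "graph_module G (insert b B)" "b \<notin> B" "B \<noteq> {}"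
  shows "insert b B \<subseteq> scope G b"
proof -
  have V: "insert b B \<subseteq> verts G" using assms(3) unfolding graph_module_iff by blast
  obtain x where x: "x \<in> B" using assms(5) by blast
  have "card {b, x} \<le> card (verts G)"
    using V x assms(1) unfolding graph_def by (intro card_mono) auto
  then have "card (verts G) \<ge> 2" using x assms(4) by (auto simp: card_insert_if split: if_splits)
  note S = scope_least[OF assms(1) this, of b]
  have str: "strong_module G (scope G b)" "card (scope G b) \<ge> 2" "b \<in> scope G b"
    using S V unfolding proper_strong_module_def by auto
  show ?thesis
  proof (rule ccontr)
    assume n: "\<not> ?thesis"
    have sub: "scope G b \<subseteq> insert b B"
      using strong_module_comparable[OF str(1) assms(3) str(3)] n by blast
    have "\<not> scope G b \<subseteq> {b}" using str(2) card_mono[of "{b}" "scope G b"] by auto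
    then obtain m where m: "m \<in> scope G b" "m \<in> B" using sub by blast
    then show False
      using strong_module_comparable[OF str(1) assms(2) m] str(3) n assms(4) by blast
  qed
qed

text \<open>Otherwise the connected component of the binder, or its component in the complement,
  would be a smaller proper strong module.\<close>

lemma scope_dichotomy:
  assumes co: "cograph G" and V: "card (verts G) \<ge> 2" "b \<in> verts G"
  shows "(\<forall>v\<in>scope G b - {b}. adj G b v) \<or> (\<forall>v\<in>scope G b - {b}. \<not> adj G b v)"
proof -
  note S = scope_least[OF cographD(1)[OF co] V]
  define M where "M = scope G b"
  have M: "strong_module G M" "card M \<ge> 2" "b \<in> M"
    using S unfolding M_def proper_strong_module_def by auto
  note Mm = strong_moduleD[OF M(1)]
  note MV = graph_module_verts[OF Mm]
  have finM: "finite M" using M(2) by (auto intro: card_ge_0_finite)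
  \<comment> \<open>\<open>R\<close> is adjacency or its complement, whichever splits the scope. The
    set \<open>D\<close> below is the connected component of \<open>b\<close> in \<open>M\<close>
    with respect to \<open>R\<close>.\<close>
  have key: "\<forall>v\<in>M - {b}. \<not> R b v"
    if s: "splits M R" and R: "R = adj G \<or> R = compl_rel (adj G)" for R
  proof -
    have symR: "R u v \<longleftrightarrow> R v u" for u v
      using R by (auto simp: compl_rel_def insert_commute)
    let ?P = "\<lambda>D. b \<in> D \<and> D \<subseteq> M \<and> (\<forall>u\<in>D. \<forall>v\<in>M - D. \<not> R u v)"
    define D where "D = (ARG_MIN card D. ?P D)"
    have PM: "?P M" using M by auto
    have D: "?P D" "\<And>D'. ?P D' \<Longrightarrow> card D \<le> card D'"
      using arg_min_natI[of ?P, OF PM] arg_min_nat_le[of ?P] unfolding D_def by blast+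
    obtain A B where AB: "A \<union> B = M" "A \<inter> B = {}" "A \<noteq> {}" "B \<noteq> {}" "\<forall>a\<in>A. \<forall>b\<in>B. \<not> R a b"
      using s unfolding splits_def by blast
    have BA: "\<forall>b\<in>B. \<forall>a\<in>A. \<not> R b a" using AB(5) symR by blast
    have "M - A = B" "M - B = A" using AB by auto
    then have "?P A \<or> ?P B" using AB BA M(3) by auto
    then have "card D < card M"
    proof
      assume P: "?P A"
      have "card A < card M" using AB finM by (intro psubset_card_mono) auto
      then show ?thesis using D(2)[OF P] by simp
    next
      assume P: "?P B"
      have "card B < card M" using AB finM by (intro psubset_card_mono) auto
      then show ?thesis using D(2)[OF P] by simp
    qed
    then have DM: "\<not> M \<subseteq> D" using D(1) by (metis less_irrefl subset_antisym)
    have finD: "finite D" using D(1) finM finite_subset by blast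
    have outR: "R u w \<longleftrightarrow> R v w" if "M' \<subseteq> verts G" "graph_module G M'" "u \<in> M'" "v \<in> M'" "w \<in> verts G" "w \<notin> M'" for M' u v w
    proof -
      have "adj G u w \<longleftrightarrow> adj G v w"
        using graph_moduleD[OF that(2,3,4,5,6)] graph_moduleD[OF that(2,4,3,5,6)] by blast
      moreover have "u \<noteq> w" "v \<noteq> w" using that by auto
      ultimately show ?thesis using R by (auto simp: compl_rel_def)
    qed
    have Dmod: "graph_module G D"
      unfolding graph_module_iff
    proof (intro conjI ballI)
      show "D \<subseteq> verts G" using D(1) MV by blast
      fix u v w assume uvw: "u \<in> D" "v \<in> D" "w \<in> verts G - D"
      show "adj G u w \<longleftrightarrow> adj G v w"
      proof (cases "w \<in> M")
        case True
        then have "\<not> R u w" "\<not> R v w" using D(1) uvw by auto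
        then show ?thesis using R uvw unfolding compl_rel_def by auto
      next
        case False
        then show ?thesis using Mm D(1) uvw unfolding graph_module_iff by blast
      qed
    qed
    have "strong_module G D"
      unfolding strong_module_def
    proof (intro conjI allI impI)
      show "graph_module G D" by fact
      fix M' assume M': "graph_module G M'"
      then have M'V: "M' \<subseteq> verts G" unfolding graph_module_iff by blast
      show "M' \<inter> D = {} \<or> M' \<subseteq> D \<or> D \<subseteq> M'"
      proof (rule ccontr)
        assume n: "\<not> ?thesis"
        then obtain d where d: "d \<in> D" "d \<in> M'" by blast
        have "M' \<subseteq> M" using strong_module_comparable[OF M(1) M', of d] d D(1) n by blast
        obtain m where m: "m \<in> M'" "m \<notin> D" using n by blast
        \<comment> \<open>The vertex \<open>m\<close> of \<open>M'\<close> outside \<open>D\<close>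
          has no \<open>R\<close>-edge to the part of \<open>D\<close> outside \<open>M'\<close>. As
          \<open>M'\<close> is a module, the part of \<open>D\<close> inside \<open>M'\<close> has
          none either, so \<open>D\<close> falls apart.\<close>
        have no: "\<not> R d1 d2" if "d1 \<in> D" "d1 \<in> M'" "d2 \<in> D" "d2 \<notin> M'" for d1 d2
        proof -
          have "\<not> R m d2" using D(1) m \<open>M' \<subseteq> M\<close> that symR by blast
          then show ?thesis using outR[OF M'V M', of d1 m d2] that m D(1) MV by blast
        qed
        define D' where "D' = (if b \<in> M' then D \<inter> M' else D - M')"
        have no': "\<not> R d2 d1" if "d1 \<in> D" "d1 \<in> M'" "d2 \<in> D" "d2 \<notin> M'" for d1 d2
          using no[OF that] symR[of d1 d2] by blast
        have "?P D'"
        proof (cases "b \<in> M'")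
          case True
          then show ?thesis using D(1) no unfolding D'_def by (simp, blast)
        next
          case False
          then show ?thesis using D(1) no' unfolding D'_def by (simp, blast)
        qed
        moreover have "D' \<subset> D" using n d unfolding D'_def by (auto split: if_splits)
        ultimately show False using D(2) finD by (meson not_le psubset_card_mono)
      qed
    qed
    \<comment> \<open>As a strong module properly inside the scope, \<open>D\<close> cannot have two
      vertices. So it consists of \<open>b\<close> alone, which means that \<open>b\<close> has no
      \<open>R\<close>-neighbour in \<open>M\<close>.\<close>
    then have "card D < 2" using S(3)[of D] D(1) DM unfolding M_def proper_strong_module_def by force
    moreover have "card D \<noteq> 0" using D(1) finD by auto
    ultimately have "card D = 1" by linarith
    then have "D = {b}" using D(1) by (auto simp: card_1_singleton_iff)
    then show ?thesis using D(1) by blast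
  qed
  have "splits M (adj G) \<or> splits M (compl_rel (adj G))"
    using p4_free_splits[OF finM M(2) symp_adj] p4_free_subset[OF cographD(2)[OF co] MV] by blast
  then show ?thesis
  proof
    assume "splits M (adj G)"
    from key[OF this] show ?thesis unfolding M_def by blast
  next
    assume "splits M (compl_rel (adj G))"
    from key[OF this] have "\<forall>v\<in>M - {b}. \<not> compl_rel (adj G) b v" by blast
    then show ?thesis by (auto simp: M_def compl_rel_def)
  qed
qed

subsection \<open>Fographs\<close>

lemma fographD:
  assumes "fograph G"
  shows "cograph G" "graph G" "p4_free (verts G) (adj G)" "literals G \<noteq> {}"
    "b \<in> binders G \<Longrightarrow> legal G b"
  using assms cographD unfolding fograph_def logical_cograph_def by blast+

lemma binder_not_literal: "b \<in> binders G \<Longrightarrow> b \<notin> literals G"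
  unfolding binders_def literals_def by auto

lemma fograph_card:
  assumes "fograph G" "b \<in> binders G"
  shows "card (verts G) \<ge> 2" "b \<in> verts G"
proof -
  obtain l where l: "l \<in> literals G" using fographD(4)[OF assms(1)] by blast
  show b: "b \<in> verts G" using assms(2) unfolding binders_def by blast
  have "l \<noteq> b" using l binder_not_literal[OF assms(2)] by auto
  moreover have "card {b, l} \<le> card (verts G)"
    using l b fographD(2)[OF assms(1)] unfolding graph_def literals_def by (intro card_mono) auto
  ultimately show "card (verts G) \<ge> 2" by (auto simp: card_insert_if split: if_splits)
qed

lemma fograph_scope:
  assumes "fograph G" "b \<in> binders G"
  shows "strong_module G (scope G b)" "graph_module G (scope G b)" "b \<in> scope G b"
    "scope G b \<subseteq> verts G"
proof -
  note S = scope_least(1,2)[OF fographD(2)[OF assms(1)] fograph_card[OF assms]]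
  show "strong_module G (scope G b)" using S(1) unfolding proper_strong_module_def by blast
  then show "graph_module G (scope G b)" by (rule strong_moduleD)
  then show "scope G b \<subseteq> verts G" by (rule graph_module_verts)
qed (rule scope_least(2)[OF fographD(2)[OF assms(1)] fograph_card[OF assms]])

lemma not_existential_nonadj:
  assumes "fograph G" "b \<in> binders G" "\<not> existential G b" "v \<in> scope G b"
  shows "\<not> adj G b v"
  using scope_dichotomy[OF fographD(1)[OF assms(1)] fograph_card[OF assms(1,2)]] assms
    adj_irrefl[OF fographD(2)[OF assms(1)]]
  unfolding existential_def by (cases "v = b") auto

lemma existential_adj: "existential G b \<Longrightarrow> v \<in> scope G b \<Longrightarrow> v \<noteq> b \<Longrightarrow> adj G b v"
  unfolding existential_def by blast

lemma existential_if_adj_body: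
  assumes "fograph G" "b \<in> binders G" "v \<in> scope G b" "adj G b v"
  shows "existential G b"
  using not_existential_nonadj[OF assms(1,2) _ assms(3)] assms(4) by blast

lemma scope_nested:
  assumes "fograph G" "b \<in> binders G" "c \<in> binders G" "v \<in> scope G b" "v \<in> scope G c"
  shows "scope G b \<subseteq> scope G c \<or> scope G c \<subseteq> scope G b"
  using strong_module_comparable[OF fograph_scope(1)[OF assms(1,2)] fograph_scope(2)[OF assms(1,3)] assms(4,5)] .

text \<open>Both scopes contain \<open>l\<close>, so they are nested, and legality allows only one
  binder with this label in the larger one.\<close>

lemma binds_unique:
  assumes "fograph G" "binds G b l" "binds G c l" "label G b = label G c"
  shows "b = c"
proof -
  have bc: "b \<in> binders G" "c \<in> binders G" "l \<in> scope G b" "l \<in> scope G c"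
    using assms unfolding binds_def by auto
  have "b \<in> scope G c \<or> c \<in> scope G b"
    using scope_nested[OF assms(1) bc] fograph_scope(3)[OF assms(1)] bc by blast
  then show ?thesis
    using fographD(5)[OF assms(1)] bc assms(4) unfolding legal_def by force
qed

section \<open>Skew bifibrations between fographs\<close>

lemma skew_fibration_iff:
  "skew_fibration G H f \<longleftrightarrow> skew_fib (verts G) (adj G) (verts H) (adj H) f"
  unfolding skew_fibration_def graph_hom_def skew_fib_def by blast

lemma skew_bifibrationD:
  assumes "skew_bifibration G H f"
  shows "fograph G" "fograph H" "v \<in> verts G \<Longrightarrow> label H (f v) = label G v"
    "existential G b \<Longrightarrow> existential H (f b)"
    "skew_fib (verts G) (adj G) (verts H) (adj H) f"
    "v \<in> verts G \<Longrightarrow> f v \<in> verts H"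
    "u \<in> verts G \<Longrightarrow> v \<in> verts G \<Longrightarrow> adj G u v \<Longrightarrow> adj H (f u) (f v)"
    "binds G b l \<Longrightarrow> binds H (f b) (f l)"
    "v \<in> verts G \<Longrightarrow> binds H w (f v) \<Longrightarrow> \<exists>b. binds G b v \<and> f b = w"
proof -
  note a = assms[unfolded skew_bifibration_def skew_fibration_iff]
  show "fograph G" "fograph H" "v \<in> verts G \<Longrightarrow> label H (f v) = label G v"
    "skew_fib (verts G) (adj G) (verts H) (adj H) f"
    using a by auto
  show "existential G b \<Longrightarrow> existential H (f b)"
    using a unfolding existential_def binders_def by auto
  show "v \<in> verts G \<Longrightarrow> f v \<in> verts H"
    "u \<in> verts G \<Longrightarrow> v \<in> verts G \<Longrightarrow> adj G u v \<Longrightarrow> adj H (f u) (f v)"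
    using a unfolding skew_fib_def by auto
  show "binds G b l \<Longrightarrow> binds H (f b) (f l)"
    using a unfolding directed_fibration_def binding_graph_def by auto
  have "w \<in> verts H" if "binds H w (f v)"
    using that unfolding binds_def binders_def by auto
  then show "v \<in> verts G \<Longrightarrow> binds H w (f v) \<Longrightarrow> \<exists>b. binds G b v \<and> f b = w"
    using a unfolding directed_fibration_def binding_graph_def by blast
qed

text \<open>A non-existential binder cannot lie over an existential one if it binds a literal: lifting
  the edge from that literal to the existential would give a neighbour of the binder with the
  same image.\<close>

lemma existential_reflected:
  assumes f: "skew_bifibration G H f" and b: "binds G b l" and ex: "existential H (f b)"
  shows "existential G b"
proof (rule ccontr)
  assume n: "\<not> existential G b"
  note D = skew_bifibrationD[OF f]
  have B: "b \<in> binders G" "l \<in> verts G" "l \<in> scope G b" "b \<in> verts G"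
    using b unfolding binds_def literals_def binders_def by auto
  have fb: "binds H (f b) (f l)" using D(8) b .
  have fB: "f b \<in> binders H" "f l \<in> scope H (f b)" "f l \<in> literals H" using fb unfolding binds_def by auto
  have ne: "f l \<noteq> f b" using fB binder_not_literal by metis
  have "adj H (f b) (f l)" using existential_adj[OF ex fB(2)] ne by auto
  then obtain w where w: "w \<in> verts G" "adj G w l" "\<not> adj H (f w) (f b)"
    using D(5) B D(6)[OF B(4)] unfolding skew_fib_def by blast
  have fw: "f w \<in> verts H" "adj H (f w) (f l)" using D(6,7) w B by auto
  have "f w \<in> scope H (f b)"
  proof (rule ccontr)
    assume "f w \<notin> scope H (f b)"
    then have "adj H (f b) (f w)"
      using graph_moduleD[OF fograph_scope(2)[OF D(2) fB(1)] fB(2) fograph_scope(3)[OF D(2) fB(1)]]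
        fw adj_commute by metis
    then show False using w(3) adj_commute by metis
  qed
  \<comment> \<open>Every other vertex of the scope of \<open>f b\<close> is adjacent to
    \<open>f b\<close>, so \<open>w\<close> is a second vertex over the same binder.\<close>
  then have eq: "f w = f b" using existential_adj[OF ex] w(3) adj_commute by metis
  have lab: "label G w = label G b" using D(3) w(1) B(4) eq by metis
  then have wb: "w \<in> binders G" using B(1) w(1) unfolding binders_def by auto
  have "\<not> adj G b l" using not_existential_nonadj[OF D(1) B(1) n B(3)] .
  then have "w \<noteq> b" using w(2) by auto
  then have "w \<notin> scope G b" using fographD(5)[OF D(1) B(1)] wb lab unfolding legal_def by blast
  then have "adj G b w"
    using graph_moduleD[OF fograph_scope(2)[OF D(1) B(1)] B(3) fograph_scope(3)[OF D(1) B(1)] w(1)]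
      w(2) adj_commute by metis
  then have "adj H (f b) (f w)" using D(7) B w by blast
  then show False using eq adj_irrefl[OF fographD(2)[OF D(2)]] by auto
qed

text \<open>Every vertex of the clique is adjacent to \<open>b\<close>: inside the scope because
  \<open>b\<close> is existential, outside because it is adjacent to \<open>l\<close> and the scope
  is a module.\<close>

lemma existential_in_max_clique:
  assumes "fograph G" "max_clique (verts G) (adj G) C" "l \<in> C" "binds G b l" "existential G b"
  shows "b \<in> C"
proof (rule ccontr)
  assume n: "b \<notin> C"
  have B: "b \<in> binders G" "l \<in> scope G b" "b \<in> verts G" "l \<noteq> b"
    using assms(4) binder_not_literal unfolding binds_def binders_def by auto
  then obtain c where c: "c \<in> C" "\<not> adj G c b"
    using assms(2) n unfolding max_stable_def compl_rel_def by blast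
  have cV: "c \<in> verts G" "c \<noteq> b" using c n assms(2) unfolding max_stable_def by auto
  show False
  proof (cases "c \<in> scope G b")
    case True
    then show False using existential_adj[OF assms(5)] c cV adj_commute by metis
  next
    case False
    then have "c \<noteq> l" using B by auto
    moreover have "c \<noteq> l \<Longrightarrow> \<not> compl_rel (adj G) c l" using assms(2,3) c(1) unfolding max_stable_def by blast
    ultimately have "adj G l c" unfolding compl_rel_def using adj_commute by metis
    then show False
      using graph_moduleD[OF fograph_scope(2)[OF assms(1) B(1)] B(2) fograph_scope(3)[OF assms(1) B(1)] cV(1) False]
        c adj_commute by metis
  qed
qed

text \<open>Legality provides a literal \<open>l\<close> in the scope. If \<open>l\<close> is not in
  \<open>K\<close>, a vertex \<open>u\<close> of \<open>K\<close> adjacent to it lies in the scope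
  too, for otherwise the module property would make \<open>u\<close> adjacent to \<open>b\<close>.
  If \<open>u\<close> is a binder, it is not existential, so \<open>l\<close> is outside its scope,
  which is therefore strictly smaller.\<close>

lemma stable_literal_in_scope:
  assumes G: "fograph G" and K: "max_stable (verts G) (adj G) K"
    and noex: "\<forall>b\<in>K. \<not> existential G b" and lab: "verts G = literals G \<union> binders G"
    and b: "b \<in> K" "b \<in> binders G"
  shows "\<exists>k\<in>K. k \<in> literals G \<inter> scope G b"
  using b
proof (induction "card (scope G b)" arbitrary: b rule: less_induct)
  case less
  note irr = adj_irrefl[OF fographD(2)[OF G]]
  note Sb = fograph_scope[OF G less.prems(2)]
  obtain l where l: "l \<in> literals G" "l \<in> scope G b"
    using fographD(5)[OF G less.prems(2)] unfolding legal_def by blast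
  show ?case
  proof (cases "l \<in> K")
    case False
    have lV: "l \<in> verts G" using l unfolding literals_def by auto
    then obtain u where u: "u \<in> K" "adj G u l" using K False unfolding max_stable_def by blast
    have uV: "u \<in> verts G" using u K unfolding max_stable_def by blast
    have "u \<in> scope G b"
    proof (rule ccontr)
      assume "u \<notin> scope G b"
      then have "adj G b u" using graph_moduleD[OF Sb(2) l(2) Sb(3) uV] u adj_commute by metis
      then show False using max_stable_no_edge[OF K irr] u(1) less.prems(1) by blast
    qed
    show ?thesis
    proof (cases "u \<in> literals G")
      case True
      then show ?thesis using u \<open>u \<in> scope G b\<close> by blast
    next
      case False
      then have ub: "u \<in> binders G" using uV lab by blast
      note Su = fograph_scope[OF G ub]
      have "l \<notin> scope G u" using not_existential_nonadj[OF G ub] noex u by blast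
      moreover have "scope G u \<subseteq> scope G b \<or> scope G b \<subseteq> scope G u"
        using scope_nested[OF G ub less.prems(2) Su(3) \<open>u \<in> scope G b\<close>] .
      ultimately have s: "scope G u \<subset> scope G b" using l by blast
      have "finite (scope G b)"
        using Sb(4) fographD(2)[OF G] finite_subset unfolding graph_def by blast
      then have "card (scope G u) < card (scope G b)" using s psubset_card_mono by blast
      then show ?thesis using less.hyps[OF _ u(1) ub] s by blast
    qed
  qed (use l in blast)
qed

text \<open>If a binder of \<open>K\<close> is adjacent to \<open>w\<close>, it is not existential,
  so \<open>w\<close> lies outside its scope. The scope being a module, any literal of
  \<open>K\<close> in it is adjacent to \<open>w\<close> as well.\<close>

lemma max_stable_adj_literal:
  assumes G: "fograph G" and K: "max_stable (verts G) (adj G) K"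
    and noex: "\<forall>b\<in>K. \<not> existential G b" and lab: "verts G = literals G \<union> binders G"
    and w: "w \<in> verts G" "w \<notin> K"
  shows "\<exists>k\<in>K. k \<in> literals G \<and> adj G w k"
proof -
  obtain u where u: "u \<in> K" "adj G u w" using K w unfolding max_stable_def by blast
  show ?thesis
  proof (cases "u \<in> literals G")
    case True
    then show ?thesis using u adj_commute by metis
  next
    case False
    then have ub: "u \<in> binders G" using u K lab unfolding max_stable_def by blast
    obtain k where k: "k \<in> K" "k \<in> literals G" "k \<in> scope G u"
      using stable_literal_in_scope[OF G K noex lab u(1) ub] by blast
    note Su = fograph_scope[OF G ub]
    have "w \<notin> scope G u" using not_existential_nonadj[OF G ub] noex u by blast
    then have "adj G k w" using graph_moduleD[OF Su(2,3) k(3) w(1)] u by blast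
    then show ?thesis using k adj_commute by metis
  qed
qed

lemma verts_literals_binders: "verts G = literals G \<union> binders G"
  unfolding literals_def binders_def by (auto, metis vlabel.exhaust)

section \<open>Graphs of formulas\<close>

text \<open>Paths may also end at a conjunction or disjunction, which is not a vertex of the graph.
  Below a quantifier only \<open>True\<close> leads on, in line with
  \<open>graph_of\<close>.\<close>

fun sub :: "('f, 'p, 'v) fm \<Rightarrow> bool list \<Rightarrow> ('f, 'p, 'v) fm option" where
  "sub \<psi> [] = Some \<psi>"
| "sub (Conj \<phi> \<psi>) (i # p) = sub (if i then \<psi> else \<phi>) p"
| "sub (Disj \<phi> \<psi>) (i # p) = sub (if i then \<psi> else \<phi>) p"
| "sub (All x \<phi>) (i # p) = (if i then sub \<phi> p else None)"
| "sub (Ex x \<phi>) (i # p) = (if i then sub \<phi> p else None)"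
| "sub (Atm a) (i # p) = None"

lemma sub_append: "sub \<psi> (p @ q) = Option.bind (sub \<psi> p) (\<lambda>\<chi>. sub \<chi> q)"
  by (induction \<psi> p rule: sub.induct) auto

fun vlab :: "('f, 'p, 'v) fm \<Rightarrow> ('f, 'p, 'v) vlabel option" where
  "vlab (Atm a) = Some (Literal a)"
| "vlab (All x \<phi>) = Some (Binder x)"
| "vlab (Ex x \<phi>) = Some (Binder x)"
| "vlab _ = None"

lemma verts_graph_ops [simp]:
  "verts (single v l) = {v}" "verts (gunion G H) = verts G \<union> verts H"
  "verts (gjoin G H) = verts G \<union> verts H" "verts (tag i K) = Cons i ` verts K"
  "label (single v l) = (\<lambda>_. l)" "label (tag i K) = (\<lambda>v. label K (tl v))"
  "label (gunion G H) = (\<lambda>v. if v \<in> verts G then label G v else label H v)"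
  "label (gjoin G H) = (\<lambda>v. if v \<in> verts G then label G v else label H v)"
  by (auto simp: single_def gunion_def gjoin_def tag_def)

lemma adj_single: "\<not> adj (single v l) u w"
  by (simp add: single_def)

lemma adj_gunion: "adj (gunion G H) u v \<longleftrightarrow> adj G u v \<or> adj H u v"
  by (simp add: gunion_def)

lemma adj_gjoin: "adj (gjoin G H) u v \<longleftrightarrow> adj G u v \<or> adj H u v \<or>
    (u \<in> verts G \<and> v \<in> verts H) \<or> (v \<in> verts G \<and> u \<in> verts H)"
  by (auto simp: gjoin_def doubleton_eq_iff)

lemma adj_tag: "adj (tag i G) u v \<longleftrightarrow> (\<exists>u' v'. u = i # u' \<and> v = i # v' \<and> adj G u' v')"
proof
  assume "adj (tag i G) u v"
  then obtain e where e: "e \<in> edges G" "{u, v} = Cons i ` e" unfolding tag_def by auto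
  from e(2) have "u \<in> Cons i ` e" "v \<in> Cons i ` e" by (metis insertI1, metis insertI1 insertI2)
  then obtain u' v' where uv: "u = i # u'" "v = i # v'" "u' \<in> e" "v' \<in> e" by blast
  have "Cons i ` e = Cons i ` {u', v'}" using e(2) uv by simp
  moreover have "inj (Cons i)" by (simp add: inj_def)
  ultimately have "e = {u', v'}" by (simp only: inj_image_eq_iff)
  then show "\<exists>u' v'. u = i # u' \<and> v = i # v' \<and> adj G u' v'" using e uv by blast
next
  assume "\<exists>u' v'. u = i # u' \<and> v = i # v' \<and> adj G u' v'"
  then obtain u' v' where uv: "u = i # u'" "v = i # v'" "adj G u' v'" by blast
  then have "{u, v} = Cons i ` {u', v'}" by simp
  then show "adj (tag i G) u v" using uv(3) unfolding tag_def by (metis image_eqI lgraph.select_convs(2))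
qed

abbreviation fverts :: "('f, 'p, 'v) fm \<Rightarrow> bool list set" where
  "fverts \<psi> \<equiv> verts (graph_of \<psi>)"

abbreviation fadj :: "('f, 'p, 'v) fm \<Rightarrow> bool list \<Rightarrow> bool list \<Rightarrow> bool" where
  "fadj \<psi> \<equiv> adj (graph_of \<psi>)"

lemma fverts_iff: "p \<in> fverts \<psi> \<longleftrightarrow> (\<exists>\<chi> l. sub \<psi> p = Some \<chi> \<and> vlab \<chi> = Some l)"
proof (induction \<psi> p rule: sub.induct)
  case (1 \<psi>) then show ?case by (cases \<psi>) auto
qed (auto split: if_splits)

lemma flabel: "sub \<psi> p = Some \<chi> \<Longrightarrow> vlab \<chi> = Some l \<Longrightarrow> label (graph_of \<psi>) p = l"
proof (induction \<psi> p rule: sub.induct)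
  case (1 \<psi>) then show ?case by (cases \<psi>) auto
next
  case (2 \<phi> \<psi> i p)
  then have "p \<in> fverts (if i then \<psi> else \<phi>)" using fverts_iff by fastforce
  then show ?case using 2 by (auto split: if_splits)
next
  case (3 \<phi> \<psi> i p)
  then have "p \<in> fverts (if i then \<psi> else \<phi>)" using fverts_iff by fastforce
  then show ?case using 3 by (auto split: if_splits)
qed (auto split: if_splits)

lemma graph_graph_of: "graph (graph_of \<psi>)"
proof (induction \<psi>)
  case (Conj \<psi>1 \<psi>2)
  then show ?case
    by (auto simp: graph_def gjoin_def tag_def card_image card_insert_if image_iff) blast
next
  case (Disj \<psi>1 \<psi>2)
  then show ?case
    by (auto simp: graph_def gunion_def tag_def card_image) (metis imageI subsetD)+
next
  case (All x \<psi>)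
  then show ?case by (auto simp: graph_def gunion_def tag_def single_def card_image)
next
  case (Ex x \<psi>)
  then show ?case
    by (auto simp: graph_def gjoin_def tag_def single_def card_image card_insert_if image_iff)
qed (auto simp: graph_def single_def)

lemma fadj_simps [simp]:
  "\<not> fadj (Atm a) u v"
  "fadj (Conj \<phi> \<psi>) (i # u) (j # v) \<longleftrightarrow> (if i = j then fadj (if i then \<psi> else \<phi>) u v
     else u \<in> fverts (if i then \<psi> else \<phi>) \<and> v \<in> fverts (if j then \<psi> else \<phi>))"
  "fadj (Disj \<phi> \<psi>) (i # u) (j # v) \<longleftrightarrow> i = j \<and> fadj (if i then \<psi> else \<phi>) u v"
  "\<not> fadj (All x \<phi>) [] v" "\<not> fadj (All x \<phi>) v []"
  "fadj (All x \<phi>) (i # u) (j # v) \<longleftrightarrow> i \<and> j \<and> fadj \<phi> u v"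
  "fadj (Ex x \<phi>) [] (i # v) \<longleftrightarrow> i \<and> v \<in> fverts \<phi>" "fadj (Ex x \<phi>) (i # v) [] \<longleftrightarrow> i \<and> v \<in> fverts \<phi>"
  "fadj (Ex x \<phi>) (i # u) (j # v) \<longleftrightarrow> i \<and> j \<and> fadj \<phi> u v"
  by (auto simp: adj_single adj_gjoin adj_gunion adj_tag split: if_splits)

lemma fadj_irrefl: "\<not> fadj \<psi> v v"
  by (rule adj_irrefl[OF graph_graph_of])

lemma fverts_simps:
  "fverts (Conj \<phi> \<psi>) = Cons False ` fverts \<phi> \<union> Cons True ` fverts \<psi>"
  "fverts (Disj \<phi> \<psi>) = Cons False ` fverts \<phi> \<union> Cons True ` fverts \<psi>"
  "fverts (All x \<phi>) = insert [] (Cons True ` fverts \<phi>)"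
  "fverts (Ex x \<phi>) = insert [] (Cons True ` fverts \<phi>)"
  by auto

declare graph_of.simps(2-5) [simp del] fverts_simps [simp]

lemma p4_free_fadj: "p4_free (fverts \<psi>) (fadj \<psi>)"
proof (induction \<psi>)
  case (Conj \<phi> \<psi>)
  show ?case
    unfolding p4_free_def
  proof (intro ballI impI)
    fix a b c d assume V: "a \<in> fverts (Conj \<phi> \<psi>)" "b \<in> fverts (Conj \<phi> \<psi>)" "c \<in> fverts (Conj \<phi> \<psi>)" "d \<in> fverts (Conj \<phi> \<psi>)"
      and h: "distinct [a, b, c, d] \<and> fadj (Conj \<phi> \<psi>) a b \<and> fadj (Conj \<phi> \<psi>) b c \<and> fadj (Conj \<phi> \<psi>) c d"
    obtain i a' j b' k c' l d' where e: "a = i # a'" "b = j # b'" "c = k # c'" "d = l # d'"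
      using V unfolding fverts_simps by blast
    show "fadj (Conj \<phi> \<psi>) a c \<or> fadj (Conj \<phi> \<psi>) b d \<or> fadj (Conj \<phi> \<psi>) a d"
    proof (cases "i = j \<and> j = k \<and> k = l")
      case True
      then show ?thesis
        using p4_freeD[OF Conj.IH(1), of a' b' c' d'] p4_freeD[OF Conj.IH(2), of a' b' c' d'] V h
        unfolding e fverts_simps by (cases l) auto
    next
      case False
      then show ?thesis
        using V h unfolding e fverts_simps
        by (cases i; cases j; cases k; cases l) auto
    qed
  qed
next
  case (Disj \<phi> \<psi>)
  show ?case
    unfolding p4_free_def
  proof (intro ballI impI)
    fix a b c d assume V: "a \<in> fverts (Disj \<phi> \<psi>)" "b \<in> fverts (Disj \<phi> \<psi>)" "c \<in> fverts (Disj \<phi> \<psi>)" "d \<in> fverts (Disj \<phi> \<psi>)"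
      and h: "distinct [a, b, c, d] \<and> fadj (Disj \<phi> \<psi>) a b \<and> fadj (Disj \<phi> \<psi>) b c \<and> fadj (Disj \<phi> \<psi>) c d"
    obtain i a' j b' k c' l d' where e: "a = i # a'" "b = j # b'" "c = k # c'" "d = l # d'"
      using V unfolding fverts_simps by blast
    show "fadj (Disj \<phi> \<psi>) a c \<or> fadj (Disj \<phi> \<psi>) b d \<or> fadj (Disj \<phi> \<psi>) a d"
    proof (rule ccontr)
      assume "\<not> ?thesis"
      then show False
        using p4_freeD[OF Disj.IH(1), of a' b' c' d'] p4_freeD[OF Disj.IH(2), of a' b' c' d'] V h
        unfolding e fverts_simps by (cases l) auto
    qed
  qed
next
  case (All x \<phi>)
  then show ?case unfolding p4_free_def fverts_simps by auto
next
  case (Ex x \<phi>)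
  then show ?case unfolding p4_free_def fverts_simps by auto
qed (auto simp: p4_free_def)

lemma cograph_graph_of: "cograph (graph_of \<psi>)"
  using graph_graph_of p4_free_fadj[of \<psi>] unfolding cograph_def p4_free_def by (simp, blast)

lemma fadj_append: "sub \<psi> p = Some \<chi> \<Longrightarrow> fadj \<psi> (p @ u) (p @ v) \<longleftrightarrow> fadj \<chi> u v"
  by (induction \<psi> p rule: sub.induct) (auto split: if_splits)

lemma fverts_append: "sub \<psi> p = Some \<chi> \<Longrightarrow> p @ u \<in> fverts \<psi> \<longleftrightarrow> u \<in> fverts \<chi>"
  by (simp add: fverts_iff sub_append)

text \<open>The connective or quantifier at which \<open>w\<close> and the path \<open>p\<close>
  part decides the adjacency, and seen from there \<open>p @ u\<close> and \<open>p @ v\<close> lie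
  on the same side.\<close>

lemma fadj_outside:
  "sub \<psi> p = Some \<chi> \<Longrightarrow> u \<in> fverts \<chi> \<Longrightarrow> v \<in> fverts \<chi> \<Longrightarrow> w \<in> fverts \<psi> \<Longrightarrow> \<nexists>t. w = p @ t \<Longrightarrow>
    fadj \<psi> (p @ u) w \<longleftrightarrow> fadj \<psi> (p @ v) w"
proof (induction \<psi> p arbitrary: w rule: sub.induct)
  case (2 \<phi> \<psi> i p)
  then obtain j w' where w: "w = j # w'" unfolding fverts_simps by blast
  have "p @ u \<in> fverts (if i then \<psi> else \<phi>)" "p @ v \<in> fverts (if i then \<psi> else \<phi>)"
    using 2(2-4) fverts_append by fastforce+
  then show ?case using 2 w by (auto split: if_splits)
next
  case (3 \<phi> \<psi> i p)
  then obtain j w' where w: "w = j # w'" unfolding fverts_simps by blast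
  then show ?case using 3 by (auto split: if_splits)
next
  case (4 x \<phi> i p)
  then show ?case by (cases w) (auto split: if_splits)
next
  case (5 x \<phi> i p)
  have "i \<Longrightarrow> p @ u \<in> fverts \<phi>" "i \<Longrightarrow> p @ v \<in> fverts \<phi>"
    using 5(2-4) fverts_append by fastforce+
  then show ?case using 5 by (cases w) (auto split: if_splits)
qed auto

lemma graph_module_sub:
  assumes "sub \<psi> p = Some \<chi>"
  shows "graph_module (graph_of \<psi>) ((@) p ` fverts \<chi>)"
  unfolding graph_module_iff
proof (intro conjI ballI)
  show "(@) p ` fverts \<chi> \<subseteq> fverts \<psi>" using assms fverts_append by fastforce
  fix a b w assume ab: "a \<in> (@) p ` fverts \<chi>" "b \<in> (@) p ` fverts \<chi>" and w: "w \<in> fverts \<psi> - (@) p ` fverts \<chi>"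
  obtain u v where uv: "a = p @ u" "b = p @ v" "u \<in> fverts \<chi>" "v \<in> fverts \<chi>" using ab by blast
  have "\<nexists>t. w = p @ t" using w fverts_append[OF assms] by auto
  then show "fadj \<psi> a w \<longleftrightarrow> fadj \<psi> b w" using fadj_outside[OF assms uv(3,4)] w uv(1,2) by simp
qed

lemma ex_literal_fverts: "\<exists>u a. u \<in> fverts \<psi> \<and> label (graph_of \<psi>) u = Literal a"
proof -
  have "\<exists>u a. sub \<psi> u = Some (Atm a)"
  proof (induction \<psi>)
    case (Conj \<psi>1 \<psi>2) then show ?case by (metis sub.simps(2))
  next
    case (Disj \<psi>1 \<psi>2) then show ?case by (metis sub.simps(3))
  next
    case (All x \<psi>) then show ?case by (metis sub.simps(4))
  next
    case (Ex x \<psi>) then show ?case by (metis sub.simps(5))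
  qed (metis sub.simps(1))
  then show ?thesis using fverts_iff flabel by (metis vlab.simps(1))
qed

definition quantifies :: "('f, 'p, 'v) fm \<Rightarrow> 'v \<Rightarrow> ('f, 'p, 'v) fm \<Rightarrow> bool" where
  "quantifies \<psi> x \<chi> \<longleftrightarrow> \<psi> = All x \<chi> \<or> \<psi> = Ex x \<chi>"

lemma vlab_Binder: "vlab \<psi> = Some (Binder x) \<longleftrightarrow> (\<exists>\<chi>. quantifies \<psi> x \<chi>)"
  unfolding quantifies_def by (cases \<psi>) auto

lemma vlab_Literal: "vlab \<psi> = Some (Literal a) \<longleftrightarrow> \<psi> = Atm a"
  by (cases \<psi>) auto

lemma flabel_iff: "p \<in> fverts \<psi> \<Longrightarrow> label (graph_of \<psi>) p = l \<longleftrightarrow> (\<exists>\<chi>. sub \<psi> p = Some \<chi> \<and> vlab \<chi> = Some l)"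
  using flabel fverts_iff by fastforce

lemma binders_graph_of: "p \<in> binders (graph_of \<psi>) \<longleftrightarrow> (\<exists>x \<chi> \<xi>. sub \<psi> p = Some \<chi> \<and> quantifies \<chi> x \<xi>)"
  unfolding binders_def using flabel_iff[of p \<psi>] vlab_Binder fverts_iff[of p \<psi>] by fastforce

text \<open>Only an inclusion: in \<open>Disj (All x \<xi>) \<chi>\<close> the scope of the binder
  takes in \<open>\<chi>\<close> as well. Uniqueness of binders is therefore argued through labels
  and not through positions.\<close>

lemma body_in_scope:
  assumes "sub \<psi> p = Some \<chi>" "quantifies \<chi> x \<xi>" "u \<in> fverts \<xi>"
  shows "p @ True # u \<in> scope (graph_of \<psi>) p"
proof -
  have s: "sub \<psi> (p @ [True]) = Some \<xi>" using assms(1,2) unfolding quantifies_def sub_append by auto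
  have e: "insert p ((@) (p @ [True]) ` fverts \<xi>) = (@) p ` fverts \<chi>"
    using assms(2) unfolding quantifies_def by (auto simp: image_image)
  have "insert p ((@) (p @ [True]) ` fverts \<xi>) \<subseteq> scope (graph_of \<psi>) p"
  proof (rule body_subset_scope[OF graph_graph_of])
    show "graph_module (graph_of \<psi>) ((@) (p @ [True]) ` fverts \<xi>)" using graph_module_sub[OF s] .
    show "graph_module (graph_of \<psi>) (insert p ((@) (p @ [True]) ` fverts \<xi>))"
      unfolding e using graph_module_sub[OF assms(1)] .
  qed (use assms(3) in auto)
  then show ?thesis using assms(3) by auto
qed

lemma bound_vars_sub: "sub \<psi> p = Some \<chi> \<Longrightarrow> quantifies \<chi> x \<xi> \<Longrightarrow> x \<in> set (bound_vars \<psi>)"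
  unfolding quantifies_def by (induction \<psi> p rule: sub.induct) (auto split: if_splits)

lemma bound_position_unique:
  "distinct (bound_vars \<psi>) \<Longrightarrow> sub \<psi> p = Some \<chi> \<Longrightarrow> quantifies \<chi> x \<xi> \<Longrightarrow>
    sub \<psi> q = Some \<chi>' \<Longrightarrow> quantifies \<chi>' x \<xi>' \<Longrightarrow> p = q"
proof (induction \<psi> arbitrary: p q)
  case (Atm a)
  then show ?case by (cases p; cases q) auto
next
  case (Conj \<phi> \<psi>)
  then obtain i p' j q' where pq: "p = i # p'" "q = j # q'"
    by (cases p; cases q) (auto simp: quantifies_def)
  have b: "x \<in> set (bound_vars (if i then \<psi> else \<phi>))" "x \<in> set (bound_vars (if j then \<psi> else \<phi>))"
    using bound_vars_sub[of _ p' \<chi> x \<xi>] bound_vars_sub[of _ q' \<chi>' x \<xi>'] Conj.prems unfolding pq by auto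
  then have "i = j" using Conj.prems(1) by (auto split: if_splits)
  then show ?case using Conj.IH(1)[of p' q'] Conj.IH(2)[of p' q'] Conj.prems unfolding pq
    by (cases j) auto
next
  case (Disj \<phi> \<psi>)
  then obtain i p' j q' where pq: "p = i # p'" "q = j # q'"
    by (cases p; cases q) (auto simp: quantifies_def)
  have b: "x \<in> set (bound_vars (if i then \<psi> else \<phi>))" "x \<in> set (bound_vars (if j then \<psi> else \<phi>))"
    using bound_vars_sub[of _ p' \<chi> x \<xi>] bound_vars_sub[of _ q' \<chi>' x \<xi>'] Disj.prems unfolding pq by auto
  then have "i = j" using Disj.prems(1) by (auto split: if_splits)
  then show ?case using Disj.IH(1)[of p' q'] Disj.IH(2)[of p' q'] Disj.prems unfolding pq
    by (cases j) auto
next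
  case (All y \<phi>)
  then show ?case
    using bound_vars_sub[of \<phi> "tl p" \<chi> x \<xi>] bound_vars_sub[of \<phi> "tl q" \<chi>' x \<xi>'] All.IH[of "tl p" "tl q"]
    by (cases p; cases q) (auto simp: quantifies_def split: if_splits)
next
  case (Ex y \<phi>)
  then show ?case
    using bound_vars_sub[of \<phi> "tl p" \<chi> x \<xi>] bound_vars_sub[of \<phi> "tl q" \<chi>' x \<xi>'] Ex.IH[of "tl p" "tl q"]
    by (cases p; cases q) (auto simp: quantifies_def split: if_splits)
qed

lemma fograph_graph_of:
  assumes "distinct (bound_vars \<psi>)"
  shows "fograph (graph_of \<psi>)"
  unfolding fograph_def logical_cograph_def
proof (intro conjI ballI)
  show "cograph (graph_of \<psi>)" by (rule cograph_graph_of)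
  show "literals (graph_of \<psi>) \<noteq> {}" using ex_literal_fverts[of \<psi>] unfolding literals_def by blast
  fix b assume b: "b \<in> binders (graph_of \<psi>)"
  then obtain x \<chi> \<xi> where s: "sub \<psi> b = Some \<chi>" "quantifies \<chi> x \<xi>" unfolding binders_graph_of by blast
  show "legal (graph_of \<psi>) b"
    unfolding legal_def
  proof (intro conjI ballI impI)
    obtain u a where u: "u \<in> fverts \<xi>" "label (graph_of \<xi>) u = Literal a" using ex_literal_fverts by blast
    then have su: "sub \<xi> u = Some (Atm a)" using flabel_iff vlab_Literal by metis
    have "sub \<psi> (b @ True # u) = Some (Atm a)" using s su unfolding sub_append quantifies_def by auto
    then have "b @ True # u \<in> literals (graph_of \<psi>)"
      unfolding literals_def using fverts_iff flabel by fastforce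
    then show "scope (graph_of \<psi>) b \<inter> literals (graph_of \<psi>) \<noteq> {}" using body_in_scope[OF s u(1)] by blast
    fix c assume c: "c \<in> scope (graph_of \<psi>) b \<inter> binders (graph_of \<psi>)" "label (graph_of \<psi>) c = label (graph_of \<psi>) b"
    from c(1) have "c \<in> binders (graph_of \<psi>)" by (rule IntD2)
    then obtain y \<chi>' \<xi>' where s': "sub \<psi> c = Some \<chi>'" "quantifies \<chi>' y \<xi>'"
      unfolding binders_graph_of by blast
    have "label (graph_of \<psi>) b = Binder x" "label (graph_of \<psi>) c = Binder y"
      using s s' flabel vlab_Binder by metis+
    then show "c = b" using bound_position_unique[OF assms s] s' c(2) by auto
  qed
qed

text \<open>One vertex of the body decides: a binder is adjacent to all or to none of the other
  vertices of its scope, and the body lies in the scope.\<close>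

lemma existential_graph_of:
  assumes "distinct (bound_vars \<psi>)"
  shows "existential (graph_of \<psi>) p \<longleftrightarrow> (\<exists>x \<xi>. sub \<psi> p = Some (Ex x \<xi>))"
proof
  assume e: "existential (graph_of \<psi>) p"
  then have "p \<in> binders (graph_of \<psi>)" unfolding existential_def by blast
  then obtain x \<chi> \<xi> where s: "sub \<psi> p = Some \<chi>" "quantifies \<chi> x \<xi>" unfolding binders_graph_of by blast
  obtain u a where u: "u \<in> fverts \<xi>" using ex_literal_fverts by blast
  have "fadj \<psi> (p @ []) (p @ True # u)"
    using existential_adj[OF e body_in_scope[OF s u]] by simp
  then have "fadj \<chi> [] (True # u)" unfolding fadj_append[OF s(1)] .
  then show "\<exists>x \<xi>. sub \<psi> p = Some (Ex x \<xi>)" using s unfolding quantifies_def by auto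
next
  assume "\<exists>x \<xi>. sub \<psi> p = Some (Ex x \<xi>)"
  then obtain x \<xi> where s: "sub \<psi> p = Some (Ex x \<xi>)" by blast
  have q: "quantifies (Ex x \<xi>) x \<xi>" unfolding quantifies_def by blast
  obtain u a where u: "u \<in> fverts \<xi>" using ex_literal_fverts by blast
  show "existential (graph_of \<psi>) p"
  proof (rule existential_if_adj_body[OF fograph_graph_of[OF assms]])
    show "p \<in> binders (graph_of \<psi>)" unfolding binders_graph_of using s q by blast
    show "p @ True # u \<in> scope (graph_of \<psi>) p" using body_in_scope[OF s q u] .
    show "fadj \<psi> p (p @ True # u)" using fadj_append[OF s, of "[]" "True # u"] u by simp
  qed
qed

section \<open>First-order forms of modal formulas\<close>

text \<open>The atoms of the first-order form of a modal formula are applied to the variable of the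
  innermost quantifier, and to \<^term>\<open>z\<close> outside all quantifiers.\<close>

primrec modal_form :: "'v \<Rightarrow> 'p modal \<Rightarrow> ('f, 'p, 'v) fm \<Rightarrow> bool" where
  "modal_form z (MPred P) \<psi> \<longleftrightarrow> \<psi> = Atm (Pred P [Var z])"
| "modal_form z MTru \<psi> \<longleftrightarrow> \<psi> = Atm Tru"
| "modal_form z MFls \<psi> \<longleftrightarrow> \<psi> = Atm Fls"
| "modal_form z (MConj \<phi>1 \<phi>2) \<psi> \<longleftrightarrow> (\<exists>\<psi>1 \<psi>2. \<psi> = Conj \<psi>1 \<psi>2 \<and> modal_form z \<phi>1 \<psi>1 \<and> modal_form z \<phi>2 \<psi>2)"
| "modal_form z (MDisj \<phi>1 \<phi>2) \<psi> \<longleftrightarrow> (\<exists>\<psi>1 \<psi>2. \<psi> = Disj \<psi>1 \<psi>2 \<and> modal_form z \<phi>1 \<psi>1 \<and> modal_form z \<phi>2 \<psi>2)"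
| "modal_form z (Box \<phi>) \<psi> \<longleftrightarrow> (\<exists>y \<chi>. \<psi> = All y \<chi> \<and> modal_form y \<phi> \<chi>)"
| "modal_form z (Dia \<phi>) \<psi> \<longleftrightarrow> (\<exists>y \<chi>. \<psi> = Ex y \<chi> \<and> modal_form y \<phi> \<chi>)"

text \<open>\<open>star x\<close> quantifies over the one variable \<open>x\<close>, so the
  innermost pair of the environment always has \<open>x\<close> on the left and tells which variable
  stands for it in \<open>\<psi>\<close>.\<close>

lemma alpha_eq_modal_form:
  assumes "alpha_eq ((x, z) # e) (star x \<phi>) \<psi>"
  shows "modal_form z \<phi> \<psi>"
  using assms
proof (induction \<phi> arbitrary: z e \<psi>)
  case (MPred P)
  then obtain b where b: "\<psi> = Atm b" "rel_atom (=) (=) (var_eq ((x, z) # e)) (Pred P [Var x]) b"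
    by (cases \<psi>) auto
  then obtain ts where ts: "b = Pred P ts" "list_all2 (rel_tm (=) (var_eq ((x, z) # e))) [Var x] ts"
    by (cases b) (auto simp: psym.rel_eq)
  then obtain t where t: "ts = [t]" "rel_tm (=) (var_eq ((x, z) # e)) (Var x) t"
    by (auto simp: list_all2_Cons1)
  then have "t = Var z" by (cases t) (auto split: if_splits)
  then show ?case using b ts t by simp
next
  case MTru
  then show ?case by (cases \<psi>) (auto elim: atom.rel_cases)
next
  case MFls
  then show ?case by (cases \<psi>) (auto elim: atom.rel_cases)
next
  case (MConj \<phi>1 \<phi>2)
  then show ?case by (cases \<psi>) auto
next
  case (MDisj \<phi>1 \<phi>2)
  then show ?case by (cases \<psi>) auto
next
  case (Box \<phi>)
  then show ?case by (cases \<psi>) auto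
next
  case (Dia \<phi>)
  then show ?case by (cases \<psi>) auto
qed

lemma modal_form_change_var:
  "modal_form z \<phi> \<psi> \<Longrightarrow> z \<notin> free_vars \<psi> \<Longrightarrow> modal_form z' \<phi> \<psi>"
  by (induction \<phi> arbitrary: \<psi>) auto

lemma rectified_form_modal_form:
  fixes x :: nat
  assumes "rectified_form (star x \<phi>) \<psi>"
  obtains z where "modal_form z \<phi> \<psi>" "distinct (bound_vars \<psi>)" "z \<notin> set (bound_vars \<psi>)"
proof -
  have r: "rectified \<psi>" "alpha_eq [] (star x \<phi>) \<psi>" using assms unfolding rectified_form_def by auto
  \<comment> \<open>A pair \<open>(x, x)\<close> at the outer end of the environment changes
    nothing, but turns the empty environment into one with the head that
    \<open>alpha_eq_modal_form\<close> asks for.\<close>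
  have "alpha_eq (e @ [(x, x)]) \<chi> \<xi>" if "alpha_eq e \<chi> \<xi>" for e and \<chi> \<xi> :: "('a, 'b, nat) fm"
  proof -
    have v: "var_eq (e @ [(x, x)]) = var_eq e" for e :: "(nat \<times> nat) list"
    proof (intro ext)
      show "var_eq (e @ [(x, x)]) a b = var_eq e a b" for a b
        by (induction e a b rule: var_eq.induct) auto
    qed
    show ?thesis using that by (induction e \<chi> \<xi> rule: alpha_eq.induct) (auto simp: v)
  qed
  from this[OF r(2)] have m: "modal_form x \<phi> \<psi>" using alpha_eq_modal_form by fastforce
  have d: "distinct (bound_vars \<psi>)" using r(1) unfolding rectified_def by blast
  show thesis
  \<comment> \<open>If \<open>x\<close> is bound somewhere in \<open>\<psi>\<close>, it is not free
    there, so the variable outside all quantifiers is arbitrary and can be chosen fresh.\<close>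
  proof (cases "x \<in> set (bound_vars \<psi>)")
    case True
    then have "x \<notin> free_vars \<psi>" using r(1) unfolding rectified_def by blast
    from modal_form_change_var[OF m this] have "modal_form z \<phi> \<psi>" for z .
    moreover obtain z where "z \<notin> set (bound_vars \<psi>)"
      using ex_new_if_finite[of "set (bound_vars \<psi>)"] by auto
    ultimately show thesis using that[of z] d by blast
  next
    case False
    then show thesis using that[OF m d] by blast
  qed
qed

text \<open>The variable of the innermost quantifier passed on the path, or \<open>z\<close> if
  there is none. In a modal form it is the argument of the atom at the end of the path.\<close>

fun cur :: "'v \<Rightarrow> ('f, 'p, 'v) fm \<Rightarrow> bool list \<Rightarrow> 'v" where
  "cur z (Conj \<phi> \<psi>) (i # p) = cur z (if i then \<psi> else \<phi>) p"
| "cur z (Disj \<phi> \<psi>) (i # p) = cur z (if i then \<psi> else \<phi>) p"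
| "cur z (All x \<phi>) (i # p) = cur x \<phi> p"
| "cur z (Ex x \<phi>) (i # p) = cur x \<phi> p"
| "cur z \<psi> _ = z"

lemma cur_Nil [simp]: "cur z \<psi> [] = z"
  by (cases \<psi>) auto

lemma cur_append: "sub \<psi> p = Some \<chi> \<Longrightarrow> cur z \<psi> (p @ q) = cur (cur z \<psi> p) \<chi> q"
  by (induction \<psi> p arbitrary: z rule: sub.induct) (auto split: if_splits)

lemma modal_form_sub:
  "modal_form z \<phi> \<psi> \<Longrightarrow> sub \<psi> p = Some \<chi> \<Longrightarrow> \<exists>\<phi>'. modal_form (cur z \<psi> p) \<phi>' \<chi>"
proof (induction \<psi> p arbitrary: z \<phi> rule: sub.induct)
  case (2 \<psi>1 \<psi>2 i p)
  then show ?case by (cases \<phi>) (auto split: if_splits)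
next
  case (3 \<psi>1 \<psi>2 i p)
  then show ?case by (cases \<phi>) (auto split: if_splits)
next
  case (4 x \<psi> i p)
  then show ?case by (cases \<phi>) (auto split: if_splits)
next
  case (5 x \<psi> i p)
  then show ?case by (cases \<phi>) (auto split: if_splits)
qed auto

lemma modal_form_Atm:
  assumes "modal_form z \<phi> \<psi>" "sub \<psi> p = Some (Atm (Pred P ts))"
  shows "ts = [Var (cur z \<psi> p)]"
proof -
  obtain \<phi>' where "modal_form (cur z \<psi> p) \<phi>' (Atm (Pred P ts))"
    using modal_form_sub[OF assms] by blast
  then show ?thesis by (cases \<phi>') auto
qed

lemma cur_binder:
  "sub \<psi> p = Some \<chi> \<Longrightarrow> cur z \<psi> p = z \<or>
    (\<exists>q r \<chi>' \<xi>. p = q @ True # r \<and> sub \<psi> q = Some \<chi>' \<and> quantifies \<chi>' (cur z \<psi> p) \<xi>)"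
proof (induction \<psi> p arbitrary: z rule: sub.induct)
  case (2 \<phi> \<psi> i p)
  let ?\<psi> = "if i then \<psi> else \<phi>"
  from 2 have "cur z ?\<psi> p = z \<or> (\<exists>q r \<chi>' \<xi>. p = q @ True # r \<and> sub ?\<psi> q = Some \<chi>' \<and> quantifies \<chi>' (cur z ?\<psi> p) \<xi>)"
    by auto
  then show ?case
  proof (elim disjE exE conjE)
    fix q r \<chi>' \<xi> assume "p = q @ True # r" "sub ?\<psi> q = Some \<chi>'" "quantifies \<chi>' (cur z ?\<psi> p) \<xi>"
    then have "i # p = (i # q) @ True # r \<and> sub (Conj \<phi> \<psi>) (i # q) = Some \<chi>' \<and>
      quantifies \<chi>' (cur z (Conj \<phi> \<psi>) (i # p)) \<xi>" by simp
    then show ?thesis by blast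
  qed simp
next
  case (3 \<phi> \<psi> i p)
  let ?\<psi> = "if i then \<psi> else \<phi>"
  from 3 have "cur z ?\<psi> p = z \<or> (\<exists>q r \<chi>' \<xi>. p = q @ True # r \<and> sub ?\<psi> q = Some \<chi>' \<and> quantifies \<chi>' (cur z ?\<psi> p) \<xi>)"
    by auto
  then show ?case
  proof (elim disjE exE conjE)
    fix q r \<chi>' \<xi> assume "p = q @ True # r" "sub ?\<psi> q = Some \<chi>'" "quantifies \<chi>' (cur z ?\<psi> p) \<xi>"
    then have "i # p = (i # q) @ True # r \<and> sub (Disj \<phi> \<psi>) (i # q) = Some \<chi>' \<and>
      quantifies \<chi>' (cur z (Disj \<phi> \<psi>) (i # p)) \<xi>" by simp
    then show ?thesis by blast
  qed simp
next
  case (4 x \<phi> i p)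
  then have "cur x \<phi> p = x \<or> (\<exists>q r \<chi>' \<xi>. p = q @ True # r \<and> sub \<phi> q = Some \<chi>' \<and> quantifies \<chi>' (cur x \<phi> p) \<xi>)" and i
    by (auto split: if_splits)
  then show ?case
  proof (elim disjE exE conjE)
    assume "cur x \<phi> p = x" i
    then have "i # p = [] @ True # p \<and> sub (All x \<phi>) [] = Some (All x \<phi>) \<and> quantifies (All x \<phi>) (cur z (All x \<phi>) (i # p)) \<phi>"
      unfolding quantifies_def by simp
    then show ?thesis by blast
  next
    fix q r \<chi>' \<xi> assume "i" "p = q @ True # r" "sub \<phi> q = Some \<chi>'" "quantifies \<chi>' (cur x \<phi> p) \<xi>"
    then have "i # p = (True # q) @ True # r \<and> sub (All x \<phi>) (True # q) = Some \<chi>' \<and>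
      quantifies \<chi>' (cur z (All x \<phi>) (i # p)) \<xi>" by simp
    then show ?thesis by blast
  qed
next
  case (5 x \<phi> i p)
  then have "cur x \<phi> p = x \<or> (\<exists>q r \<chi>' \<xi>. p = q @ True # r \<and> sub \<phi> q = Some \<chi>' \<and> quantifies \<chi>' (cur x \<phi> p) \<xi>)" and i
    by (auto split: if_splits)
  then show ?case
  proof (elim disjE exE conjE)
    assume "cur x \<phi> p = x" i
    then have "i # p = [] @ True # p \<and> sub (Ex x \<phi>) [] = Some (Ex x \<phi>) \<and> quantifies (Ex x \<phi>) (cur z (Ex x \<phi>) (i # p)) \<phi>"
      unfolding quantifies_def by simp
    then show ?thesis by blast
  next
    fix q r \<chi>' \<xi> assume "i" "p = q @ True # r" "sub \<phi> q = Some \<chi>'" "quantifies \<chi>' (cur x \<phi> p) \<xi>"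
    then have "i # p = (True # q) @ True # r \<and> sub (Ex x \<phi>) (True # q) = Some \<chi>' \<and>
      quantifies \<chi>' (cur z (Ex x \<phi>) (i # p)) \<xi>" by simp
    then show ?thesis by blast
  qed
qed auto

lemma atom_bound_in_graph_of:
  assumes mf: "modal_form x0 \<phi> \<psi>" and s: "sub \<psi> q = Some (Atm (Pred Q [Var z]))" and z: "z \<noteq> x0"
  shows "\<exists>p \<chi> \<xi>. sub \<psi> p = Some \<chi> \<and> quantifies \<chi> z \<xi> \<and> binds (graph_of \<psi>) p q"
proof -
  have "z = cur x0 \<psi> q" using modal_form_Atm[OF mf s] by simp
  then obtain p t \<chi> \<xi> where q: "q = p @ True # t" "sub \<psi> p = Some \<chi>" "quantifies \<chi> z \<xi>"
    using cur_binder[OF s, of x0] z by blast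
  have "sub \<chi> (True # t) = Some (Atm (Pred Q [Var z]))" using s q(1,2) by (simp add: sub_append)
  then have "sub \<xi> t = Some (Atm (Pred Q [Var z]))" using q(3) unfolding quantifies_def by auto
  then have "t \<in> fverts \<xi>" using fverts_iff by fastforce
  then have "q \<in> scope (graph_of \<psi>) p" using body_in_scope[OF q(2,3)] q(1) by simp
  moreover have "p \<in> binders (graph_of \<psi>)" unfolding binders_graph_of using q(2,3) by blast
  moreover have "label (graph_of \<psi>) p = Binder z" using flabel[OF q(2)] q(3) vlab_Binder[of \<chi> z] by blast
  moreover have "label (graph_of \<psi>) q = Literal (Pred Q [Var z])" using flabel[OF s] by simp
  moreover have "q \<in> literals (graph_of \<psi>)"
    unfolding literals_def using fverts_iff[of q \<psi>] s calculation(4) by auto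
  ultimately have "binds (graph_of \<psi>) p q" unfolding binds_def by auto
  then show ?thesis using q by blast
qed

section \<open>Soundness\<close>

text \<open>Arguments are ignored: \<open>w\<close> stands for the value of the only variable that a
  predicate has in a modal form.\<close>

fun atom_holds :: "('w \<Rightarrow> 'p \<Rightarrow> bool) \<Rightarrow> 'w \<Rightarrow> ('f, 'p, 'v) atom \<Rightarrow> bool" where
  "atom_holds V w Tru = True"
| "atom_holds V w Fls = False"
| "atom_holds V w (Pred (Pos p) ts) = V w p"
| "atom_holds V w (Pred (Neg p) ts) = (\<not> V w p)"

primrec univ_vars :: "('f, 'p, 'v) fm \<Rightarrow> 'v set" where
  "univ_vars (Atm a) = {}"
| "univ_vars (Conj \<phi> \<psi>) = univ_vars \<phi> \<union> univ_vars \<psi>"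
| "univ_vars (Disj \<phi> \<psi>) = univ_vars \<phi> \<union> univ_vars \<psi>"
| "univ_vars (All x \<phi>) = insert x (univ_vars \<phi>)"
| "univ_vars (Ex x \<phi>) = univ_vars \<phi>"

lemma univ_vars_bound: "univ_vars \<psi> \<subseteq> set (bound_vars \<psi>)"
  by (induction \<psi>) auto

lemma univ_vars_sub: "y \<in> univ_vars \<psi> \<Longrightarrow> \<exists>p \<chi>. sub \<psi> p = Some (All y \<chi>)"
proof (induction \<psi>)
  case (Conj \<psi>1 \<psi>2) then show ?case by (metis Un_iff sub.simps(2) univ_vars.simps(2))
next
  case (Disj \<psi>1 \<psi>2) then show ?case by (metis Un_iff sub.simps(3) univ_vars.simps(3))
next
  case (All x \<psi>) then show ?case by (metis insert_iff sub.simps(1,4) univ_vars.simps(4))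
next
  case (Ex x \<psi>) then show ?case by (metis sub.simps(5) univ_vars.simps(5))
qed simp

text \<open>\<open>K\<close> is a clause of the conjunctive normal form with only false literals
  under the environment \<open>e\<close>. Excluding existential binders forces \<open>K\<close> into
  the body of an existential formula, whose binder alone would already be a maximal stable
  set.\<close>

definition refutes :: "('w \<Rightarrow> 'p \<Rightarrow> bool) \<Rightarrow> ('v \<Rightarrow> 'w) \<Rightarrow> 'v \<Rightarrow> ('f, 'p, 'v) fm \<Rightarrow> bool list set \<Rightarrow> bool" where
  "refutes V e z \<psi> K \<longleftrightarrow> max_stable (fverts \<psi>) (fadj \<psi>) K \<and>
     (\<forall>q\<in>K. (\<forall>x \<chi>. sub \<psi> q \<noteq> Some (Ex x \<chi>)) \<and>
       (\<forall>a. sub \<psi> q = Some (Atm a) \<longrightarrow> \<not> atom_holds V (e (cur z \<psi> q)) a))"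

lemma fverts_nonempty: "fverts \<psi> \<noteq> {}"
  using ex_literal_fverts[of \<psi>] by blast

lemma refutes_nonempty: "refutes V e z \<psi> K \<Longrightarrow> \<exists>k. k \<in> K"
  using max_stable_nonempty[OF _ fverts_nonempty] unfolding refutes_def by blast

lemma refutes_Conj:
  assumes "refutes V e z (if i then \<psi> else \<phi>) K"
  shows "refutes V e z (Conj \<phi> \<psi>) (Cons i ` K)"
proof -
  obtain k where "k \<in> K" using refutes_nonempty[OF assms] by blast
  moreover have "k \<in> fverts (if i then \<psi> else \<phi>)"
    using assms \<open>k \<in> K\<close> unfolding refutes_def max_stable_def by blast
  ultimately show ?thesis
    using assms unfolding refutes_def max_stable_def by (cases i) (auto simp: image_iff)
qed

lemma refutes_Disj:
  assumes "refutes V e z \<phi> K" "refutes V e z \<psi> K'"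
  shows "refutes V e z (Disj \<phi> \<psi>) (Cons False ` K \<union> Cons True ` K')"
proof -
  have "\<exists>u\<in>Cons False ` K \<union> Cons True ` K'. fadj (Disj \<phi> \<psi>) u v"
    if v0: "v \<in> fverts (Disj \<phi> \<psi>) - (Cons False ` K \<union> Cons True ` K')" for v
  proof -
    obtain i v' where v: "v = i # v'" using v0 unfolding fverts_simps by blast
    show ?thesis
    proof (cases i)
      case True
      then have "v' \<in> fverts \<psi> - K'" using v0 v by auto
      then obtain u where "u \<in> K'" "fadj \<psi> u v'" using assms(2) unfolding refutes_def max_stable_def by blast
      then show ?thesis using v True by (intro bexI[of _ "True # u"]) auto
    next
      case False
      then have "v' \<in> fverts \<phi> - K" using v0 v by auto
      then obtain u where "u \<in> K" "fadj \<phi> u v'" using assms(1) unfolding refutes_def max_stable_def by blast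
      then show ?thesis using v False by (intro bexI[of _ "False # u"]) auto
    qed
  qed
  moreover have "\<not> fadj (Disj \<phi> \<psi>) u v"
    if "u \<in> Cons False ` K \<union> Cons True ` K'" "v \<in> Cons False ` K \<union> Cons True ` K'" "u \<noteq> v" for u v
  proof -
    have "\<forall>u\<in>K. \<forall>v\<in>K. \<not> fadj \<phi> u v" "\<forall>u\<in>K'. \<forall>v\<in>K'. \<not> fadj \<psi> u v"
      using assms max_stable_no_edge[of _ "fadj \<phi>"] max_stable_no_edge[of _ "fadj \<psi>"] fadj_irrefl
      unfolding refutes_def by metis+
    then show ?thesis using that by auto
  qed
  ultimately have "max_stable (fverts (Disj \<phi> \<psi>)) (fadj (Disj \<phi> \<psi>)) (Cons False ` K \<union> Cons True ` K')"
    unfolding max_stable_def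
  proof (intro conjI ballI impI)
    show "Cons False ` K \<union> Cons True ` K' \<subseteq> fverts (Disj \<phi> \<psi>)"
    proof -
      have "K \<subseteq> fverts \<phi>" using assms(1) unfolding refutes_def max_stable_def by (elim conjE)
      moreover have "K' \<subseteq> fverts \<psi>" using assms(2) unfolding refutes_def max_stable_def by (elim conjE)
      ultimately show ?thesis by auto
    qed
  qed blast+
  then show ?thesis
    using assms unfolding refutes_def by auto
qed

lemma refutes_All:
  assumes "refutes V e y \<psi> K"
  shows "refutes V e z (All y \<psi>) (insert [] (Cons True ` K))"
  using assms unfolding refutes_def max_stable_def by (auto simp: image_iff)

lemma refutes_Ex:
  assumes "refutes V e y \<psi> K"
  shows "refutes V e z (Ex y \<psi>) (Cons True ` K)"
proof -
  obtain k where k: "k \<in> K" using refutes_nonempty[OF assms] by blast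
  then have "k \<in> fverts \<psi>" using assms unfolding refutes_def max_stable_def by blast
  then show ?thesis using k assms unfolding refutes_def max_stable_def by (auto simp: image_iff)
qed

text \<open>Modal subformulas have the same truth value at all worlds, so the witness of a universal
  quantifier can be chosen independently of the enclosing existential ones.\<close>

lemma ex_range_subset: "A \<noteq> {} \<Longrightarrow> \<exists>w. range w \<subseteq> A"
proof -
  assume "A \<noteq> {}"
  then obtain a where "a \<in> A" by blast
  then show ?thesis by (intro exI[of _ "\<lambda>_. a"]) auto
qed

lemma refutation_exists:
  fixes W0 :: "'w set" and z :: 'v and \<psi> :: "('f, 'p, 'v) fm"
  assumes W: "W0 \<noteq> {}" and R: "\<And>u v. u \<in> W0 \<Longrightarrow> (u, v) \<in> R \<longleftrightarrow> v \<in> W0"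
  shows "modal_form z \<phi> \<psi> \<Longrightarrow> distinct (bound_vars \<psi>) \<Longrightarrow>
    \<exists>wy. range wy \<subseteq> W0 \<and> (\<forall>e. range e \<subseteq> W0 \<longrightarrow> (\<forall>y\<in>univ_vars \<psi>. e y = wy y) \<longrightarrow>
      \<not> sat R V (e z) \<phi> \<longrightarrow> (\<exists>K. refutes V e z \<psi> K))"
proof (induction \<phi> arbitrary: z \<psi>)
  case (MPred P)
  have "refutes V e z \<psi> {[]}" if "\<not> sat R V (e z) (MPred P)" for e
    using that MPred(1) unfolding refutes_def max_stable_def by (cases P) auto
  moreover obtain wy :: "'v \<Rightarrow> 'w" where "range wy \<subseteq> W0" by (rule exE[OF ex_range_subset[OF W]]) (rule that)
  ultimately show ?case by (intro exI[of _ wy]) blast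
next
  case MTru
  obtain wy :: "'v \<Rightarrow> 'w" where "range wy \<subseteq> W0" by (rule exE[OF ex_range_subset[OF W]]) (rule that)
  then show ?case by auto
next
  case MFls
  have "refutes V e z \<psi> {[]}" for e
    using MFls(1) unfolding refutes_def max_stable_def by auto
  moreover obtain wy :: "'v \<Rightarrow> 'w" where "range wy \<subseteq> W0" by (rule exE[OF ex_range_subset[OF W]]) (rule that)
  ultimately show ?case by (intro exI[of _ wy]) blast
next
  case (MConj \<phi>1 \<phi>2)
  then obtain \<psi>1 \<psi>2 where \<psi>: "\<psi> = Conj \<psi>1 \<psi>2" "modal_form z \<phi>1 \<psi>1" "modal_form z \<phi>2 \<psi>2" by auto
  have d: "distinct (bound_vars \<psi>1)" "distinct (bound_vars \<psi>2)"
    "set (bound_vars \<psi>1) \<inter> set (bound_vars \<psi>2) = {}" using MConj.prems(2) \<psi>(1) by auto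
  obtain w1 where w1: "range w1 \<subseteq> W0" "\<And>e. range e \<subseteq> W0 \<Longrightarrow> (\<forall>y\<in>univ_vars \<psi>1. e y = w1 y) \<Longrightarrow>
      \<not> sat R V (e z) \<phi>1 \<Longrightarrow> \<exists>K. refutes V e z \<psi>1 K" using MConj.IH(1)[OF \<psi>(2) d(1)] by blast
  obtain w2 where w2: "range w2 \<subseteq> W0" "\<And>e. range e \<subseteq> W0 \<Longrightarrow> (\<forall>y\<in>univ_vars \<psi>2. e y = w2 y) \<Longrightarrow>
      \<not> sat R V (e z) \<phi>2 \<Longrightarrow> \<exists>K. refutes V e z \<psi>2 K" using MConj.IH(2)[OF \<psi>(3) d(2)] by blast
  define wy where "wy y = (if y \<in> univ_vars \<psi>1 then w1 y else w2 y)" for y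
  have "\<exists>K. refutes V e z \<psi> K"
    if e: "range e \<subseteq> W0" "\<forall>y\<in>univ_vars \<psi>. e y = wy y" "\<not> sat R V (e z) (MConj \<phi>1 \<phi>2)" for e
  proof -
    have e12: "\<forall>y\<in>univ_vars \<psi>1. e y = w1 y" "\<forall>y\<in>univ_vars \<psi>2. e y = w2 y"
      using e(2) d(3) univ_vars_bound[of \<psi>1] univ_vars_bound[of \<psi>2] unfolding wy_def \<psi>(1) by auto
    from e(3) consider "\<not> sat R V (e z) \<phi>1" | "\<not> sat R V (e z) \<phi>2" by auto
    then show ?thesis
    proof cases
      case 1
      then show ?thesis using w1(2)[OF e(1) e12(1)] refutes_Conj[of V e z False \<psi>2 \<psi>1] \<psi>(1) by auto
    next
      case 2
      then show ?thesis using w2(2)[OF e(1) e12(2)] refutes_Conj[of V e z True \<psi>2 \<psi>1] \<psi>(1) by auto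
    qed
  qed
  moreover have "range wy \<subseteq> W0" using w1(1) w2(1) unfolding wy_def by auto
  ultimately show ?case by blast
next
  case (MDisj \<phi>1 \<phi>2)
  then obtain \<psi>1 \<psi>2 where \<psi>: "\<psi> = Disj \<psi>1 \<psi>2" "modal_form z \<phi>1 \<psi>1" "modal_form z \<phi>2 \<psi>2" by auto
  have d: "distinct (bound_vars \<psi>1)" "distinct (bound_vars \<psi>2)"
    "set (bound_vars \<psi>1) \<inter> set (bound_vars \<psi>2) = {}" using MDisj.prems(2) \<psi>(1) by auto
  obtain w1 where w1: "range w1 \<subseteq> W0" "\<And>e. range e \<subseteq> W0 \<Longrightarrow> (\<forall>y\<in>univ_vars \<psi>1. e y = w1 y) \<Longrightarrow>
      \<not> sat R V (e z) \<phi>1 \<Longrightarrow> \<exists>K. refutes V e z \<psi>1 K" using MDisj.IH(1)[OF \<psi>(2) d(1)] by blast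
  obtain w2 where w2: "range w2 \<subseteq> W0" "\<And>e. range e \<subseteq> W0 \<Longrightarrow> (\<forall>y\<in>univ_vars \<psi>2. e y = w2 y) \<Longrightarrow>
      \<not> sat R V (e z) \<phi>2 \<Longrightarrow> \<exists>K. refutes V e z \<psi>2 K" using MDisj.IH(2)[OF \<psi>(3) d(2)] by blast
  define wy where "wy y = (if y \<in> univ_vars \<psi>1 then w1 y else w2 y)" for y
  have "\<exists>K. refutes V e z \<psi> K"
    if e: "range e \<subseteq> W0" "\<forall>y\<in>univ_vars \<psi>. e y = wy y" "\<not> sat R V (e z) (MDisj \<phi>1 \<phi>2)" for e
  proof -
    have e12: "\<forall>y\<in>univ_vars \<psi>1. e y = w1 y" "\<forall>y\<in>univ_vars \<psi>2. e y = w2 y"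
      using e(2) d(3) univ_vars_bound[of \<psi>1] univ_vars_bound[of \<psi>2] unfolding wy_def \<psi>(1) by auto
    obtain K where K: "refutes V e z \<psi>1 K" using w1(2)[OF e(1) e12(1)] e(3) by auto
    obtain K' where "refutes V e z \<psi>2 K'" using w2(2)[OF e(1) e12(2)] e(3) by auto
    then show ?thesis using refutes_Disj[OF K] \<psi>(1) by blast
  qed
  moreover have "range wy \<subseteq> W0" using w1(1) w2(1) unfolding wy_def by auto
  ultimately show ?case by blast
next
  case (Box \<phi>)
  then obtain y \<chi> where \<psi>: "\<psi> = All y \<chi>" "modal_form y \<phi> \<chi>" by auto
  have d: "distinct (bound_vars \<chi>)" "y \<notin> set (bound_vars \<chi>)" using Box.prems(2) \<psi>(1) by auto
  obtain w1 where w1: "range w1 \<subseteq> W0" "\<And>e. range e \<subseteq> W0 \<Longrightarrow> (\<forall>y\<in>univ_vars \<chi>. e y = w1 y) \<Longrightarrow>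
      \<not> sat R V (e y) \<phi> \<Longrightarrow> \<exists>K. refutes V e y \<chi> K" using Box.IH[OF \<psi>(2) d(1)] by blast
  \<comment> \<open>A world that falsifies the body as soon as some world of the class does. It is
    chosen before any environment is given.\<close>
  obtain u where u: "u \<in> W0" "(\<exists>v\<in>W0. \<not> sat R V v \<phi>) \<Longrightarrow> \<not> sat R V u \<phi>" using W by blast
  have "\<exists>K. refutes V e z \<psi> K"
    if e: "range e \<subseteq> W0" "\<forall>x\<in>univ_vars \<psi>. e x = (w1(y := u)) x" "\<not> sat R V (e z) (Box \<phi>)" for e
  proof -
    have "e z \<in> W0" using e(1) by auto
    then have "\<not> sat R V u \<phi>" using e(3) u(2) R by auto
    moreover have "e y = u" using e(2) \<psi>(1) by auto
    moreover have "\<forall>x\<in>univ_vars \<chi>. e x = w1 x" using e(2) d(2) univ_vars_bound[of \<chi>] unfolding \<psi>(1) by auto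
    ultimately show ?thesis using w1(2)[OF e(1)] refutes_All[of V e y \<chi>] \<psi>(1) by auto
  qed
  moreover have "range (w1(y := u)) \<subseteq> W0" using w1(1) u(1) by auto
  ultimately show ?case by blast
next
  case (Dia \<phi>)
  then obtain y \<chi> where \<psi>: "\<psi> = Ex y \<chi>" "modal_form y \<phi> \<chi>" by auto
  have d: "distinct (bound_vars \<chi>)" using Dia.prems(2) \<psi>(1) by auto
  obtain w1 where w1: "range w1 \<subseteq> W0" "\<And>e. range e \<subseteq> W0 \<Longrightarrow> (\<forall>y\<in>univ_vars \<chi>. e y = w1 y) \<Longrightarrow>
      \<not> sat R V (e y) \<phi> \<Longrightarrow> \<exists>K. refutes V e y \<chi> K" using Dia.IH[OF \<psi>(2) d(1)] by blast
  have "\<exists>K. refutes V e z \<psi> K"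
    if e: "range e \<subseteq> W0" "\<forall>x\<in>univ_vars \<psi>. e x = w1 x" "\<not> sat R V (e z) (Dia \<phi>)" for e
  proof -
    have "e z \<in> W0" "e y \<in> W0" using e(1) by auto
    \<comment> \<open>A false diamond has a false body at every world, so whatever \<open>e\<close>
      assigns to \<open>y\<close> will do.\<close>
    then have "\<not> sat R V (e y) \<phi>" using e(3) R by auto
    then show ?thesis using w1(2)[OF e(1)] refutes_Ex[of V e y \<chi>] \<psi>(1) e(2) by auto
  qed
  then show ?case using w1(1) by blast
qed

text \<open>If every literal of a maximal stable set is linked to a neighbour of another literal of it,
  then a minimal closed set of such literals together with their partners induces a bimatching.\<close>

lemma closed_minimal_cycle:
  assumes "finite K" "K \<noteq> {}" "\<And>k. k \<in> K \<Longrightarrow> \<exists>k'\<in>K. R k k'" "\<And>k. \<not> R k k"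
  shows "\<exists>S g. S \<subseteq> K \<and> S \<noteq> {} \<and> bij_betw g S S \<and> (\<forall>k\<in>S. \<forall>k'\<in>S. R k k' \<longleftrightarrow> k' = g k)"
proof -
  let ?P = "\<lambda>S. S \<subseteq> K \<and> S \<noteq> {} \<and> (\<forall>k\<in>S. \<exists>k'\<in>S. R k k')"
  define S where "S = (ARG_MIN card S. ?P S)"
  have "?P K" using assms by blast
  from arg_min_natI[of ?P, OF this] arg_min_nat_le[of ?P _ card]
  have S: "?P S" "\<And>S'. ?P S' \<Longrightarrow> card S \<le> card S'" unfolding S_def by blast+
  have fin: "finite S" using S(1) assms(1) finite_subset by blast
  \<comment> \<open>By minimality the set is no longer closed without \<open>k\<close>, so some
    \<open>j\<close> has \<open>k\<close> as its only successor. These \<open>j\<close> define an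
    injection of the finite set \<open>S\<close> into itself, and its inverse is the successor map
    \<open>g\<close>.\<close>
  have pred: "\<exists>j\<in>S. \<forall>k'\<in>S. R j k' \<longleftrightarrow> k' = k" if k: "k \<in> S" for k
  proof -
    have ne: "S - {k} \<noteq> {}" using S(1) k assms(4) by (metis Diff_eq_empty_iff singleton_iff subset_singletonD)
    have "card (S - {k}) < card S" using k fin by (intro psubset_card_mono) auto
    then have "\<not> ?P (S - {k})" using S(2) by (meson not_le)
    then obtain j where "j \<in> S" "\<forall>k'\<in>S - {k}. \<not> R j k'" using S(1) ne by blast
    moreover then obtain k' where "k' \<in> S" "R j k'" using S(1) by blast
    ultimately show ?thesis by blast
  qed
  then obtain h where h: "\<And>k. k \<in> S \<Longrightarrow> h k \<in> S \<and> (\<forall>k'\<in>S. R (h k) k' \<longleftrightarrow> k' = k)" by metis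
  have inj: "inj_on h S" using h by (metis inj_onI)
  have bij: "bij_betw h S S" using inj h fin by (simp add: bij_betw_def endo_inj_surj image_subsetI)
  define g where "g = inv_into S h"
  have g: "bij_betw g S S" unfolding g_def using bij bij_betw_inv_into by blast
  have "R k k' \<longleftrightarrow> k' = g k" if "k \<in> S" "k' \<in> S" for k k'
  proof -
    have "h (g k) = k" "g k \<in> S" unfolding g_def using bij that
      by (auto simp: bij_betw_inv_into_right intro: bij_betw_apply[OF bij_betw_inv_into])
    then show ?thesis using h that by metis
  qed
  then show ?thesis using S(1) g by blast
qed

text \<open>\<open>R k k'\<close> says that the partner of \<open>k\<close> is adjacent to
  \<open>k'\<close>. On the minimal closed set, each partner \<open>l k\<close> is adjacent to
  exactly one member, \<open>g k\<close>. Two adjacent partners would give the induced path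
  \<open>g k\<close>, \<open>l k\<close>, \<open>l k'\<close>, \<open>g k'\<close>. So in
  \<open>W\<close> the edges pair \<open>l k\<close> with \<open>g k\<close>, while the leaps pair
  \<open>l k\<close> with \<open>k\<close>.\<close>

lemma bimatching_exists:
  assumes G: "fograph G" and K: "max_stable (verts G) (adj G) K"
    and noex: "\<forall>b\<in>K. \<not> existential G b"
    and L: "\<And>k. k \<in> L \<Longrightarrow> k \<subseteq> literals G" "\<And>k k'. k \<in> L \<Longrightarrow> k' \<in> L \<Longrightarrow> k \<noteq> k' \<Longrightarrow> k \<inter> k' = {}"
      "\<And>u v. {u, v} \<in> L \<Longrightarrow> \<not> adj G u v"
    and l: "\<And>k. k \<in> K \<inter> literals G \<Longrightarrow> {k, l k} \<in> L \<and> l k \<notin> K"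
  shows "\<exists>W. induces_bimatching G L W"
proof -
  note lab = verts_literals_binders[of G]
  note irr = adj_irrefl[OF fographD(2)[OF G]]
  let ?K = "K \<inter> literals G"
  have KV: "K \<subseteq> verts G" using K unfolding max_stable_def by blast
  have fin: "finite ?K" using KV fographD(2)[OF G] finite_subset unfolding graph_def by blast
  have "verts G \<noteq> {}" using fographD(4)[OF G] unfolding literals_def by blast
  then obtain v where v: "v \<in> K" using max_stable_nonempty[OF K] by blast
  have ne: "?K \<noteq> {}"
    using v stable_literal_in_scope[OF G K noex lab v] KV lab by blast
  have lV: "l k \<in> literals G" if "k \<in> ?K" for k using L(1) l[OF that] by blast
  have stable: "\<not> adj G k k'" if "k \<in> K" "k' \<in> K" for k k'
    using max_stable_no_edge[OF K irr that] .
  define R where "R k k' \<longleftrightarrow> k \<in> ?K \<and> adj G (l k) k'" for k k'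
  have R1: "\<exists>k'\<in>?K. R k k'" if "k \<in> ?K" for k
    using max_stable_adj_literal[OF G K noex lab, of "l k"] l[OF that] lV[OF that] lab that
    unfolding R_def by blast
  have R2: "\<not> R k k" for k
    using L(3)[of k "l k"] l[of k] adj_commute[of k "l k" G] unfolding R_def by blast
  obtain S g where S: "S \<subseteq> ?K" "S \<noteq> {}" "bij_betw g S S"
    "\<forall>k\<in>S. \<forall>k'\<in>S. R k k' \<longleftrightarrow> k' = g k"
    using closed_minimal_cycle[OF fin ne R1 R2] by blast
  have lk: "{k, l k} \<in> L" "l k \<notin> K" if "k \<in> S" for k using l S(1) that by auto
  have link: "{u, v} \<in> L \<Longrightarrow> k \<in> {u, v} \<Longrightarrow> {u, v} = {k, l k}" if "k \<in> S" for u v k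
    using L(2)[of "{u, v}" "{k, l k}"] lk[OF that] by blast
  have gS: "g k \<in> S" if "k \<in> S" for k using S(3) that bij_betw_apply by metis
  have lkk: "adj G (l k) k' \<longleftrightarrow> k' = g k" if "k \<in> S" "k' \<in> S" for k k' using S(1,4) that unfolding R_def by blast
  have ll: "\<not> adj G (l k) (l k')" if k: "k \<in> S" "k' \<in> S" for k k'
  proof
    assume a: "adj G (l k) (l k')"
    then have ne: "k \<noteq> k'" using irr by auto
    then have "g k \<noteq> g k'" using S(3) k unfolding bij_betw_def inj_on_def by blast
    moreover have "l k \<noteq> l k'" using a irr by auto
    moreover have "g k \<in> K" "g k' \<in> K" using gS k S(1) by auto
    then have "g k \<notin> {l k, l k'}" "g k' \<notin> {l k, l k'}" using lk(2) k by auto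
    ultimately have "distinct [g k, l k, l k', g k']" by auto
    moreover have "adj G (g k) (l k)" "adj G (l k') (g k')" "\<not> adj G (g k) (l k')" "\<not> adj G (l k) (g k')"
      using lkk[OF k(1) gS[OF k(1)]] lkk[OF k(2) gS[OF k(2)]] lkk[OF k(2) gS[OF k(1)]]
        lkk[OF k(1) gS[OF k(2)]] \<open>g k \<noteq> g k'\<close> adj_commute by metis+
    moreover have "\<not> adj G (g k) (g k')" using stable gS k S(1) by blast
    moreover have "g k \<in> verts G" "l k \<in> verts G" "l k' \<in> verts G" "g k' \<in> verts G"
      using gS lV k S(1) lab KV by blast+
    ultimately show False using p4_freeD[OF fographD(3)[OF G]] a by blast
  qed
  define W where "W = S \<union> l ` S"
  have WL: "W \<subseteq> literals G" unfolding W_def using S(1) lV by blast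
  have edge: "induces_matching (edges G) W"
    unfolding induces_matching_def
  proof (intro conjI ballI)
    show "W \<noteq> {}" using S(2) unfolding W_def by blast
    fix v assume "v \<in> W"
    then consider "v \<in> S" | k where "k \<in> S" "v = l k" unfolding W_def by blast
    then show "\<exists>!w. w \<in> W \<and> adj G v w"
    proof cases
      case 1
      have "v \<in> g ` S" using S(3) 1 unfolding bij_betw_def by simp
      then obtain k where k: "k \<in> S" "g k = v" by blast
      show ?thesis
      proof (rule ex1I[of _ "l k"])
        show "l k \<in> W \<and> adj G v (l k)" using k lkk[OF k(1) 1] adj_commute[of v "l k" G] unfolding W_def by auto
        fix w assume w: "w \<in> W \<and> adj G v w"
        then have "w \<notin> S" using stable[of v w] 1 S(1) by blast
        then obtain k' where k': "k' \<in> S" "w = l k'" using w unfolding W_def by blast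
        then have "g k' = v" using lkk[OF k'(1) 1] w adj_commute[of v w G] by metis
        then have "k' = k" using k k' S(3) unfolding bij_betw_def inj_on_def by blast
        then show "w = l k" using k' by blast
      qed
    next
      case 2
      show ?thesis
      proof (rule ex1I[of _ "g k"])
        show "g k \<in> W \<and> adj G v (g k)" using 2 lkk[OF 2(1) gS[OF 2(1)]] gS unfolding W_def by auto
        fix w assume w: "w \<in> W \<and> adj G v w"
        then have "w \<notin> l ` S" using ll 2 by blast
        then show "w = g k" using w lkk 2 unfolding W_def by blast
      qed
    qed
  qed
  \<comment> \<open>Dependencies join binders, and \<open>W\<close> consists of literals, so only
    links count as leaps in \<open>W\<close>.\<close>
  have dep: "{u, v} \<notin> dependencies G L" if "u \<in> W" for u v
  proof
    assume "{u, v} \<in> dependencies G L"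
    then obtain b c where bc: "{u, v} = {b, c}" "existential G b" "universal G c" unfolding dependencies_def by auto
    then have "b \<in> binders G" "c \<in> binders G" unfolding existential_def universal_def by auto
    moreover have "u = b \<or> u = c" using bc(1) by (auto simp: doubleton_eq_iff)
    ultimately show False using that WL binder_not_literal by (metis subsetD)
  qed
  have leap: "induces_matching (leap_edges G L) W"
    unfolding induces_matching_def
  proof (intro conjI ballI)
    show "W \<noteq> {}" using S(2) unfolding W_def by blast
    fix v assume v: "v \<in> W"
    have iff: "{v, w} \<in> leap_edges G L \<longleftrightarrow> {v, w} \<in> L" for w
      using dep[OF v] unfolding leap_edges_def by blast
    from v consider "v \<in> S" | k where "k \<in> S" "v = l k" unfolding W_def by blast
    then show "\<exists>!w. w \<in> W \<and> {v, w} \<in> leap_edges G L"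
      unfolding iff
    proof cases
      case 1
      show "\<exists>!w. w \<in> W \<and> {v, w} \<in> L"
      proof (rule ex1I[of _ "l v"])
        show "l v \<in> W \<and> {v, l v} \<in> L" using lk 1 unfolding W_def by blast
        fix w assume "w \<in> W \<and> {v, w} \<in> L"
        then have "{v, w} = {v, l v}" using link[OF 1] by blast
        then show "w = l v" by (auto simp: doubleton_eq_iff)
      qed
    next
      case 2
      have s: "{l k, k} \<in> L" using lk(1)[OF 2(1)] by (simp add: insert_commute)
      show "\<exists>!w. w \<in> W \<and> {v, w} \<in> L"
      proof (rule ex1I[of _ k])
        show "k \<in> W \<and> {v, k} \<in> L" using s 2 unfolding W_def by blast
        fix w assume w: "w \<in> W \<and> {v, w} \<in> L"
        have "{v, w} = {k, l k}" using L(2)[of "{v, w}" "{k, l k}"] w lk(1)[OF 2(1)] 2(2) by blast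
        then show "w = k" using 2(2) lk(2)[OF 2(1)] S(1) 2(1) by (auto simp: doubleton_eq_iff)
      qed
    qed
  qed
  have "W \<subseteq> verts G" using WL lab by blast
  then show ?thesis using edge leap unfolding induces_bimatching_def by blast
qed


section \<open>Renaming the binders of a fograph\<close>

lemma rename_binders_simps [simp]:
  "verts (rename_binders r G) = verts G" "edges (rename_binders r G) = edges G"
  unfolding rename_binders_def by auto

lemma label_rename_Binder: "label G v = Binder x \<Longrightarrow> label (rename_binders r G) v = Binder (r v)"
  unfolding rename_binders_def by auto

lemma label_rename_Literal:
  "label G v = Literal a \<Longrightarrow> label (rename_binders r G) v = Literal (map_atom id id
           (\<lambda>x. if \<exists>b. binds_var G b x v then r (THE b. binds_var G b x v) else x) a)"
  unfolding rename_binders_def by auto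

lemma rename_binders_sets [simp]:
  "literals (rename_binders r G) = literals G" "binders (rename_binders r G) = binders G"
proof -
  have "x \<in> literals (rename_binders r G) \<longleftrightarrow> x \<in> literals G"
    "x \<in> binders (rename_binders r G) \<longleftrightarrow> x \<in> binders G" for x
    by (cases "label G x"; simp add: literals_def binders_def rename_binders_def)+
  then show "literals (rename_binders r G) = literals G" "binders (rename_binders r G) = binders G" by auto
qed

lemma graph_module_rename [simp]: "graph_module (rename_binders r G) = graph_module G"
  unfolding graph_module_iff fun_eq_iff by simp

lemma scope_rename [simp]: "scope (rename_binders r G) = scope G"
  unfolding scope_def proper_strong_module_def strong_module_def by simp

lemma existential_rename [simp]: "existential (rename_binders r G) = existential G"
  unfolding existential_def fun_eq_iff by simp

lemma universal_rename [simp]: "universal (rename_binders r G) = universal G"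
  unfolding universal_def fun_eq_iff by simp

lemma binds_var_unique: "fograph G \<Longrightarrow> binds_var G b x l \<Longrightarrow> binds_var G c x l \<Longrightarrow> b = c"
  using binds_unique unfolding binds_var_def by metis

lemma label_rename_bound:
  assumes "fograph G" "binds_var G b z v" "label G v = Literal (Pred P [Var z])"
  shows "label (rename_binders r G) v = Literal (Pred P [Var (r b)])"
proof -
  have "(THE b. binds_var G b z v) = b"
    by (rule the_equality, rule assms(2), rule binds_var_unique[OF assms(1) _ assms(2)])
  then show ?thesis using label_rename_Literal[OF assms(3), of r] assms(2) by (auto simp: psym.map_id)
qed

lemma label_rename_free:
  assumes "\<nexists>b. binds_var G b z v" "label G v = Literal (Pred P [Var z])"
  shows "label (rename_binders r G) v = Literal (Pred P [Var z])"
  using label_rename_Literal[OF assms(2), of r] assms(1) by (auto simp: psym.map_id)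


lemma rectified_inj_on:
  assumes "rectified_fograph (rename_binders r G)"
  shows "inj_on r (binders G)"
proof (rule inj_onI)
  fix b c assume bc: "b \<in> binders G" "c \<in> binders G" "r b = r c"
  then obtain x y where "label G b = Binder x" "label G c = Binder y" unfolding binders_def by blast
  then have "label (rename_binders r G) b = Binder (r b)" "label (rename_binders r G) c = Binder (r b)"
    using label_rename_Binder bc(3) by metis+
  then show "b = c" using assms bc unfolding rectified_fograph_def by (metis rename_binders_sets(2))
qed

lemma existential_vars_rename:
  assumes "inj_on r (binders G)" "b \<in> binders G"
  shows "r b \<in> existential_vars (rename_binders r G) \<longleftrightarrow> existential G b"
proof
  assume "r b \<in> existential_vars (rename_binders r G)"
  then obtain c where c: "existential G c" "label (rename_binders r G) c = Binder (r b)"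
    unfolding existential_vars_def by auto
  then have cb: "c \<in> binders G" unfolding existential_def by blast
  then obtain x where "label G c = Binder x" unfolding binders_def by blast
  then have "r c = r b" using label_rename_Binder c(2) by fastforce
  then show "existential G b" using inj_onD[OF assms(1) _ cb assms(2)] c(1) by auto
next
  assume e: "existential G b"
  obtain x where "label G b = Binder x" using assms(2) unfolding binders_def by blast
  then show "r b \<in> existential_vars (rename_binders r G)"
    using e label_rename_Binder unfolding existential_vars_def by fastforce
qed

lemma existential_vars_rename_range: "existential_vars (rename_binders r G) \<subseteq> r ` binders G"
proof
  fix x assume "x \<in> existential_vars (rename_binders r G)"
  then obtain c where c: "existential G c" "label (rename_binders r G) c = Binder x"
    unfolding existential_vars_def by auto
  then have cb: "c \<in> binders G" unfolding existential_def by blast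
  then obtain y where "label G c = Binder y" unfolding binders_def by blast
  then have "r c = x" using label_rename_Binder c(2) by fastforce
  then show "x \<in> r ` binders G" using cb by blast
qed

theorem soundness:
  fixes N :: "('a, 'f, 'p, 'v) fograph"
  assumes mf: "modal_form x0 \<phi> \<psi>" and dist: "distinct (bound_vars \<psi>)" and x0: "x0 \<notin> set (bound_vars \<psi>)"
    and net: "fonet N L" and f: "skew_bifibration N (graph_of \<psi>) f"
    and R: "equiv W R" and w0: "w0 \<in> W"
  shows "sat R V w0 \<phi>"
proof (rule ccontr)
  assume neg: "\<not> sat R V w0 \<phi>"
  let ?H = "graph_of \<psi>"
  note D = skew_bifibrationD[OF f]
  \<comment> \<open>On the equivalence class of \<open>w0\<close> the accessibility relation is
    total, as \<open>refutation_exists\<close> asks for.\<close>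
  define W0 where "W0 = R `` {w0}"
  have w0W: "w0 \<in> W0" using R w0 unfolding W0_def equiv_def refl_on_def by blast
  have RW: "(u, v) \<in> R \<longleftrightarrow> v \<in> W0" if "u \<in> W0" for u v
    using R that unfolding W0_def equiv_def sym_def trans_def by blast
  obtain wy where wy: "range wy \<subseteq> W0" "\<And>e. range e \<subseteq> W0 \<Longrightarrow> (\<forall>y\<in>univ_vars \<psi>. e y = wy y) \<Longrightarrow>
      \<not> sat R V (e x0) \<phi> \<Longrightarrow> \<exists>K. refutes V e x0 \<psi> K"
    using refutation_exists[of W0 R x0 \<phi> \<psi> V, OF _ RW mf dist] w0W by blast
  obtain r \<delta> where r: "rectified_fograph (rename_binders r N)" "r ` binders N \<inter> graph_free_vars N = {}"
    and \<delta>: "dualizer (rename_binders r N) L \<delta>" and nobi: "\<nexists>W. induces_bimatching (rename_binders r N) L W"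
    and lf: "linked_fograph N L"
    using net unfolding fonet_def rectified_form_graph_def by blast
  define N' where "N' = rename_binders r N"
  have rinj: "inj_on r (binders N)" using rectified_inj_on[OF r(1)] .
  have fN: "fograph N" using D(1) .
  define \<sigma> where "\<sigma> x = (if x \<in> existential_vars N' then \<delta> x else Var x)" for x
  define nonex where "nonex b \<longleftrightarrow> b \<in> binders N \<and> \<not> existential N b" for b
  \<comment> \<open>Values for the variables of the rectified net: the variable of a non-existential
    binder gets the witness fixed for the original label, and every other variable defaults to
    \<open>w0\<close>.\<close>
  define u where "u z = (if \<exists>b. nonex b \<and> r b = z
    then wy (SOME y. \<exists>b. nonex b \<and> r b = z \<and> label N b = Binder y) else w0)" for z
  \<comment> \<open>Terms with a function symbol get the default \<open>w0\<close>. Any fixed value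
    will do, because the dualizer makes the terms of linked literals equal.\<close>
  define tval :: "('f, 'v) tm \<Rightarrow> _" where "tval t = (case t of Var z \<Rightarrow> u z | Fn g ts \<Rightarrow> w0)" for t
  define val where "val v = (case label N' v of Literal (Pred P (Var z # ts)) \<Rightarrow> tval (\<sigma> z) | _ \<Rightarrow> w0)" for v
  have tvalW: "tval t \<in> W0" for t using wy(1) w0W unfolding tval_def u_def by (auto split: tm.splits)
  have u_nonex: "u (r b) = wy z" if "nonex b" "label N b = Binder z" for b z
  proof -
    have bb: "b' = b" if "nonex b'" "r b' = r b" for b'
      using inj_onD[OF rinj that(2)] that(1) \<open>nonex b\<close> unfolding nonex_def by blast
    have "(SOME y. \<exists>b'. nonex b' \<and> r b' = r b \<and> label N b' = Binder y) = z"
    proof (rule some_equality)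
      fix y assume "\<exists>b'. nonex b' \<and> r b' = r b \<and> label N b' = Binder y"
      then obtain b' where "nonex b'" "r b' = r b" "label N b' = Binder y" by blast
      moreover then have "b' = b" using bb by blast
      ultimately show "y = z" using that(2) by simp
    qed (use that in blast)
    then show ?thesis using that unfolding u_def by auto
  qed
  have lit: "a = Pred P ts \<Longrightarrow> ts = [Var (cur x0 \<psi> (f v))]" "sub \<psi> (f v) = Some (Atm a)"
    if "v \<in> literals N" "label N v = Literal a" for v a P ts
  proof -
    have v: "v \<in> verts N" using that unfolding literals_def by blast
    then show s: "sub \<psi> (f v) = Some (Atm a)"
      using flabel_iff[OF D(6)[OF v]] D(3)[OF v] that(2) vlab_Literal by metis
    show "ts = [Var (cur x0 \<psi> (f v))]" if "a = Pred P ts"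
      using modal_form_Atm[OF mf] s that by blast
  qed
  have lab': "\<exists>t. label N' v = Literal (Pred P [Var t]) \<and> val v = tval (\<sigma> t)"
    if "v \<in> literals N" "label N v = Literal (Pred P ts)" for v P ts
  proof -
    have l: "label N v = Literal (Pred P [Var (cur x0 \<psi> (f v))])" using lit(1)[OF that] that(2) by simp
    have "\<exists>t. label N' v = Literal (Pred P [Var t])"
      using label_rename_bound[OF fN _ l] label_rename_free[OF _ l] unfolding N'_def by blast
    then show ?thesis unfolding val_def by auto
  qed
  have bpos: "\<exists>\<chi> \<xi>. sub \<psi> (f b) = Some \<chi> \<and> quantifies \<chi> z \<xi>" if "b \<in> binders N" "label N b = Binder z" for b z
  proof -
    have b: "b \<in> verts N" using that unfolding binders_def by blast
    show ?thesis using flabel_iff[OF D(6)[OF b]] D(3)[OF b] that(2) vlab_Binder by metis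
  qed
  have same: "f b = f c" if "b \<in> binders N" "label N b = Binder z" "c \<in> binders N" "label N c = Binder z" for b c z
    using bpos that bound_position_unique[OF dist] by metis
  define T where "T = {v. existential N v} \<union> {v \<in> literals N. \<exists>a. label N v = Literal a \<and> atom_holds V (val v) a}"
  have finN: "finite (verts N)" "verts N \<noteq> {}"
    using fographD(2,4)[OF fN] unfolding graph_def literals_def by auto
  from max_clique_or_max_stable[OF finN symp_adj fographD(3)[OF fN], of T]
  show False
  proof (elim disjE exE conjE)
    fix C assume C: "max_clique (verts N) (adj N) C" "C \<subseteq> T"
    \<comment> \<open>Several binders of \<open>N\<close> may lie over one existential quantifier,
      with different terms. The environment follows those in the clique. There is at most one for
      each variable, since two would be adjacent and have the same image.\<close>
    define ex where "ex z b \<longleftrightarrow> b \<in> C \<and> existential N b \<and> label N b = Binder z" for z b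
    have ex_bind: "b \<in> binders N" "b \<in> verts N" "label N b = Binder z" if "ex z b" for z b
      using that unfolding ex_def existential_def binders_def by auto
    have ex_unique: "b = c" if "ex z b" "ex z c" for z b c
    proof (rule ccontr)
      assume "b \<noteq> c"
      then have "adj N b c" using C(1) that unfolding max_stable_def compl_rel_def ex_def by blast
      then have "fadj \<psi> (f b) (f c)" by (rule D(7)[OF ex_bind(2)[OF that(1)] ex_bind(2)[OF that(2)]])
      moreover have "f b = f c"
        by (rule same[OF ex_bind(1)[OF that(1)] ex_bind(3)[OF that(1)] ex_bind(1)[OF that(2)] ex_bind(3)[OF that(2)]])
      ultimately show False using fadj_irrefl by metis
    qed
    define e where "e z = (if \<exists>b. ex z b then tval (\<sigma> (r (THE b. ex z b)))
       else if z \<in> set (bound_vars \<psi>) then wy z else w0)" for z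
    have e_ex: "e z = tval (\<sigma> (r b))" if "ex z b" for z b
    proof -
      have "(THE b. ex z b) = b" using that ex_unique by blast
      then show ?thesis using that unfolding e_def by auto
    qed
    have eW: "range e \<subseteq> W0" using wy(1) w0W tvalW unfolding e_def by auto
    have "\<not> ex x0 b" for b
    proof
      assume b: "ex x0 b"
      obtain \<chi> \<xi> where "sub \<psi> (f b) = Some \<chi>" "quantifies \<chi> x0 \<xi>"
        using bpos[OF ex_bind(1)[OF b] ex_bind(3)[OF b]] by blast
      then show False using bound_vars_sub x0 by metis
    qed
    then have ex0: "e x0 = w0" using x0 unfolding e_def by auto
    have euniv: "\<forall>y\<in>univ_vars \<psi>. e y = wy y"
    proof
      fix y assume y: "y \<in> univ_vars \<psi>"
      obtain p \<chi> where p: "sub \<psi> p = Some (All y \<chi>)" using univ_vars_sub[OF y] by blast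
      have "\<not> ex y b" for b
      proof
        assume b: "ex y b"
        obtain \<chi>' \<xi> where q: "sub \<psi> (f b) = Some \<chi>'" "quantifies \<chi>' y \<xi>" using bpos ex_bind[OF b] by blast
        have "f b = p" using bound_position_unique[OF dist q p] unfolding quantifies_def by blast
        moreover have "existential ?H (f b)" using D(4) b unfolding ex_def by blast
        ultimately show False using p unfolding existential_graph_of[OF dist] by auto
      qed
      then show "e y = wy y" using univ_vars_bound[of \<psi>] y unfolding e_def by auto
    qed
    obtain K where K: "refutes V e x0 \<psi> K" using wy(2)[OF eW euniv] neg ex0 by auto
    have irr: "\<And>v. \<not> adj N v v" "\<And>v. \<not> fadj \<psi> v v"
      using adj_irrefl[OF fographD(2)[OF fN]] fadj_irrefl by blast+
    have "finite (fverts \<psi>)" using graph_graph_of unfolding graph_def by blast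
    \<comment> \<open>The preimage of the refuting set is maximal stable in the net and so meets the
      clique. The common vertex is in \<open>T\<close> but lies over \<open>K\<close>, which
      contains neither existential binders nor true literals.\<close>
    then have "max_stable (verts N) (adj N) {v \<in> verts N. f v \<in> K}"
      using skew_fib_max_stable[OF _ fographD(3)[OF fN] p4_free_fadj symp_adj symp_adj irr D(5)] K
      unfolding refutes_def by blast
    from max_clique_meets_max_stable[OF finN(1) fographD(3)[OF fN] symp_adj finN(2) C(1) this irr(1)]
    obtain v where v: "v \<in> C" "v \<in> verts N" "f v \<in> K" by blast
    have "v \<in> T" using v(1) C(2) by blast
    then consider "existential N v" | a where "v \<in> literals N" "label N v = Literal a" "atom_holds V (val v) a"
      unfolding T_def by blast
    then show False
    proof cases
      case 1
      then have "\<exists>x \<xi>. sub \<psi> (f v) = Some (Ex x \<xi>)" using D(4) existential_graph_of[OF dist] by blast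
      then show False using K v(3) unfolding refutes_def by blast
    next
      case 2
      note sv = lit(2)[OF 2(1,2)]
      define z where "z = cur x0 \<psi> (f v)"
      have nh: "\<not> atom_holds V (e z) a" using K v(3) sv unfolding refutes_def z_def by blast
      then obtain P ts where a0: "a = Pred P ts" using 2(3) by (cases a) auto
      then have a: "a = Pred P [Var z]" using lit(1)[OF 2(1,2)] unfolding z_def by blast
      \<comment> \<open>The net and the environment agree on the literal: an existential binder of
        \<open>v\<close> belongs to the clique; if the binder of \<open>v\<close> is not
        existential, no binder in the clique has its label, by \<open>existential_reflected\<close>;
        and a variable without a binder can only be \<open>x0\<close>.\<close>
      have "val v = e z"
      proof (cases "\<exists>b. binds_var N b z v")
        case True
        then obtain b where b: "binds N b v" "label N b = Binder z" "binds_var N b z v" unfolding binds_var_def by blast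
        then have bb: "b \<in> binders N" unfolding binds_def by blast
        have "label N' v = Literal (Pred P [Var (r b)])"
          using label_rename_bound[OF fN b(3)] 2(2) a unfolding N'_def by blast
        then have vv: "val v = tval (\<sigma> (r b))" unfolding val_def by simp
        show ?thesis
        proof (cases "existential N b")
          case True
          then have "b \<in> C" using existential_in_max_clique[OF fN C(1) v(1) b(1)] by blast
          then show ?thesis using e_ex[of z b] vv True b(2) unfolding ex_def by auto
        next
          case False
          then have ne: "nonex b" using bb unfolding nonex_def by blast
          have "r b \<notin> existential_vars N'" using existential_vars_rename[OF rinj bb] False unfolding N'_def by blast
          then have "val v = u (r b)" using vv unfolding \<sigma>_def tval_def by simp
          then have vw: "val v = wy z" using u_nonex[OF ne b(2)] by simp
          have "\<not> ex z c" for c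
          proof
            assume c: "ex z c"
            have "f c = f b" using same ex_bind[OF c] bb b(2) by blast
            moreover have "existential ?H (f c)" using D(4) c unfolding ex_def by blast
            ultimately show False using existential_reflected[OF f b(1)] False by simp
          qed
          moreover have "z \<in> set (bound_vars \<psi>)" using bpos[OF bb b(2)] by (auto intro: bound_vars_sub)
          ultimately show ?thesis using vw unfolding e_def by auto
        qed
      next
        case False
        have zx: "z = x0"
        proof (rule ccontr)
          assume "z \<noteq> x0"
          then obtain q \<chi>' \<xi> where q: "sub \<psi> q = Some \<chi>'" "quantifies \<chi>' z \<xi>" "binds ?H q (f v)"
            using atom_bound_in_graph_of[OF mf, of "f v" P z] sv a by blast
          then have qb: "label ?H q = Binder z" using flabel[OF q(1)] vlab_Binder[of \<chi>' z] by blast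
          from q(3)
          obtain b where b: "binds N b v" "f b = q" using D(9)[OF v(2)] by blast
          then have "b \<in> verts N" unfolding binds_def binders_def by blast
          then have "label N b = Binder z" using D(3) b(2) qb by metis
          then show False using False b(1) unfolding binds_var_def by blast
        qed
        have "label N' v = Literal (Pred P [Var z])"
          using label_rename_free[OF False] 2(2) a unfolding N'_def by blast
        then have vv: "val v = tval (\<sigma> z)" unfolding val_def by simp
        have "z \<in> graph_free_vars N" using 2(1,2) a False unfolding graph_free_vars_def by fastforce
        then have zr: "z \<notin> r ` binders N" using r(2) by blast
        then have "z \<notin> existential_vars N'" using existential_vars_rename_range[of r N] unfolding N'_def by blast
        then have "val v = u z" using vv unfolding \<sigma>_def tval_def by simp
        also have "u z = w0" using zr unfolding u_def nonex_def by auto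
        finally show ?thesis using ex0 zx by simp
      qed
      then show False using nh 2(3) by simp
    qed
  next
    fix K assume K: "max_stable (verts N) (adj N) K" "K \<inter> T = {}"
    have fN': "fograph N'" using r(1) unfolding rectified_fograph_def N'_def by blast
    have links: "\<exists>v w a b. k = {v, w} \<and> v \<noteq> w \<and> v \<in> verts N \<and> w \<in> verts N \<and> {v, w} \<notin> edges N \<and>
        label N v = Literal a \<and> label N w = Literal b \<and> predual a b" if "k \<in> L" for k
      using lf that unfolding linked_fograph_def by blast
    have Kf: "\<not> atom_holds V (val k) a" if "k \<in> K" "label N k = Literal a" for k a
    proof -
      have "k \<in> literals N" using that K(1) unfolding max_stable_def literals_def by blast
      then show ?thesis using K(2) that unfolding T_def by blast
    qed
    \<comment> \<open>The dualizer gives both ends of a link the same term, hence the same value. So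
      one of the two dual literals is true and lies in \<open>T\<close>, which \<open>K\<close>
      avoids.\<close>
    have both: False if kl: "{v, w} \<in> L" "v \<in> K" "w \<in> K" "label N v = Literal a" "label N w = Literal b" "predual a b" for v w a b
    proof -
      have vw: "v \<in> literals N" "w \<in> literals N" using kl(2-5) K(1) unfolding max_stable_def literals_def by blast+
      have nv: "\<not> atom_holds V (val v) a" "\<not> atom_holds V (val w) b" using Kf kl by blast+
      obtain P ts us where ab: "a = Pred P ts" "b = Pred (dual_psym P) us"
        using kl(6) nv by (cases a; cases b) auto
      obtain t t' where t: "label N' v = Literal (Pred P [Var t])" "val v = tval (\<sigma> t)"
        "label N' w = Literal (Pred (dual_psym P) [Var t'])" "val w = tval (\<sigma> t')"
        using lab'[OF vw(1)] lab'[OF vw(2)] kl(4,5) ab by blast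
      have "subst_atom \<sigma> (Pred (dual_psym P) [Var t']) = dual_atom (subst_atom \<sigma> (Pred P [Var t]))"
        using \<delta>[unfolded dualizer_def Let_def, folded N'_def] kl(1) t(1,3)
        unfolding \<sigma>_def[abs_def] by blast
      then have "val v = val w" using t by simp
      then show False using nv ab by (cases P) auto
    qed
    have "\<exists>m. {k, m} \<in> L \<and> m \<notin> K" if k: "k \<in> K \<inter> literals N'" for k
    proof -
      have kl: "k \<in> literals N" using k unfolding N'_def by simp
      obtain a where a: "label N k = Literal a" using kl unfolding literals_def by blast
      have "a \<noteq> Tru" using Kf[of k a] k a by auto
      moreover have "label N k = Literal Tru \<or> k \<in> \<Union>L"
        using lf kl unfolding linked_fograph_def by blast
      ultimately obtain l where l: "l \<in> L" "k \<in> l" using a by auto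
      obtain v w a' b where vw: "l = {v, w}" "label N v = Literal a'" "label N w = Literal b" "predual a' b"
        using links[OF l(1)] by blast
      have "\<not> (v \<in> K \<and> w \<in> K)" using both[OF _ _ _ vw(2-4)] l(1) vw(1) by blast
      moreover have "k = v \<or> k = w" using l(2) vw(1) by blast
      ultimately show ?thesis using l(1) vw(1) k by (metis IntD1 insert_commute)
    qed
    then obtain l where l: "\<And>k. k \<in> K \<inter> literals N' \<Longrightarrow> {k, l k} \<in> L \<and> l k \<notin> K" by metis
    have "\<exists>W. induces_bimatching N' L W"
    proof (rule bimatching_exists[OF fN', of K])
      show "max_stable (verts N') (adj N') K" using K(1) unfolding N'_def by simp
      show "\<forall>b\<in>K. \<not> existential N' b" using K(2) unfolding T_def N'_def by auto
      show "k \<subseteq> literals N'" if "k \<in> L" for k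
        unfolding N'_def rename_binders_sets using links[OF that] by (auto simp: literals_def)
      show "k \<inter> k' = {}" if "k \<in> L" "k' \<in> L" "k \<noteq> k'" for k k'
        using lf that unfolding linked_fograph_def by blast
      show "\<not> adj N' v w" if "{v, w} \<in> L" for v w
        using links[OF that] unfolding N'_def by (auto simp: doubleton_eq_iff insert_commute)
    qed (use l in blast)
    then show False using nobi unfolding N'_def by blast
  qed
qed

section \<open>Completeness\<close>

text \<open>The relational form of \<open>induces_matching\<close>, since nets have their adjacency
  as a relation on vertices.\<close>

definition matched :: "('a \<Rightarrow> 'a \<Rightarrow> bool) \<Rightarrow> 'a set \<Rightarrow> bool" where
  "matched R W \<longleftrightarrow> W \<noteq> {} \<and> (\<forall>v\<in>W. \<exists>!w. w \<in> W \<and> R v w)"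

lemma matched_cong: "(\<And>u v. u \<in> W \<Longrightarrow> v \<in> W \<Longrightarrow> R u v \<longleftrightarrow> R' u v) \<Longrightarrow> matched R W \<longleftrightarrow> matched R' W"
  unfolding matched_def by (intro conj_cong refl ball_cong) metis

lemma matchedD: "matched R W \<Longrightarrow> v \<in> W \<Longrightarrow> \<exists>w\<in>W. R v w"
  unfolding matched_def by blast

text \<open>An item \<open>(p, a)\<close> is the subformula at position \<open>p\<close>, taken at the world named \<open>a\<close>. A net over
  a set of items is a linked cograph, each vertex \<open>v\<close> of which lies over the position \<open>f v\<close> below
  the item \<open>it v\<close>. Worlds are named by \<open>x0\<close> and by the variables of the universal quantifiers. The
  world of a literal or an existential binder is \<open>den v\<close>: a name, until the universal binder that
  introduces this name becomes a vertex. \<open>Bd b\<close> is the body of a binder. The condition on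
  bimatchings allows for fewer leaps than those given by \<open>L\<close> and \<open>den\<close>.\<close>

locale net =
  fixes \<psi> :: "('f, 'p, 'v) fm" and x0 :: 'v and P :: "(bool list \<times> 'v) set" and Fb :: "bool list set"
    and V :: "nat set" and E :: "nat \<Rightarrow> nat \<Rightarrow> bool" and f :: "nat \<Rightarrow> bool list"
    and it :: "nat \<Rightarrow> bool list \<times> 'v" and L :: "nat set set" and den :: "nat \<Rightarrow> 'v + nat"
    and Bd :: "nat \<Rightarrow> nat set"
  assumes fin: "finite V" and ne: "V \<noteq> {}"
    and E_sym: "\<And>u v. E u v \<Longrightarrow> E v u"
    and E_V: "\<And>u v. E u v \<Longrightarrow> u \<in> V \<and> v \<in> V"
    and p4: "p4_free V E"
    and it_P: "\<And>v. v \<in> V \<Longrightarrow> it v \<in> P"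
    and f_H: "\<And>v. v \<in> V \<Longrightarrow> f v \<in> fverts \<psi> \<and> (\<exists>u. f v = fst (it v) @ u)"
    and E_it: "\<And>u v. E u v \<Longrightarrow> it u = it v"
    and hom: "\<And>u v. E u v \<Longrightarrow> fadj \<psi> (f u) (f v)"
    and skew: "\<And>u v. v \<in> V \<Longrightarrow> fadj \<psi> (fst (it v) @ u) (f v) \<Longrightarrow> \<exists>w. E w v \<and> \<not> fadj \<psi> (f w) (fst (it v) @ u)"
    and link: "\<And>k. k \<in> L \<Longrightarrow> \<exists>v w Q ts us. k = {v, w} \<and> v \<noteq> w \<and> v \<in> V \<and> w \<in> V \<and> \<not> E v w \<and>
      sub \<psi> (f v) = Some (Atm (Pred Q ts)) \<and> sub \<psi> (f w) = Some (Atm (Pred (dual_psym Q) us)) \<and> den v = den w"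
    and link_disj: "\<And>k k'. k \<in> L \<Longrightarrow> k' \<in> L \<Longrightarrow> k \<noteq> k' \<Longrightarrow> k \<inter> k' = {}"
    and cover: "\<And>v a. v \<in> V \<Longrightarrow> sub \<psi> (f v) = Some (Atm a) \<Longrightarrow> a = Tru \<or> v \<in> \<Union>L"
    and body: "\<And>b \<chi> x \<xi>. b \<in> V \<Longrightarrow> sub \<psi> (f b) = Some \<chi> \<Longrightarrow> quantifies \<chi> x \<xi> \<Longrightarrow>
      Bd b \<subseteq> V \<and> b \<notin> Bd b \<and> (\<exists>l\<in>Bd b. \<exists>a. sub \<psi> (f l) = Some (Atm a)) \<and>
      (\<forall>u\<in>Bd b. it u = it b \<and> (E b u \<longleftrightarrow> \<chi> = Ex x \<xi>)) \<and>
      (\<forall>w\<in>V. w \<notin> Bd b \<longrightarrow> w \<noteq> b \<longrightarrow> (\<forall>u\<in>Bd b. E w u \<longleftrightarrow> E w b))"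
    and binding: "\<And>v Q z. v \<in> V \<Longrightarrow> sub \<psi> (f v) = Some (Atm (Pred Q [Var z])) \<Longrightarrow>
      (\<exists>b\<in>V. \<exists>\<chi> \<xi>. sub \<psi> (f b) = Some \<chi> \<and> quantifies \<chi> z \<xi> \<and> v \<in> Bd b \<and>
        den v = (if \<chi> = Ex z \<xi> then den b else Inr b)) \<or>
      (z = cur x0 \<psi> (fst (it v)) \<and> den v = Inl (snd (it v)))"
    and univ_sep: "\<And>b c x \<xi>. b \<in> V \<Longrightarrow> c \<in> V \<Longrightarrow> b \<noteq> c \<Longrightarrow> f b = f c \<Longrightarrow> sub \<psi> (f b) = Some (All x \<xi>) \<Longrightarrow>
      \<exists>u. E u b \<and> \<not> E u c"
    and univ_isolated: "\<And>b x \<xi>. b \<in> V \<Longrightarrow> sub \<psi> (f b) = Some (All x \<xi>) \<Longrightarrow> (\<And>u. \<not> E u b) \<Longrightarrow>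
      (\<exists>x \<xi>. sub \<psi> (fst (it b)) = Some (All x \<xi>)) \<or> (\<exists>\<xi> \<xi>'. sub \<psi> (fst (it b)) = Some (Disj \<xi> \<xi>'))"
    and univ_Fb: "\<And>b x \<xi>. b \<in> V \<Longrightarrow> sub \<psi> (f b) = Some (All x \<xi>) \<Longrightarrow> f b \<notin> Fb"
    and den_V: "\<And>b c. b \<in> V \<Longrightarrow> den b = Inr c \<Longrightarrow> c \<in> V \<and> c \<noteq> b"
    and nobim: "\<And>W E'. W \<subseteq> V \<Longrightarrow> E' \<subseteq> L \<union> {{b, c} |b c. b \<in> V \<and> den b = Inr c} \<Longrightarrow>
      matched E W \<Longrightarrow> \<not> matched (\<lambda>u v. {u, v} \<in> E') W"
begin

lemma E_irrefl: "\<not> E v v"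
  using hom fadj_irrefl by blast

text \<open>If the position is adjacent to \<open>f v\<close>, the skew condition provides
  \<open>w\<close>; otherwise \<open>v\<close> itself serves. This yields the skew condition for
  vertices that are joined to everything over an item.\<close>

lemma onto:
  assumes "v \<in> V" "fst (it v) @ u \<in> fverts \<psi>"
  shows "\<exists>w\<in>V. it w = it v \<and> \<not> fadj \<psi> (f w) (fst (it v) @ u)"
proof (cases "fadj \<psi> (fst (it v) @ u) (f v)")
  case True
  then show ?thesis using skew[OF assms(1)] E_it E_V by blast
next
  case False
  then show ?thesis using assms(1) adj_commute by metis
qed

lemma literal_in_item:
  assumes "v \<in> V"
  shows "\<exists>l\<in>V. it l = it v \<and> (\<exists>a. sub \<psi> (f l) = Some (Atm a))"
proof -
  have "f v \<in> fverts \<psi>" using f_H[OF assms] by blast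
  then obtain \<chi> l where \<chi>: "sub \<psi> (f v) = Some \<chi>" "vlab \<chi> = Some l" unfolding fverts_iff by blast
  show ?thesis
  proof (cases l)
    case (Literal a)
    then have "\<chi> = Atm a" using \<chi>(2) vlab_Literal[of \<chi> a] by simp
    then show ?thesis using \<chi>(1) assms by blast
  next
    case (Binder x)
    then have "\<exists>\<xi>. quantifies \<chi> x \<xi>" using \<chi>(2) vlab_Binder[of \<chi> x] by simp
    then obtain \<xi> where "quantifies \<chi> x \<xi>" by blast
    from body[OF assms \<chi>(1) this] show ?thesis by blast
  qed
qed

end

section \<open>Constructions of nets\<close>

lemma net_weaken:
  assumes "net \<psi> x0 P Fb V E f it L den Bd" "P \<subseteq> P'" "Fb' \<subseteq> Fb"
  shows "net \<psi> x0 P' Fb' V E f it L den Bd"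
proof -
  interpret net \<psi> x0 P Fb V E f it L den Bd by fact
  show ?thesis
  proof (unfold_locales, goal_cases)
    case (6 v) then show ?case using it_P assms(2) by blast
  next
    case (18 b x \<xi>) then show ?case using univ_Fb assms(3) by blast
  qed (fact fin ne E_sym E_V p4 f_H E_it hom skew link link_disj cover body binding univ_sep
      univ_isolated den_V nobim)+
qed

text \<open>For steps whose new item has no vertex over it: such a step is skipped, instead of
  adding a binder with an empty body or joining an empty part.\<close>

lemma net_drop:
  assumes "net \<psi> x0 (insert i P) Fb V E f it L den Bd" "\<And>v. v \<in> V \<Longrightarrow> it v \<noteq> i"
  shows "net \<psi> x0 P Fb V E f it L den Bd"
proof -
  interpret net \<psi> x0 "insert i P" Fb V E f it L den Bd by fact
  show ?thesis
  proof (unfold_locales, goal_cases)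
    case (6 v) then show ?case using it_P assms(2) by blast
  qed (fact fin ne E_sym E_V p4 f_H E_it hom skew link link_disj cover body binding univ_sep
      univ_isolated univ_Fb den_V nobim)+
qed

lemma net_axiom:
  assumes mf: "modal_form x0 \<phi> \<psi>"
    and p: "sub \<psi> p = Some (Atm (Pred Q ts))" and q: "sub \<psi> q = Some (Atm (Pred (dual_psym Q) us))"
    and P: "(p, a) \<in> P" "(q, a) \<in> P"
  shows "net \<psi> x0 P Fb {n, Suc n} (\<lambda>_ _. False) (\<lambda>v. if v = n then p else q)
    (\<lambda>v. if v = n then (p, a) else (q, a)) {{n, Suc n}} (\<lambda>_. Inl a) (\<lambda>_. {})"
proof -
  have at: "sub \<psi> (if v = n then p else q) = Some (Atm (if v = n then Pred Q ts else Pred (dual_psym Q) us))" for v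
    using p q by simp
  have fv: "(if v = n then p else q) \<in> fverts \<psi>" for v
    using at[of v] fverts_iff by fastforce
  have nofadj: "\<not> fadj \<psi> ((if v = n then p else q) @ u) (if v = n then p else q)" for u v
    using fadj_append[OF at, of v u "[]"] by (simp del: graph_of.simps)
  have c: "ts = [Var (cur x0 \<psi> p)]" "us = [Var (cur x0 \<psi> q)]"
    using modal_form_Atm[OF mf] p q by blast+
  show ?thesis
  proof (unfold_locales, goal_cases)
    case (10 u v)
    then show ?case using nofadj[of v u] by (simp split: if_splits)
  next
    case (11 k)
    then show ?case
      using p q by (intro exI[of _ n] exI[of _ "Suc n"] exI[of _ Q] exI[of _ ts] exI[of _ us]) auto
  next
    case (20 W E')
    then show ?case unfolding matched_def by blast
  qed (use P p q c at fv in \<open>auto simp: p4_free_def quantifies_def split: if_splits\<close>)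
qed

lemma net_Tru:
  assumes p: "sub \<psi> p = Some (Atm Tru)" and P: "(p, a) \<in> P"
  shows "net \<psi> x0 P Fb {n} (\<lambda>_ _. False) (\<lambda>_. p) (\<lambda>_. (p, a)) {} (\<lambda>_. Inl a) (\<lambda>_. {})"
proof -
  have fv: "p \<in> fverts \<psi>" using p fverts_iff by fastforce
  have nofadj: "\<not> fadj \<psi> (p @ u) p" for u
    using fadj_append[OF p, of u "[]"] by (simp del: graph_of.simps)
  show ?thesis
  proof unfold_locales
    show "\<not> matched (\<lambda>u v. {u, v} \<in> E') W" if "matched (\<lambda>_ _. False) W" for W and E' :: "nat set set"
      using that unfolding matched_def by blast
  qed (use P p fv nofadj in \<open>auto simp: p4_free_def quantifies_def\<close>)
qed

text \<open>The graph stays the same and only items merge. A position below the disjunction that is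
  adjacent to \<open>f v\<close> is on the side of \<open>f v\<close>, so the old skew condition
  covers it.\<close>

lemma net_Disj:
  assumes net: "net \<psi> x0 (insert (p @ [False], a) (insert (p @ [True], a) P)) Fb V E f it L den Bd"
    and p: "sub \<psi> p = Some (Disj \<chi> \<chi>')"
  shows "net \<psi> x0 (insert (p, a) P) Fb V E f
    (\<lambda>v. if it v = (p @ [False], a) \<or> it v = (p @ [True], a) then (p, a) else it v) L den Bd"
proof -
  interpret net \<psi> x0 "insert (p @ [False], a) (insert (p @ [True], a) P)" Fb V E f it L den Bd by fact
  define it' where "it' v = (if it v = (p @ [False], a) \<or> it v = (p @ [True], a) then (p, a) else it v)" for v
  have same: "it u = it v \<Longrightarrow> it' u = it' v" for u v unfolding it'_def by simp
  have skew': "\<exists>w. E w v \<and> \<not> fadj \<psi> (f w) (fst (it' v) @ u)"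
    if v: "v \<in> V" "fadj \<psi> (fst (it' v) @ u) (f v)" for u v
  proof (cases "\<exists>i. it v = (p @ [i], a)")
    case True
    then obtain i where i: "it v = (p @ [i], a)" by blast
    then have i': "it' v = (p, a)" unfolding it'_def by (cases i) auto
    obtain t where t: "f v = p @ i # t" using f_H[OF v(1)] i by auto
    have "fadj \<psi> (p @ u) (p @ i # t)" using v(2) i' t by simp
    then have "fadj (Disj \<chi> \<chi>') u (i # t)" unfolding fadj_append[OF p] .
    moreover have "u \<in> fverts (Disj \<chi> \<chi>')" using adj_verts(1)[OF graph_graph_of calculation] .
    then obtain j u' where "u = j # u'" unfolding fverts_simps by blast
    ultimately have "u = i # u'" by auto
    then show ?thesis using skew[OF v(1), of u'] v(2) i i' by simp
  next
    case False
    then have "it' v = it v" unfolding it'_def by auto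
    then show ?thesis using skew[OF v(1)] v(2) by simp
  qed
  have "net \<psi> x0 (insert (p, a) P) Fb V E f it' L den Bd"
  proof (unfold_locales, goal_cases)
    case (6 v)
    then show ?case using it_P[of v] unfolding it'_def by auto
  next
    case (7 v)
    then show ?case using f_H[of v] unfolding it'_def by auto
  next
    case (8 u v)
    then show ?case using E_it same by blast
  next
    case (10 u v)
    then show ?case using skew' by blast
  next
    case (14 b \<chi>'' x \<xi>)
    then show ?case using body[of b \<chi>'' x \<xi>] same by blast
  next
    case (15 v Q z)
    have "cur x0 \<psi> (fst (it v)) = cur x0 \<psi> (fst (it' v)) \<and> snd (it v) = snd (it' v)"
      unfolding it'_def using cur_append[OF p, of x0 "[False]"] cur_append[OF p, of x0 "[True]"] by auto
    then show ?case using binding[OF 15] by simp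
  next
    case (17 b x \<xi>)
    then show ?case using univ_isolated[of b x \<xi>] p unfolding it'_def by auto
  qed (fact fin ne E_sym E_V p4 hom link link_disj cover univ_sep univ_Fb den_V nobim)+
  then show ?thesis unfolding it'_def .
qed

text \<open>The new vertex \<open>c\<close> has as its body the part \<open>B\<close> over the body
  item, and is joined to it if existential. A universal \<open>c\<close> resolves the name
  \<open>x\<close>: every vertex denoting \<open>x\<close>, in \<open>B\<close> or not, now refers
  to \<open>c\<close>. As no item of \<open>P\<close> carries this name, literals outside
  \<open>B\<close> that still wait for their binder are not affected.\<close>

lemma net_quantifier:
  assumes net: "net \<psi> x0 (insert (p @ [True], b) P) (if ex then Fb else insert p Fb) V E f it L den Bd"
    and p: "sub \<psi> p = Some \<chi>" "quantifies \<chi> x \<xi>" and ex: "ex \<longleftrightarrow> \<chi> = Ex x \<xi>"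
    and A: "v0 \<in> V" "it v0 = (p @ [True], b)" and new: "(p @ [True], b) \<notin> P"
    and all: "\<not> ex \<Longrightarrow> b = x \<and> p \<notin> Fb \<and> (\<forall>j\<in>P. snd j \<noteq> x)"
    and c: "c \<notin> V"
  shows "net \<psi> x0 (insert (p, a) P) Fb (insert c V)
    (\<lambda>u v. E u v \<or> ex \<and> (u = c \<and> v \<in> V \<and> it v = (p @ [True], b) \<or> v = c \<and> u \<in> V \<and> it u = (p @ [True], b)))
    (f(c := p)) (\<lambda>v. if v = c \<or> it v = (p @ [True], b) then (p, a) else it v) L
    (\<lambda>v. if v = c then Inl b else if \<not> ex \<and> den v = Inl x then Inr c else den v)
    (Bd(c := {v \<in> V. it v = (p @ [True], b)}))"
proof -
  interpret net \<psi> x0 "insert (p @ [True], b) P" "if ex then Fb else insert p Fb" V E f it L den Bd by fact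
  define B where "B = {v \<in> V. it v = (p @ [True], b)}"
  define E' where "E' u v \<longleftrightarrow> E u v \<or> ex \<and> (u = c \<and> v \<in> V \<and> it v = (p @ [True], b) \<or> v = c \<and> u \<in> V \<and> it u = (p @ [True], b))" for u v
  define it' where "it' v = (if v = c \<or> it v = (p @ [True], b) then (p, a) else it v)" for v
  define f' where "f' = f(c := p)"
  define den' where "den' v = (if v = c then Inl b else if \<not> ex \<and> den v = Inl x then Inr c else den v)" for v
  define Bd' where "Bd' = Bd(c := B)"
  have f'V: "f' v = f v" if "v \<in> V" for v using that c unfolding f'_def by auto
  have f'c: "f' c = p" unfolding f'_def by simp
  have Bd'V: "Bd' v = Bd v" if "v \<in> V" for v using that c unfolding Bd'_def by auto
  have Bd'c: "Bd' c = B" unfolding Bd'_def by simp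
  have E'V: "E' u v \<longleftrightarrow> E u v" if "u \<in> V" "v \<in> V" for u v using that c unfolding E'_def by auto
  have E'c: "E' c v \<longleftrightarrow> ex \<and> v \<in> B" "E' v c \<longleftrightarrow> ex \<and> v \<in> B" for v
    using E_V[of c v] E_V[of v c] c unfolding E'_def B_def by blast+
  have E'sym: "E' u v \<longleftrightarrow> E' v u" for u v using E_sym unfolding E'_def by blast
  have it'_B: "it' v = (p, a)" if "v \<in> B" for v using that unfolding B_def it'_def by auto
  have it'_V: "it' v = it v" if "v \<in> V" "v \<notin> B" for v using that c unfolding B_def it'_def by auto
  have it'_c: "it' c = (p, a)" unfolding it'_def by auto
  have same: "it' u = it' v" if "u \<in> V" "v \<in> V" "it u = it v" for u v
    using that unfolding it'_def using c by auto
  have pf: "p \<in> fverts \<psi>" using p fverts_iff vlab_Binder by metis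
  have sub1: "sub \<psi> (p @ [True]) = Some \<xi>" using p unfolding quantifies_def sub_append by auto
  have cur1: "cur x0 \<psi> (p @ [True]) = x" using cur_append[OF p(1), of x0 "[True]"] p(2) unfolding quantifies_def by auto
  have fadjp: "fadj \<psi> (p @ u) (p @ True # t) \<longleftrightarrow> fadj \<chi> u (True # t)" for u t by (rule fadj_append[OF p(1)])
  have fB: "\<exists>t. f v = p @ True # t \<and> t \<in> fverts \<xi>" if v: "v \<in> B" for v
  proof -
    have "\<exists>t. f v = (p @ [True]) @ t" using v f_H[of v] unfolding B_def by auto
    then obtain t where t: "f v = (p @ [True]) @ t" by blast
    then have "t \<in> fverts \<xi>" using fverts_append[OF sub1, of t] f_H[of v] v unfolding B_def by auto
    then show ?thesis using t by auto
  qed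
  have litB: "\<exists>l\<in>B. \<exists>a. sub \<psi> (f l) = Some (Atm a)" using literal_in_item[OF A(1)] A(2) unfolding B_def by auto
  have EB: "E u v \<Longrightarrow> u \<in> B \<longleftrightarrow> v \<in> B" for u v using E_it[of u v] E_V[of u v] unfolding B_def by auto
  have "net \<psi> x0 (insert (p, a) P) Fb (insert c V) E' f' it' L den' Bd'"
  proof (unfold_locales, goal_cases)
    case 1 then show ?case using fin by simp
  next
    case 2 then show ?case by simp
  next
    case (3 u v) then show ?case using E'sym by blast
  next
    case (4 u v) then show ?case using E_V unfolding E'_def by blast
  next
    case 5
    show ?case
      unfolding p4_free_def
    proof (intro ballI impI)
      fix a1 a2 a3 a4 assume V: "a1 \<in> insert c V" "a2 \<in> insert c V" "a3 \<in> insert c V" "a4 \<in> insert c V"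
        and h: "distinct [a1, a2, a3, a4] \<and> E' a1 a2 \<and> E' a2 a3 \<and> E' a3 a4"
      \<comment> \<open>No edge leaves \<open>insert c B\<close>, so a path through \<open>c\<close>
        stays in this set. There \<open>c\<close> is adjacent to all other vertices, which gives a
        chord.\<close>
      have con: "u \<in> insert c B" if "E' u v" "v \<in> insert c B" for u v
        using that E'c EB[of u v] unfolding E'_def by blast
      show "E' a1 a3 \<or> E' a2 a4 \<or> E' a1 a4"
      proof (cases "c \<in> {a1, a2, a3, a4}")
        case False
        then have "a1 \<in> V" "a2 \<in> V" "a3 \<in> V" "a4 \<in> V" using V by auto
        then show ?thesis using p4 h E'V unfolding p4_free_def by simp
      next
        case True
        have "a1 \<in> insert c B \<and> a2 \<in> insert c B \<and> a3 \<in> insert c B \<and> a4 \<in> insert c B"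
          using True h con E'sym by (metis insertE insertI1 singletonD)
        moreover have ex using True h E'c by auto
        ultimately show ?thesis using True h E'c by auto
      qed
    qed
  next
    case (6 v) then show ?case using it_P[of v] unfolding it'_def by auto
  next
    case (7 v)
    then show ?case using f_H[of v] pf c unfolding it'_def f'_def by auto
  next
    case (8 u v)
    show ?case
    proof (cases "E u v")
      case True
      then show ?thesis using same E_V[OF True] E_it[OF True] by blast
    next
      case False
      then have "u = c \<and> v \<in> B \<or> v = c \<and> u \<in> B" using 8 unfolding E'_def B_def by blast
      then show ?thesis using it'_c it'_B by auto
    qed
  next
    case (9 u v)
    have one: "fadj \<psi> p (f v)" if "ex" "v \<in> B" for v
    proof -
      obtain t where t: "f v = p @ True # t" "t \<in> fverts \<xi>" using fB[OF \<open>v \<in> B\<close>] by blast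
      then show ?thesis using fadjp[of "[]" t] that(1) ex by simp
    qed
    show ?case
    proof (cases "u = c \<or> v = c")
      case True
      then show ?thesis using 9 E'c one f'c f'V c adj_commute[of p "f u" "graph_of \<psi>"] unfolding B_def by auto
    next
      case False
      then show ?thesis using 9 hom[of u v] unfolding E'_def f'_def by auto
    qed
  next
    case (10 u v)
    show ?case
    proof (cases "v = c")
      case True
      have a1: "fadj \<psi> (p @ u) (p @ [])" using 10 True it'_c f'c by simp
      then have a2: "fadj \<chi> u []" unfolding fadj_append[OF p(1)] .
      then obtain u' where u': "ex" "u = True # u'"
        using p(2) ex fadj_irrefl[of "[]" \<chi>] unfolding quantifies_def by (cases u) auto
      have "fst (it v0) @ u' \<in> fverts \<psi>"
        using adj_verts(1)[OF graph_graph_of a1] u' A(2) by simp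
      \<comment> \<open>Since \<open>c\<close> is joined to all of \<open>B\<close>, it is enough to
        find some vertex over the body item whose image is not adjacent to the position.\<close>
      then obtain w where w: "w \<in> V" "it w = it v0" "\<not> fadj \<psi> (f w) (fst (it v0) @ u')"
        using onto[OF A(1)] by blast
      then show ?thesis using True u' A(2) E'c it'_c f'V unfolding B_def by (intro exI[of _ w]) auto
    next
      case False
      then have v: "v \<in> V" using 10 by blast
      show ?thesis
      proof (cases "v \<in> B")
        case True
        obtain t where t: "f v = p @ True # t" "t \<in> fverts \<xi>" using fB[OF True] by blast
        have a1: "fadj \<psi> (p @ u) (p @ True # t)" using 10(2) it'_B[OF True] f'V[OF v] t by simp
        then have a2: "fadj \<chi> u (True # t)" unfolding fadjp .
        show ?thesis
        proof (cases u)
          case Nil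
          then have ex using a2 p(2) ex unfolding quantifies_def by auto
          then have "E' c v" using E'c True by blast
          moreover have "\<not> fadj \<psi> (f' c) (fst (it' v) @ u)" using Nil it'_B[OF True] f'c fadj_irrefl by simp
          ultimately show ?thesis by blast
        next
          case (Cons j u')
          then have "u = True # u'" using a2 p(2) unfolding quantifies_def by auto
          then have eq: "fst (it' v) @ u = fst (it v) @ u'" using True it'_B[OF True] unfolding B_def by simp
          obtain w where "E w v" "\<not> fadj \<psi> (f w) (fst (it' v) @ u)"
            using skew[OF v, of u'] 10(2) f'V[OF v] unfolding eq by auto
          then show ?thesis using E_V[of w v] f'V[of w] unfolding E'_def by auto
        qed
      next
        case False
        then obtain w where "E w v" "\<not> fadj \<psi> (f w) (fst (it' v) @ u)"
          using skew[OF v, of u] 10(2) f'V[OF v] it'_V[OF v] by auto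
        then show ?thesis using E_V[of w v] f'V[of w] unfolding E'_def by auto
      qed
    qed
  next
    case (11 k)
    then obtain v w Q ts us where vw: "k = {v, w} \<and> v \<noteq> w \<and> v \<in> V \<and> w \<in> V \<and> \<not> E v w \<and>
      sub \<psi> (f v) = Some (Atm (Pred Q ts)) \<and> sub \<psi> (f w) = Some (Atm (Pred (dual_psym Q) us)) \<and> den v = den w"
      using link[OF 11] by (elim exE)
    then have V: "v \<in> V" "w \<in> V" by blast+
    then have vc: "v \<noteq> c" "w \<noteq> c" using c by auto
    have "den' v = den' w" using vw vc unfolding den'_def by simp
    then have "k = {v, w} \<and> v \<noteq> w \<and> v \<in> insert c V \<and> w \<in> insert c V \<and> \<not> E' v w \<and>
      sub \<psi> (f' v) = Some (Atm (Pred Q ts)) \<and> sub \<psi> (f' w) = Some (Atm (Pred (dual_psym Q) us)) \<and> den' v = den' w"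
      using vw f'V[OF V(1)] f'V[OF V(2)] E'V[OF V] by simp
    then show ?case by (intro exI)
  next
    case (12 k k') then show ?case using link_disj by blast
  next
    case (13 v a)
    have "v \<noteq> c" using 13(2) p f'c unfolding quantifies_def by auto
    then show ?case using 13 cover[of v a] f'V by auto
  next
    case (14 b' \<chi>' x' \<xi>')
    show ?case
    proof (cases "b' = c")
      case True
      then have "\<chi>' = \<chi>" using 14(2) p(1) f'c by auto
      then have e: "\<chi>' = Ex x' \<xi>' \<longleftrightarrow> ex" using 14(3) p(2) ex unfolding quantifies_def by auto
      have "E' w u \<longleftrightarrow> E' w c" if "w \<in> insert c V" "w \<notin> B" "w \<noteq> c" "u \<in> B" for w u
      proof -
        have "w \<in> V" "u \<in> V" using that unfolding B_def by auto
        then have "\<not> E' w u" using E'V[of w u] EB[of w u] that by blast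
        moreover have "\<not> E' w c" using E'c(2)[of w] that by blast
        ultimately show ?thesis by blast
      qed
      moreover have "\<exists>l\<in>B. \<exists>a. sub \<psi> (f' l) = Some (Atm a)" using litB f'V unfolding B_def by auto
      moreover have "c \<notin> B" using c unfolding B_def by blast
      moreover have "B \<subseteq> insert c V" unfolding B_def by blast
      ultimately show ?thesis unfolding True Bd'c using e E'c it'_B it'_c by auto
    next
      case False
      then have b': "b' \<in> V" using 14 by blast
      note bd = body[OF b' 14(2)[unfolded f'V[OF b']] 14(3)]
      have BV: "u \<in> V" "it u = it b'" if "u \<in> Bd b'" for u using bd that by blast+
      from bd obtain l a where "l \<in> Bd b'" "sub \<psi> (f l) = Some (Atm a)" by blast
      then have "\<exists>l\<in>Bd b'. \<exists>a. sub \<psi> (f' l) = Some (Atm a)" using f'V[OF BV(1)] by auto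
      moreover have "it' u = it' b' \<and> (E' b' u \<longleftrightarrow> \<chi>' = Ex x' \<xi>')" if "u \<in> Bd b'" for u
        using BV[OF that] same[OF _ b'] bd that E'V[OF b'] by blast
      moreover have "E' w u \<longleftrightarrow> E' w b'" if w: "w \<in> insert c V" "w \<notin> Bd b'" "w \<noteq> b'" "u \<in> Bd b'" for w u
      proof (cases "w = c")
        case True
        then show ?thesis using E'c BV[OF w(4)] b' unfolding B_def by auto
      next
        case False
        then show ?thesis using w bd E'V b' BV[OF w(4)] by blast
      qed
      ultimately show ?thesis unfolding Bd'V[OF b'] using bd by blast
    qed
  next
    case (15 v Q z)
    have vc: "v \<noteq> c" using 15(2) p f'c unfolding quantifies_def by auto
    then have v: "v \<in> V" using 15 by blast
    from binding[OF v 15(2)[unfolded f'V[OF v]]] show ?case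
    proof (elim disjE bexE exE conjE)
      fix b' \<chi>' \<xi>' assume b': "b' \<in> V" "sub \<psi> (f b') = Some \<chi>'" "quantifies \<chi>' z \<xi>'" "v \<in> Bd b'"
        "den v = (if \<chi>' = Ex z \<xi>' then den b' else Inr b')"
      have "b' \<noteq> c" using b' c by blast
      then have "den' v = (if \<chi>' = Ex z \<xi>' then den' b' else Inr b')" using b'(5) vc unfolding den'_def by auto
      then show ?thesis using b' f'V Bd'V by (intro disjI1 bexI[of _ b'] exI[of _ \<chi>'] exI[of _ \<xi>']) auto
    next
      assume z: "z = cur x0 \<psi> (fst (it v))" "den v = Inl (snd (it v))"
      show ?thesis
      proof (cases "v \<in> B")
        case True
        then have i: "it v = (p @ [True], b)" unfolding B_def by simp
        then have zx: "z = x" using z cur1 by simp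
        have "den' v = (if \<chi> = Ex z \<xi> then den' c else Inr c)"
          using z(2) i vc all ex zx unfolding den'_def by auto
        then show ?thesis using p f'c Bd'c True zx by (intro disjI1 bexI[of _ c] exI[of _ \<chi>] exI[of _ \<xi>]) auto
      next
        case False
        then have i: "it' v = it v" using it'_V v by blast
        have "it v \<in> P" using it_P[OF v] False v unfolding B_def by auto
        then have "den' v = den v" using all vc z(2) unfolding den'_def by auto
        then show ?thesis using z i by simp
      qed
    qed
  next
    case (16 b1 c1 x1 \<xi>1)
    \<comment> \<open>This is the purpose of \<open>Fb\<close>: the given net has no universal
      binder over \<open>p\<close>, so a universal \<open>c\<close> has no other copy to be told
      apart from.\<close>
    have not_c: False if "b2 \<in> V" "f b2 = p" "sub \<psi> p = Some (All x1 \<xi>1)" for b2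
      using univ_Fb[OF that(1)] that(2,3) p ex unfolding quantifies_def by auto
    have "b1 \<noteq> c" "c1 \<noteq> c" using 16 f'c f'V not_c by (metis insertE)+
    then have bc: "b1 \<in> V" "c1 \<in> V" using 16 by auto
    then obtain u where u: "E u b1" "\<not> E u c1" using univ_sep[of b1 c1 x1 \<xi>1] 16 f'V by auto
    then have "E' u b1" "\<not> E' u c1" using E'V[of u] E_V[OF u(1)] bc by auto
    then show ?case by blast
  next
    case (17 b1 x1 \<xi>1)
    show ?case
    proof (cases "b1 \<in> insert c B")
      case True
      have "\<not> ex"
      proof
        assume "ex"
        obtain l where "l \<in> B" using litB by blast
        then show False using 17(3)[of l] 17(3)[of c] E'c True \<open>ex\<close> by blast
      qed
      then have "\<exists>x \<xi>. sub \<psi> p = Some (All x \<xi>)" using p ex unfolding quantifies_def by auto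
      then show ?thesis using True it'_B it'_c by auto
    next
      case False
      then have b1: "b1 \<in> V" using 17 by auto
      then have "\<not> E u b1" for u using 17(3)[of u] unfolding E'_def by blast
      then show ?thesis using univ_isolated[OF b1] 17(2) f'V[OF b1] it'_V[OF b1] False by auto
    qed
  next
    case (18 b1 x1 \<xi>1)
    show ?case
    proof (cases "b1 = c")
      case True
      then have "\<not> ex" using 18(2) f'c p ex unfolding quantifies_def by auto
      then show ?thesis using all True f'c by simp
    next
      case False
      then have b1: "b1 \<in> V" using 18 by blast
      then have "f b1 \<notin> (if ex then Fb else insert p Fb)" using univ_Fb[OF b1] 18(2) f'V by simp
      then show ?thesis using f'V[OF b1] by (auto split: if_splits)
    qed
  next
    case (19 b1 c1)
    then show ?case using den_V[of b1 c1] c unfolding den'_def by (auto split: if_splits)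
  next
    case (20 W E'')
    show ?case
    proof
      assume m: "matched (\<lambda>u v. {u, v} \<in> E'') W"
      have LV: "k \<subseteq> V" if "k \<in> L" for k using link[OF that] by blast
      \<comment> \<open>A universal \<open>c\<close> has no edges. An existential \<open>c\<close>
        has no leaps: it denotes the name \<open>b\<close> and not a vertex, and no older vertex
        refers to it.\<close>
      have cW: "c \<notin> W"
      proof
        assume cW: "c \<in> W"
        then obtain w where w: "w \<in> W" "E' c w" using matchedD[OF 20(3)] by blast
        then have ex using E'c by blast
        obtain w' where "{c, w'} \<in> E''" using matchedD[OF m cW] by blast
        then consider "{c, w'} \<in> L" | b1 c1 where "{c, w'} = {b1, c1}" "b1 \<in> insert c V" "den' b1 = Inr c1"
          using 20(2) by blast
        then show False
        proof cases
          case 1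
          then show False using LV c by blast
        next
          case 2
          then have "b1 \<noteq> c" unfolding den'_def by auto
          then have "den b1 = Inr c1" "b1 \<in> V" using 2(2,3) \<open>ex\<close> unfolding den'_def by auto
          then have "c1 \<in> V" "b1 \<in> V" using den_V[of b1 c1] by blast+
          then have "c \<noteq> b1" "c \<noteq> c1" using c by auto
          then show False using 2(1) by (metis insertI1 insertE singletonD)
        qed
      qed
      then have WV: "W \<subseteq> V" using 20(1) by blast
      have "matched E W \<longleftrightarrow> matched E' W"
      proof (rule matched_cong)
        fix u v assume "u \<in> W" "v \<in> W"
        then show "E u v \<longleftrightarrow> E' u v" using WV E'V[of u v] by blast
      qed
      then have mE: "matched E W" using 20(3) by blast
      \<comment> \<open>The only new leaps end in \<open>c\<close>, which is not in
        \<open>W\<close>, so those inside \<open>W\<close> were leaps before.\<close>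
      have "{k \<in> E''. k \<subseteq> W} \<subseteq> L \<union> {{b, c} |b c. b \<in> V \<and> den b = Inr c}"
      proof
        fix k assume k: "k \<in> {k \<in> E''. k \<subseteq> W}"
        then consider "k \<in> L" | b1 c1 where "k = {b1, c1}" "den' b1 = Inr c1" using 20(2) by blast
        then show "k \<in> L \<union> {{b, c} |b c. b \<in> V \<and> den b = Inr c}"
        proof cases
          case 2
          then have "b1 \<in> V" "c1 \<in> V" "b1 \<noteq> c" "c1 \<noteq> c" using k WV c by auto
          then have "den b1 = Inr c1" using 2 unfolding den'_def by (auto split: if_splits)
          then show ?thesis using 2 \<open>b1 \<in> V\<close> by blast
        qed blast
      qed
      from nobim[OF WV this mE] have "\<not> matched (\<lambda>u v. {u, v} \<in> {k \<in> E''. k \<subseteq> W}) W" .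
      moreover have "matched (\<lambda>u v. {u, v} \<in> {k \<in> E''. k \<subseteq> W}) W \<longleftrightarrow> matched (\<lambda>u v. {u, v} \<in> E'') W"
        by (intro matched_cong) auto
      ultimately show False using m by blast
    qed
  qed
  then show ?thesis unfolding E'_def[abs_def] f'_def it'_def[abs_def] den'_def[abs_def] Bd'_def B_def .
qed

text \<open>Allows two nets on disjoint vertex sets to share the functions \<open>f\<close>,
  \<open>it\<close>, \<open>den\<close> and \<open>Bd\<close>, as \<open>net_Conj\<close>
  requires.\<close>

lemma net_cong:
  assumes "net \<psi> x0 P Fb V E f it L den Bd"
    and eq: "\<And>v. v \<in> V \<Longrightarrow> f' v = f v" "\<And>v. v \<in> V \<Longrightarrow> it' v = it v"
      "\<And>v. v \<in> V \<Longrightarrow> den' v = den v" "\<And>v. v \<in> V \<Longrightarrow> Bd' v = Bd v"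
  shows "net \<psi> x0 P Fb V E f' it' L den' Bd'"
proof -
  interpret net \<psi> x0 P Fb V E f it L den Bd by fact
  show ?thesis
  proof (unfold_locales, goal_cases)
    case (6 v) then show ?case using it_P eq by simp
  next
    case (7 v) then show ?case using f_H eq by simp
  next
    case (8 u v) then show ?case using E_it[of u v] E_V[of u v] eq by simp
  next
    case (9 u v) then show ?case using hom[of u v] E_V[of u v] eq by simp
  next
    case (10 u v)
    then obtain w where "E w v" "\<not> fadj \<psi> (f w) (fst (it v) @ u)" using skew[of v u] eq by auto
    then show ?case using E_V[of w v] eq 10 by auto
  next
    case (11 k)
    then obtain v w Q ts us where "k = {v, w} \<and> v \<noteq> w \<and> v \<in> V \<and> w \<in> V \<and> \<not> E v w \<and>
      sub \<psi> (f v) = Some (Atm (Pred Q ts)) \<and> sub \<psi> (f w) = Some (Atm (Pred (dual_psym Q) us)) \<and> den v = den w"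
      using link[OF 11] by (elim exE) (rule that)
    then have "k = {v, w} \<and> v \<noteq> w \<and> v \<in> V \<and> w \<in> V \<and> \<not> E v w \<and>
      sub \<psi> (f' v) = Some (Atm (Pred Q ts)) \<and> sub \<psi> (f' w) = Some (Atm (Pred (dual_psym Q) us)) \<and> den' v = den' w"
      using eq(1)[of v] eq(1)[of w] eq(3)[of v] eq(3)[of w] by simp
    then show ?case by (intro exI)
  next
    case (13 v a) then show ?case using cover eq by simp
  next
    case (14 b \<chi> x \<xi>)
    note bd = body[OF 14(1) 14(2)[unfolded eq(1)[OF 14(1)]] 14(3)]
    then have "u \<in> V" if "u \<in> Bd b" for u using that by blast
    then show ?case using bd eq 14(1) by auto
  next
    case (15 v Q z)
    from binding[OF 15(1) 15(2)[unfolded eq(1)[OF 15(1)]]] show ?case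
    proof (elim disjE bexE exE conjE)
      fix b \<chi> \<xi> assume b: "b \<in> V" "sub \<psi> (f b) = Some \<chi>" "quantifies \<chi> z \<xi>" "v \<in> Bd b"
        "den v = (if \<chi> = Ex z \<xi> then den b else Inr b)"
      then have "sub \<psi> (f' b) = Some \<chi> \<and> quantifies \<chi> z \<xi> \<and> v \<in> Bd' b \<and>
        den' v = (if \<chi> = Ex z \<xi> then den' b else Inr b)"
        using eq(1,3,4)[OF b(1)] eq(3)[OF 15(1)] by simp
      then show ?thesis using b(1) by blast
    qed (use eq 15(1) in auto)
  next
    case (16 b c x \<xi>) then show ?case using univ_sep eq by simp
  next
    case (17 b x \<xi>) then show ?case using univ_isolated eq by simp
  next
    case (18 b x \<xi>) then show ?case using univ_Fb eq by simp
  next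
    case (19 b c) then show ?case using den_V[of b c] eq(3)[of b] by simp
  next
    case (20 W E')
    have e: "b \<in> V \<and> den' b = Inr c \<longleftrightarrow> b \<in> V \<and> den b = Inr c" for b c using eq(3) by auto
    have "{{b, c} |b c. b \<in> V \<and> den' b = Inr c} = {{b, c} |b c. b \<in> V \<and> den b = Inr c}"
      by (simp only: e)
    then show ?case using nobim 20 by simp
  qed (fact fin ne E_sym E_V p4 link_disj)+
qed

text \<open>Removing a vertex together with its partner leaves a matched set.\<close>

lemma even_card_matched:
  assumes "finite W" "\<And>u v. u \<in> W \<Longrightarrow> v \<in> W \<Longrightarrow> R u v \<Longrightarrow> R v u" "\<And>v. v \<in> W \<Longrightarrow> \<not> R v v"
    "\<And>v. v \<in> W \<Longrightarrow> \<exists>!w. w \<in> W \<and> R v w"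
  shows "even (card W)"
  using assms
proof (induction "card W" arbitrary: W rule: less_induct)
  case less
  show ?case
  proof (cases "W = {}")
    case False
    then obtain v where v: "v \<in> W" by blast
    then obtain w where w: "w \<in> W" "R v w" "\<And>u. u \<in> W \<Longrightarrow> R v u \<Longrightarrow> u = w" using less.prems(4) by blast
    have vw: "v \<noteq> w" using w(2) less.prems(3)[OF v] by metis
    have w': "u = v" if "u \<in> W" "R w u" for u
      using less.prems(4)[OF w(1)] less.prems(2)[OF v w(1,2)] v that by blast
    let ?W = "W - {v, w}"
    have card: "card W = card ?W + 2"
      using card_Diff_subset[of "{v, w}" W] card_mono[OF less.prems(1), of "{v, w}"] v w(1) vw by simp
    have h5: "\<exists>!t. t \<in> ?W \<and> R u t" if u: "u \<in> ?W" for u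
    proof -
      obtain t where t: "t \<in> W" "R u t" "\<And>s. s \<in> W \<Longrightarrow> R u s \<Longrightarrow> s = t" using less.prems(4)[of u] u by blast
      have uW: "u \<in> W" "u \<noteq> v" "u \<noteq> w" using u by auto
      have tu: "R t u" using less.prems(2)[OF uW(1) t(1,2)] .
      have "t \<noteq> v" using w(3)[OF uW(1)] tu uW(3) by metis
      moreover have "t \<noteq> w" using w'[OF uW(1)] tu uW(2) by metis
      ultimately have "t \<in> ?W \<and> R u t" using t(1,2) by blast
      then show ?thesis
      proof (rule ex1I)
        show "s = t" if "s \<in> ?W \<and> R u s" for s using t(3)[of s] that by blast
      qed
    qed
    have h1: "card ?W < card W" using card by simp
    have h2: "finite ?W" using less.prems(1) by blast
    have h3: "R t u" if "u \<in> ?W" "t \<in> ?W" "R u t" for u t using less.prems(2)[of u t] that by blast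
    have h4: "\<not> R u u" if "u \<in> ?W" for u using less.prems(3)[of u] that by blast
    have "even (card ?W)" by (rule less.hyps[OF h1 h2 h3 h4 h5])
    then show ?thesis using card by simp
  qed simp
qed

text \<open>Only the parts \<open>A i\<close> over the two conjuncts are joined. Leaps never cross
  between the two nets, so a bimatching \<open>W\<close> meets each net in an even number of
  vertices. If \<open>W\<close> meets both joined parts, it has exactly one crossing edge, from
  \<open>u\<close> to \<open>v\<close> say. The vertices of \<open>W\<close> in the net of
  \<open>u\<close>, except \<open>u\<close>, are then matched by edges among themselves, so together
  with \<open>u\<close> they are odd in number. If \<open>W\<close> misses one of the joined parts,
  no edge in \<open>W\<close> crosses, and one of the nets has a bimatching of its own.\<close>

lemma net_Conj:
  fixes V :: "bool \<Rightarrow> nat set"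
  assumes net: "\<And>i. net \<psi> x0 (insert (p @ [i], a) P) Fb (V i) (E i) f it (L i) den Bd"
    and p: "sub \<psi> p = Some (Conj \<chi>1 \<chi>2)"
    and w0: "\<And>i. w0 i \<in> V i \<and> it (w0 i) = (p @ [i], a)"
    and new: "\<And>i. (p @ [i], a) \<notin> P"
    and pending: "\<And>j x \<xi> \<xi>'. j \<in> P \<Longrightarrow> sub \<psi> (fst j) \<noteq> Some (All x \<xi>) \<and> sub \<psi> (fst j) \<noteq> Some (Disj \<xi> \<xi>')"
    and disj: "V False \<inter> V True = {}"
  defines "A \<equiv> \<lambda>i. {v \<in> V i. it v = (p @ [i], a)}"
  shows "net \<psi> x0 (insert (p, a) P) Fb (\<Union>i. V i)
    (\<lambda>u v. (\<exists>i. E i u v) \<or> (\<exists>i. u \<in> A i \<and> v \<in> A (\<not> i))) f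
    (\<lambda>v. if \<exists>i. it v = (p @ [i], a) then (p, a) else it v) (\<Union>i. L i) den Bd"
proof -
  define E' where "E' u v \<longleftrightarrow> (\<exists>i. E i u v) \<or> (\<exists>i. u \<in> A i \<and> v \<in> A (\<not> i))" for u v
  define it' where "it' v = (if \<exists>i. it v = (p @ [i], a) then (p, a) else it v)" for v
  note N = net[THEN net.fin] net[THEN net.ne]
  note E_V = net[THEN net.E_V] and E_sym = net[THEN net.E_sym] and E_it = net[THEN net.E_it]
  note it_P = net[THEN net.it_P] and f_H = net[THEN net.f_H]
  have side: "i = j" if "v \<in> V i" "v \<in> V j" for v i j using that disj by (cases i; cases j) auto
  have AV: "A i \<subseteq> V i" for i unfolding A_def by blast
  have A_iff: "v \<in> A i \<longleftrightarrow> (\<exists>j. it v = (p @ [j], a))" if "v \<in> V i" for v i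
    using it_P[OF that] new that unfolding A_def by auto
  have it'_A: "it' v = (p, a)" if "v \<in> A i" for v i using that unfolding A_def it'_def by auto
  have it'_V: "it' v = it v" if "v \<in> V i" "v \<notin> A i" for v i using that A_iff unfolding it'_def by auto
  have it_PV: "it v \<in> P" if "v \<in> V i" "v \<notin> A i" for v i using it_P[OF that(1)] that unfolding A_def by auto
  have same: "it' u = it' v" if "it u = it v" for u v using that unfolding it'_def by simp
  have E'V: "E' u v \<longleftrightarrow> E i u v" if "u \<in> V i" "v \<in> V i" for u v i
  proof
    assume "E' u v"
    then show "E i u v"
      unfolding E'_def
    proof (elim disjE exE conjE)
      fix j assume "E j u v"
      moreover then have "j = i" using E_V side that by blast
      ultimately show ?thesis by simp
    next
      fix j assume "u \<in> A j" "v \<in> A (\<not> j)"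
      then have "j = i" "(\<not> j) = i" using AV side that by blast+
      then show ?thesis by simp
    qed
  qed (auto simp: E'_def)
  have E'X: "E' u v \<longleftrightarrow> u \<in> A i \<and> v \<in> A j" if "u \<in> V i" "v \<in> V j" "i \<noteq> j" for u v i j
  proof
    assume "E' u v"
    then show "u \<in> A i \<and> v \<in> A j"
      unfolding E'_def
    proof (elim disjE exE conjE)
      fix k assume "E k u v"
      then have "k = i" "k = j" using E_V side that by blast+
      then show ?thesis using that by simp
    next
      fix k assume k: "u \<in> A k" "v \<in> A (\<not> k)"
      then have "k = i" "(\<not> k) = j" using AV side that by blast+
      then show ?thesis using k by simp
    qed
  next
    assume "u \<in> A i \<and> v \<in> A j"
    moreover have "j = (\<not> i)" using that(3) by auto
    ultimately show "E' u v" unfolding E'_def by blast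
  qed
  have E'_sym: "E' v u" if uv: "E' u v" for u v
  proof (cases "\<exists>i. E i u v")
    case False
    then obtain i where "u \<in> A i" "v \<in> A (\<not> i)" using uv unfolding E'_def by blast
    then show ?thesis unfolding E'_def by (intro disjI2 exI[of _ "\<not> i"]) simp
  qed (use E_sym in \<open>auto simp: E'_def\<close>)
  have E'_V: "(\<exists>i. u \<in> V i) \<and> (\<exists>i. v \<in> V i)" if "E' u v" for u v
    using that E_V AV unfolding E'_def by blast
  have conA: "(\<exists>i. u \<in> A i) \<longleftrightarrow> (\<exists>i. v \<in> A i)" if "E' u v" for u v
  proof -
    have "u \<in> A i \<longleftrightarrow> v \<in> A i" if "E i u v" for i using E_V[OF that] E_it[OF that] unfolding A_def by auto
    moreover have "i = j" if "E i u v" "u \<in> A j \<or> v \<in> A j" for i j using E_V[OF that(1)] that(2) AV side by blast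
    ultimately show ?thesis using that unfolding E'_def by blast
  qed
  have fA: "\<exists>t. f v = p @ i # t" if "v \<in> A i" for v i
    using f_H[of v i] that unfolding A_def by auto
  have "net \<psi> x0 (insert (p, a) P) Fb (\<Union>i. V i) E' f it' (\<Union>i. L i) den Bd"
  proof (unfold_locales, goal_cases)
    case 1 then show ?case using N(1) by simp
  next
    case 2 then show ?case using N(2) by auto
  next
    case (3 u v) then show ?case using E'_sym by blast
  next
    case (4 u v) then show ?case using E'_V by blast
  next
    case 5
    show ?case
      unfolding p4_free_def
    proof (intro ballI impI, rule ccontr)
      fix a1 a2 a3 a4 assume V: "a1 \<in> (\<Union>i. V i)" "a2 \<in> (\<Union>i. V i)" "a3 \<in> (\<Union>i. V i)" "a4 \<in> (\<Union>i. V i)"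
        and h: "distinct [a1, a2, a3, a4] \<and> E' a1 a2 \<and> E' a2 a3 \<and> E' a3 a4"
        and n: "\<not> (E' a1 a3 \<or> E' a2 a4 \<or> E' a1 a4)"
      obtain i1 i2 i3 i4 where i: "a1 \<in> V i1" "a2 \<in> V i2" "a3 \<in> V i3" "a4 \<in> V i4" using V by blast
      show False
      proof (cases "i1 = i2 \<and> i2 = i3 \<and> i3 = i4")
        case True
        then show False using net[THEN net.p4, of i4] h n i E'V unfolding p4_free_def by auto
      next
        case False
        have "(\<exists>i. a1 \<in> A i) \<or> (\<exists>i. a2 \<in> A i) \<or> (\<exists>i. a3 \<in> A i)"
          using False h E'X[OF i(1,2)] E'X[OF i(2,3)] E'X[OF i(3,4)] by blast
        then have "\<exists>i. a1 \<in> A i" "\<exists>i. a2 \<in> A i" "\<exists>i. a3 \<in> A i" "\<exists>i. a4 \<in> A i"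
          using conA h by metis+
        then have "a1 \<in> A i1" "a2 \<in> A i2" "a3 \<in> A i3" "a4 \<in> A i4" using i AV side by blast+
        then have "i1 = i3" "i2 = i4" "i1 = i4"
          using n E'X[OF i(1,3)] E'X[OF i(2,4)] E'X[OF i(1,4)] by blast+
        then show False using False by simp
      qed
    qed
  next
    case (6 v)
    then obtain i where "v \<in> V i" by blast
    then show ?case using it_P[of v i] unfolding it'_def by auto
  next
    case (7 v)
    then obtain i where "v \<in> V i" by blast
    then show ?case using f_H[of v i] unfolding it'_def by auto
  next
    case (8 u v)
    show ?case
    proof (cases "\<exists>i. E i u v")
      case True
      then show ?thesis using E_it same by blast
    next
      case False
      then show ?thesis using 8 it'_A unfolding E'_def by metis
    qed
  next
    case (9 u v)
    show ?case
    proof (cases "\<exists>i. E i u v")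
      case True
      then show ?thesis using net[THEN net.hom] by blast
    next
      case False
      then obtain i where i: "u \<in> A i" "v \<in> A (\<not> i)" using 9 unfolding E'_def by blast
      then obtain t t' where t: "f u = p @ i # t" "f v = p @ (\<not> i) # t'" using fA by blast
      have "f u \<in> fverts \<psi>" "f v \<in> fverts \<psi>" using f_H AV i by blast+
      then have "i # t \<in> fverts (Conj \<chi>1 \<chi>2)" "(\<not> i) # t' \<in> fverts (Conj \<chi>1 \<chi>2)"
        using fverts_append[OF p] t by auto
      then have "fadj (Conj \<chi>1 \<chi>2) (i # t) ((\<not> i) # t')" by (cases i) auto
      then show ?thesis using fadj_append[OF p] t by simp
    qed
  next
    case (10 u v)
    then obtain i where v: "v \<in> V i" by blast
    show ?case
    proof (cases "v \<in> A i")
      case True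
      obtain t where t: "f v = p @ i # t" using fA[OF True] by blast
      have a1: "fadj \<psi> (p @ u) (p @ i # t)" using 10(2) it'_A[OF True] t by simp
      have "p @ u \<in> fverts \<psi>" using adj_verts(1)[OF graph_graph_of a1] .
      then have "u \<in> fverts (Conj \<chi>1 \<chi>2)" using fverts_append[OF p] by blast
      then obtain j u' where u: "u = j # u'" unfolding fverts_simps by blast
      show ?thesis
      proof (cases "j = i")
        case eq: True
        have "fst (it v) @ u' = p @ u" using True u eq unfolding A_def by auto
        then obtain w where w: "E i w v" "\<not> fadj \<psi> (f w) (p @ u)"
          using net[THEN net.skew, OF v, of u'] a1 t by auto
        then show ?thesis using it'_A[OF True] unfolding E'_def by auto
      next
        case False
        have e: "fst (it (w0 j)) @ u' = p @ u" using w0[of j] u by simp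
        then obtain w where w: "w \<in> V j" "it w = it (w0 j)" "\<not> fadj \<psi> (f w) (p @ u)"
          using net[THEN net.onto, of "w0 j" j u'] w0[of j] \<open>p @ u \<in> fverts \<psi>\<close> by auto
        then have "w \<in> A j" using w0[of j] unfolding A_def by simp
        then have "E' w v" using E'X[OF w(1) v False] True by blast
        then show ?thesis using w(3) it'_A[OF True] by auto
      qed
    next
      case False
      then obtain w where "E i w v" "\<not> fadj \<psi> (f w) (fst (it v) @ u)"
        using net[THEN net.skew, OF v, of u] 10(2) it'_V[OF v] by auto
      then show ?thesis using it'_V[OF v False] unfolding E'_def by auto
    qed
  next
    case (11 k)
    then obtain i where i: "k \<in> L i" by blast
    then obtain v w Q ts us where vw: "k = {v, w} \<and> v \<noteq> w \<and> v \<in> V i \<and> w \<in> V i \<and> \<not> E i v w \<and>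
      sub \<psi> (f v) = Some (Atm (Pred Q ts)) \<and> sub \<psi> (f w) = Some (Atm (Pred (dual_psym Q) us)) \<and> den v = den w"
      using net[THEN net.link, OF i] by (elim exE) (rule that)
    then have "\<not> E' v w" using E'V by blast
    then have "k = {v, w} \<and> v \<noteq> w \<and> v \<in> (\<Union>i. V i) \<and> w \<in> (\<Union>i. V i) \<and> \<not> E' v w \<and>
      sub \<psi> (f v) = Some (Atm (Pred Q ts)) \<and> sub \<psi> (f w) = Some (Atm (Pred (dual_psym Q) us)) \<and> den v = den w"
      using vw by blast
    then show ?case by (intro exI)
  next
    case (12 k k')
    then obtain i j where ij: "k \<in> L i" "k' \<in> L j" by blast
    have "k \<subseteq> V i" "k' \<subseteq> V j" using net[THEN net.link, OF ij(1)] net[THEN net.link, OF ij(2)] by blast+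
    then show ?case using net[THEN net.link_disj, of k i k'] ij 12(3) side by (cases "i = j") blast+
  next
    case (13 v c)
    then obtain i where "v \<in> V i" by blast
    then show ?case using net[THEN net.cover, of v i c] 13(2) by blast
  next
    case (14 b \<chi> x \<xi>)
    then obtain i where b: "b \<in> V i" by blast
    note bd = net[THEN net.body, OF b 14(2,3)]
    have BV: "u \<in> V i" "it u = it b" if "u \<in> Bd b" for u using bd that by auto
    have "it' u = it' b \<and> (E' b u \<longleftrightarrow> \<chi> = Ex x \<xi>)" if "u \<in> Bd b" for u
      using same[OF BV(2)[OF that]] bd that E'V[OF b BV(1)[OF that]] by blast
    moreover have "E' w u \<longleftrightarrow> E' w b" if w: "w \<in> V j" "w \<notin> Bd b" "w \<noteq> b" "u \<in> Bd b" for w u j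
    proof (cases "j = i")
      case True
      then have "w \<in> V i" using w(1) by simp
      moreover from this have "E i w u \<longleftrightarrow> E i w b" using bd w(2-4) by blast
      ultimately show ?thesis using E'V[OF _ BV(1)[OF w(4)], of w] E'V[OF _ b, of w] by simp
    next
      case False
      have "u \<in> A i \<longleftrightarrow> b \<in> A i" using BV[OF w(4)] b unfolding A_def by auto
      then show ?thesis using E'X[OF w(1) _ False] BV(1)[OF w(4)] b by blast
    qed
    moreover have "Bd b \<subseteq> (\<Union>i. V i)" using BV(1) by blast
    moreover have "b \<notin> Bd b" "\<exists>l\<in>Bd b. \<exists>a. sub \<psi> (f l) = Some (Atm a)" using bd by blast+
    ultimately show ?case by (intro conjI ballI impI) (auto 0 2)
  next
    case (15 v Q z)
    then obtain i where v: "v \<in> V i" by blast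
    have "cur x0 \<psi> (fst (it v)) = cur x0 \<psi> (fst (it' v)) \<and> snd (it v) = snd (it' v)"
      unfolding it'_def using cur_append[OF p, of x0 "[False]"] cur_append[OF p, of x0 "[True]"]
      by (auto; case_tac i; auto)
    then have c: "cur x0 \<psi> (fst (it v)) = cur x0 \<psi> (fst (it' v))" "snd (it v) = snd (it' v)" by auto
    from net[THEN net.binding, OF v 15(2)] show ?case
      unfolding c by (rule disj_forward) (blast, assumption)
  next
    case (16 b c x \<xi>)
    then obtain i j where b: "b \<in> V i" and c: "c \<in> V j" by blast
    show ?case
    proof (cases "i = j")
      case True
      then obtain u where u: "E i u b" "\<not> E i u c"
        using net[THEN net.univ_sep, OF b _ 16(3-5)] c by blast
      then show ?thesis using E'V E_V[OF u(1)] b c True by blast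
    next
      case False
      \<comment> \<open>Two universal binders over one position, in different nets. If
        \<open>b\<close> is in the joined part, a vertex over the other conjunct is adjacent to
        \<open>b\<close>, but not to \<open>c\<close>. If not, \<open>pending\<close> and
        \<open>univ_isolated\<close> give \<open>b\<close> a neighbour in its own net; it is outside
        the joined part and so not adjacent to \<open>c\<close>.\<close>
      show ?thesis
      proof (cases "b \<in> A i")
        case True
        have w: "w0 j \<in> V j" "w0 j \<in> A j" using w0[of j] unfolding A_def by auto
        have "E' (w0 j) b" using E'X[OF w(1) b] w True False by blast
        moreover have "\<not> E' (w0 j) c"
        proof
          assume "E' (w0 j) c"
          then have "E j (w0 j) c" using E'V[OF w(1) c] by blast
          then have "c \<in> A j" using E_it w0[of j] c unfolding A_def by fastforce
          then show False using fA[OF True] fA 16(4) False by fastforce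
        qed
        ultimately show ?thesis by blast
      next
        case nA: False
        then obtain u where u: "E i u b"
          using net[THEN net.univ_isolated, OF b 16(5)] pending[OF it_PV[OF b nA]] by blast
        have uV: "u \<in> V i" using E_V[OF u] by blast
        have "u \<notin> A i" using nA E_it[OF u] b unfolding A_def by auto
        then have "\<not> E' u c" using E'X[OF uV c False] by blast
        then show ?thesis using u unfolding E'_def by blast
      qed
    qed
  next
    case (17 b x \<xi>)
    then obtain i where b: "b \<in> V i" by blast
    have bA: "b \<notin> A i"
    proof
      assume "b \<in> A i"
      moreover have "w0 (\<not> i) \<in> A (\<not> i)" "w0 (\<not> i) \<in> V (\<not> i)" using w0[of "\<not> i"] unfolding A_def by auto
      ultimately have "E' (w0 (\<not> i)) b" using E'X[OF _ b, of "w0 (\<not> i)" "\<not> i"] by blast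
      then show False using 17(3) by blast
    qed
    have "\<not> E i u b" for u using 17(3)[of u] unfolding E'_def by blast
    then show ?case using net[THEN net.univ_isolated, OF b 17(2)] it'_V[OF b bA] by simp
  next
    case (18 b x \<xi>)
    then show ?case using net[THEN net.univ_Fb] by blast
  next
    case (19 b c)
    then show ?case using net[THEN net.den_V] by blast
  next
    case (20 W E'')
    show ?case
    proof
      assume m: "matched (\<lambda>u v. {u, v} \<in> E'') W"
      have finW: "finite W" using 20(1) N(1) by (meson finite_UN finite_UNIV finite finite_subset)
      have E''_cases: "(\<exists>j. k \<in> L j) \<or> (\<exists>b c j. k = {b, c} \<and> b \<in> V j \<and> den b = Inr c)" if "k \<in> E''" for k
        using subsetD[OF 20(2) that] by blast
      have leap: "k \<subseteq> V i" if k: "k \<in> E''" "v \<in> k" "v \<in> V i" for k v i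
      proof -
        from E''_cases[OF k(1)] consider j where "k \<in> L j" | b c j where "k = {b, c}" "b \<in> V j" "den b = Inr c" by blast
        then have "\<exists>j. k \<subseteq> V j"
        proof cases
          case (1 j)
          then show ?thesis using net[THEN net.link, OF 1] by blast
        next
          case (2 b c j)
          then show ?thesis using net[THEN net.den_V, OF 2(2,3)] by blast
        qed
        then show ?thesis using k side by blast
      qed
      have irr: "{v, v} \<notin> E''" for v
      proof
        assume "{v, v} \<in> E''"
        from E''_cases[OF this]
        consider j where "{v, v} \<in> L j" | b c j where "{v, v} = {b, c}" "b \<in> V j" "den b = Inr c" by blast
        then show False
        proof cases
          case (1 j)
          then show ?thesis using net[THEN net.link, OF 1] by (auto simp: doubleton_eq_iff)
        next
          case (2 b c j)
          then show ?thesis using net[THEN net.den_V, OF 2(2,3)] by (auto simp: doubleton_eq_iff)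
        qed
      qed
      have mi: "\<exists>!w. w \<in> W \<inter> V i \<and> {v, w} \<in> E''" if v: "v \<in> W \<inter> V i" for v i
      proof -
        obtain w where w: "w \<in> W" "{v, w} \<in> E''" "\<And>t. t \<in> W \<Longrightarrow> {v, t} \<in> E'' \<Longrightarrow> t = w"
          using m v unfolding matched_def by blast
        have "w \<in> V i" using leap[OF w(2), of v i] v by auto
        then have "w \<in> W \<inter> V i \<and> {v, w} \<in> E''" using w by blast
        then show ?thesis
        proof (rule ex1I)
          show "t = w" if "t \<in> W \<inter> V i \<and> {v, t} \<in> E''" for t using w(3)[of t] that by blast
        qed
      qed
      have mE: "\<exists>w\<in>W. E' v w \<and> (\<forall>t\<in>W. E' v t \<longrightarrow> t = w)" if "v \<in> W" for v
        using 20(3) that unfolding matched_def by blast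
      show False
      proof (cases "\<exists>u v. u \<in> W \<inter> A False \<and> v \<in> W \<inter> A True")
        case True
        then obtain u v where uv: "u \<in> W" "u \<in> A False" "v \<in> W" "v \<in> A True" by blast
        have uvV: "u \<in> V False" "v \<in> V True" using uv AV by blast+
        have Euv: "E' u v" using E'X[OF uvV] uv by simp
        \<comment> \<open>Each vertex of \<open>A False\<close> is adjacent to \<open>v\<close>,
          whose neighbour in \<open>W\<close> is unique.\<close>
        have u_only: "t = u" if "t \<in> W" "t \<in> A False" for t
        proof -
          have "E' t v" using E'X[of t False v True] that uv uvV AV by blast
          then show ?thesis using mE[OF uv(3)] Euv E'_sym that(1) uv(1) by metis
        qed
        let ?W = "W \<inter> V False"
        have "even (card ?W)"
          by (rule even_card_matched[of _ "\<lambda>u v. {u, v} \<in> E''"])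
            (use finW irr mi in \<open>auto simp: insert_commute\<close>)
        moreover have "even (card (?W - {u}))"
        proof (rule even_card_matched[of _ E'])
          show "finite (?W - {u})" using finW by blast
          show "E' t s" if "E' s t" for s t using E'_sym[OF that] .
          show "\<not> E' t t" if "t \<in> ?W - {u}" for t
            using that E'V[of t False t] net[THEN net.E_irrefl] by blast
          fix t assume t: "t \<in> ?W - {u}"
          then obtain s where s: "s \<in> W" "E' t s" "\<And>r. r \<in> W \<Longrightarrow> E' t r \<Longrightarrow> r = s" using mE[of t] by blast
          have "s \<noteq> u"
          proof
            assume "s = u"
            then have "E' u t" using s(2) E'_sym by blast
            then have "t = v" using mE[OF uv(1)] Euv t uv(3) by (metis Diff_iff IntD1)
            then show False using t uvV side by blast
          qed
          moreover have "s \<in> V False"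
          proof (rule ccontr)
            assume "s \<notin> V False"
            then have "s \<in> V True" using E'_V[OF s(2)] by (metis (full_types))
            then have "t \<in> A False" using E'X[of t False s True] t s(2) by blast
            then show False using u_only t by blast
          qed
          ultimately have "s \<in> ?W - {u} \<and> E' t s" using s(1,2) by blast
          then show "\<exists>!w. w \<in> ?W - {u} \<and> E' t w"
          proof (rule ex1I)
            show "r = s" if "r \<in> ?W - {u} \<and> E' t r" for r using s(3)[of r] that by blast
          qed
        qed
        moreover have "card ?W = Suc (card (?W - {u}))"
          by (rule card.remove) (use uv(1) uvV(1) finW in blast)+
        ultimately show False by simp
      next
        case False
        obtain v0 where "v0 \<in> W" using 20(3) unfolding matched_def by blast
        then obtain i where i: "v0 \<in> W \<inter> V i" using 20(1) by blast
        have "matched (E i) (W \<inter> V i)"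
          unfolding matched_def
        proof (intro conjI ballI)
          show "W \<inter> V i \<noteq> {}" using i by blast
          fix v assume v: "v \<in> W \<inter> V i"
          then obtain w where w: "w \<in> W" "E' v w" "\<forall>t\<in>W. E' v t \<longrightarrow> t = w" using mE by blast
          obtain j where j: "w \<in> V j" using 20(1) w(1) by blast
          have "j = i"
          proof (rule ccontr)
            assume "j \<noteq> i"
            then have "v \<in> A i" "w \<in> A j" using E'X[of v i w j] v j w(2) by blast+
            then show False using False v w(1) \<open>j \<noteq> i\<close> by (cases i; cases j) auto
          qed
          then have wi: "w \<in> V i" using j by blast
          have "w \<in> W \<inter> V i \<and> E i v w" using w wi v E'V[of v i w] by blast
          then show "\<exists>!w. w \<in> W \<inter> V i \<and> E i v w"
          proof (rule ex1I)
            show "t = w" if "t \<in> W \<inter> V i \<and> E i v t" for t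
              using w(3) that E'V[of v i t] v by blast
          qed
        qed
        moreover have "matched (\<lambda>u v. {u, v} \<in> {k \<in> E''. k \<subseteq> V i}) (W \<inter> V i)"
          unfolding matched_def
        proof (intro conjI ballI)
          show "W \<inter> V i \<noteq> {}" using i by blast
          fix v assume v: "v \<in> W \<inter> V i"
          then have "{v, w} \<in> {k \<in> E''. k \<subseteq> V i} \<longleftrightarrow> {v, w} \<in> E''" for w using leap[of "{v, w}" v i] by blast
          then show "\<exists>!w. w \<in> W \<inter> V i \<and> {v, w} \<in> {k \<in> E''. k \<subseteq> V i}" using mi[OF v] by simp
        qed
        moreover have "{k \<in> E''. k \<subseteq> V i} \<subseteq> L i \<union> {{b, c} |b c. b \<in> V i \<and> den b = Inr c}"
        proof
          fix k assume k: "k \<in> {k \<in> E''. k \<subseteq> V i}"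
          then have "k \<in> E''" by blast
          from E''_cases[OF this] consider j where "k \<in> L j" | b c where "k = {b, c}" "den b = Inr c" by blast
          then show "k \<in> L i \<union> {{b, c} |b c. b \<in> V i \<and> den b = Inr c}"
          proof cases
            case (1 j)
            then have "\<exists>v. v \<in> k \<and> v \<in> V j" using net[THEN net.link, OF 1] by blast
            then have "j = i" using k side by blast
            then show ?thesis using 1 by blast
          qed (use k in blast)
        qed
        ultimately show False using net[THEN net.nobim, of "W \<inter> V i" i] by blast
      qed
    qed
  qed
  then show ?thesis unfolding E'_def[abs_def] it'_def[abs_def] .
qed

subsection \<open>Proof search\<close>

definition positions :: "('f, 'p, 'v) fm \<Rightarrow> bool list set" where
  "positions \<psi> = {p. \<exists>\<chi>. sub \<psi> p = Some \<chi>}"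

lemma finite_positions: "finite (positions \<psi>)"
proof (induction \<psi>)
  case (Atm a)
  have "positions (Atm a) \<subseteq> {[]}" unfolding positions_def by (auto elim: sub.elims)
  then show ?case using finite_subset by blast
next
  case (Conj \<phi> \<psi>)
  have "p \<in> insert [] (Cons False ` positions \<phi> \<union> Cons True ` positions \<psi>)" if "p \<in> positions (Conj \<phi> \<psi>)" for p
    using that unfolding positions_def by (cases p) (auto split: if_splits)
  then show ?case using Conj by (meson finite_UnI finite_imageI finite_insert finite_subset subsetI)
next
  case (Disj \<phi> \<psi>)
  have "p \<in> insert [] (Cons False ` positions \<phi> \<union> Cons True ` positions \<psi>)" if "p \<in> positions (Disj \<phi> \<psi>)" for p
    using that unfolding positions_def by (cases p) (auto split: if_splits)
  then show ?case using Disj by (meson finite_UnI finite_imageI finite_insert finite_subset subsetI)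
next
  case (All x \<phi>)
  have "p \<in> insert [] (Cons True ` positions \<phi>)" if "p \<in> positions (All x \<phi>)" for p
    using that unfolding positions_def by (cases p) (auto split: if_splits)
  then show ?case using All by (meson finite_imageI finite_insert finite_subset subsetI)
next
  case (Ex x \<phi>)
  have "p \<in> insert [] (Cons True ` positions \<phi>)" if "p \<in> positions (Ex x \<phi>)" for p
    using that unfolding positions_def by (cases p) (auto split: if_splits)
  then show ?case using Ex by (meson finite_imageI finite_insert finite_subset subsetI)
qed

text \<open>The world introduced by a universal item is named after the bound variable, whatever the
  world \<open>a\<close> of the item. Atoms and existential formulas never count as decomposed, so
  they remain in use throughout a branch.\<close>

fun decomposed :: "(bool list \<times> 'v) set \<Rightarrow> bool list \<times> 'v \<Rightarrow> ('f, 'p, 'v) fm option \<Rightarrow> bool" where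
  "decomposed \<Gamma> (p, a) (Some (Conj \<chi> \<chi>')) \<longleftrightarrow> (\<exists>i. (p @ [i], a) \<in> \<Gamma>)"
| "decomposed \<Gamma> (p, a) (Some (Disj \<chi> \<chi>')) \<longleftrightarrow> (\<forall>i. (p @ [i], a) \<in> \<Gamma>)"
| "decomposed \<Gamma> (p, a) (Some (All x \<chi>)) \<longleftrightarrow> (p @ [True], x) \<in> \<Gamma>"
| "decomposed \<Gamma> _ _ \<longleftrightarrow> False"

lemma decomposed_mono: "decomposed \<Gamma> j \<chi> \<Longrightarrow> \<Gamma> \<subseteq> \<Gamma>' \<Longrightarrow> decomposed \<Gamma>' j \<chi>"
  by (induction \<Gamma> j \<chi> rule: decomposed.induct) auto

text \<open>Hintikka conditions for falsity: they allow all items of \<open>\<Gamma>\<close> to be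
  refuted at once, with the names occurring in \<open>\<Gamma>\<close> as worlds.\<close>

fun saturated_at :: "('f, 'p, 'v) fm \<Rightarrow> (bool list \<times> 'v) set \<Rightarrow> bool list \<times> 'v \<Rightarrow> ('f, 'p, 'v) fm option \<Rightarrow> bool" where
  "saturated_at \<psi> \<Gamma> (p, a) (Some (Ex x \<chi>)) \<longleftrightarrow> (\<forall>b\<in>snd ` \<Gamma>. (p @ [True], b) \<in> \<Gamma>)"
| "saturated_at \<psi> \<Gamma> (p, a) (Some (Atm Tru)) \<longleftrightarrow> False"
| "saturated_at \<psi> \<Gamma> (p, a) (Some (Atm Fls)) \<longleftrightarrow> True"
| "saturated_at \<psi> \<Gamma> (p, a) (Some (Atm (Pred Q ts))) \<longleftrightarrow>
     \<not> (\<exists>q us. (q, a) \<in> \<Gamma> \<and> sub \<psi> q = Some (Atm (Pred (dual_psym Q) us)))"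
| "saturated_at \<psi> \<Gamma> j \<chi> \<longleftrightarrow> decomposed \<Gamma> j \<chi>"

definition saturated :: "('f, 'p, 'v) fm \<Rightarrow> (bool list \<times> 'v) set \<Rightarrow> bool" where
  "saturated \<psi> \<Gamma> \<longleftrightarrow> (\<forall>j\<in>\<Gamma>. saturated_at \<psi> \<Gamma> j (sub \<psi> (fst j)))"

text \<open>\<open>\<Gamma>\<close> collects all items of a branch and \<open>P\<close> those still in use. Each universal quantifier is
  decomposed at most once per branch, which is enough because modal subformulas are closed.\<close>

definition search_state :: "('f, 'p, 'v) fm \<Rightarrow> 'v \<Rightarrow> (bool list \<times> 'v) set \<Rightarrow> (bool list \<times> 'v) set \<Rightarrow> bool" where
  "search_state \<psi> x0 \<Gamma> P \<longleftrightarrow> P \<subseteq> \<Gamma> \<and> \<Gamma> \<subseteq> positions \<psi> \<times> insert x0 (set (bound_vars \<psi>)) \<and>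
     (\<forall>j\<in>\<Gamma> - P. decomposed \<Gamma> j (sub \<psi> (fst j))) \<and>
     (\<forall>a\<in>snd ` \<Gamma>. a = x0 \<or> (\<exists>p \<xi>. sub \<psi> p = Some (All a \<xi>) \<and> (p @ [True], a) \<in> \<Gamma>)) \<and>
     (\<forall>p b x \<xi>. (p @ [True], b) \<in> \<Gamma> \<and> sub \<psi> p = Some (All x \<xi>) \<longrightarrow> b = x)"

lemma search_stateD:
  assumes "search_state \<psi> x0 \<Gamma> P"
  shows "P \<subseteq> \<Gamma>" "\<Gamma> \<subseteq> positions \<psi> \<times> insert x0 (set (bound_vars \<psi>))"
    "\<And>j. j \<in> \<Gamma> \<Longrightarrow> j \<notin> P \<Longrightarrow> decomposed \<Gamma> j (sub \<psi> (fst j))"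
    "\<And>a. a \<in> snd ` \<Gamma> \<Longrightarrow> a = x0 \<or> (\<exists>p \<xi>. sub \<psi> p = Some (All a \<xi>) \<and> (p @ [True], a) \<in> \<Gamma>)"
    "\<And>p b x \<xi>. (p @ [True], b) \<in> \<Gamma> \<Longrightarrow> sub \<psi> p = Some (All x \<xi>) \<Longrightarrow> b = x"
  using assms unfolding search_state_def by (simp_all only: Diff_iff Ball_def) metis+

text \<open>The lower bound on the vertices is what makes it possible to take two nets with disjoint
  vertex sets.\<close>

definition has_net :: "('f, 'p, 'v) fm \<Rightarrow> 'v \<Rightarrow> (bool list \<times> 'v) set \<Rightarrow> bool list set \<Rightarrow> bool" where
  "has_net \<psi> x0 P Fb \<longleftrightarrow> (\<forall>n. \<exists>V E f it L den Bd. net \<psi> x0 P Fb V E f it L den Bd \<and> (\<forall>v\<in>V. n \<le> v))"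

lemma has_net_weaken: "has_net \<psi> x0 P Fb \<Longrightarrow> P \<subseteq> P' \<Longrightarrow> Fb' \<subseteq> Fb \<Longrightarrow> has_net \<psi> x0 P' Fb'"
  unfolding has_net_def by (meson net_weaken)

lemma has_net_Disj:
  assumes "has_net \<psi> x0 (insert (p @ [False], a) (insert (p @ [True], a) P)) Fb" "sub \<psi> p = Some (Disj \<chi> \<chi>')"
  shows "has_net \<psi> x0 (insert (p, a) P) Fb"
  unfolding has_net_def
proof
  fix n
  obtain V E f it L den Bd where N: "net \<psi> x0 (insert (p @ [False], a) (insert (p @ [True], a) P)) Fb V E f it L den Bd" "\<forall>v\<in>V. n \<le> v"
    using assms(1) unfolding has_net_def by blast
  from net_Disj[OF N(1) assms(2)] N(2)
  show "\<exists>V E f it L den Bd. net \<psi> x0 (insert (p, a) P) Fb V E f it L den Bd \<and> (\<forall>v\<in>V. n \<le> v)" by blast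
qed

lemma has_net_quantifier:
  assumes H: "has_net \<psi> x0 (insert (p @ [True], b) P) (if ex then Fb else insert p Fb)"
    and p: "sub \<psi> p = Some \<chi>" "quantifies \<chi> x \<xi>" and ex: "ex \<longleftrightarrow> \<chi> = Ex x \<xi>"
    and new: "(p @ [True], b) \<notin> P"
    and all: "\<not> ex \<Longrightarrow> b = x \<and> p \<notin> Fb \<and> (\<forall>j\<in>P. snd j \<noteq> x)"
  shows "has_net \<psi> x0 (insert (p, a) P) Fb"
  unfolding has_net_def
proof
  fix n
  obtain V E f it L den Bd where N: "net \<psi> x0 (insert (p @ [True], b) P) (if ex then Fb else insert p Fb) V E f it L den Bd" "\<forall>v\<in>V. n \<le> v"
    using H unfolding has_net_def by blast
  show "\<exists>V E f it L den Bd. net \<psi> x0 (insert (p, a) P) Fb V E f it L den Bd \<and> (\<forall>v\<in>V. n \<le> v)"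
  proof (cases "\<exists>v\<in>V. it v = (p @ [True], b)")
    case True
    then obtain v0 where v0: "v0 \<in> V" "it v0 = (p @ [True], b)" by blast
    define c where "c = Suc (n + Max V)"
    have "c \<notin> V"
    proof
      assume "c \<in> V"
      then have "c \<le> Max V" using net.fin[OF N(1)] Max_ge by blast
      then show False unfolding c_def by simp
    qed
    from net_quantifier[OF N(1) p ex v0 new all this, of a]
    show ?thesis
      by (intro exI conjI, assumption) (use N(2) in \<open>auto simp: c_def\<close>)
  next
    case False
    then have "net \<psi> x0 P (if ex then Fb else insert p Fb) V E f it L den Bd" using net_drop[OF N(1)] by blast
    then have "net \<psi> x0 (insert (p, a) P) Fb V E f it L den Bd" by (rule net_weaken) auto
    then show ?thesis using N(2) by blast
  qed
qed

lemma has_net_Conj: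
  assumes H: "\<And>i. has_net \<psi> x0 (insert (p @ [i], a) P) Fb"
    and p: "sub \<psi> p = Some (Conj \<chi>1 \<chi>2)"
    and new: "\<And>i. (p @ [i], a) \<notin> P"
    and pending: "\<And>j x \<xi> \<xi>'. j \<in> P \<Longrightarrow> sub \<psi> (fst j) \<noteq> Some (All x \<xi>) \<and> sub \<psi> (fst j) \<noteq> Some (Disj \<xi> \<xi>')"
  shows "has_net \<psi> x0 (insert (p, a) P) Fb"
  unfolding has_net_def
proof
  fix n
  let ?goal = "\<exists>V E f it L den Bd. net \<psi> x0 (insert (p, a) P) Fb V E f it L den Bd \<and> (\<forall>v\<in>V. n \<le> v)"
  have drop: ?goal if N: "net \<psi> x0 (insert (p @ [i], a) P) Fb V E f it L den Bd" "\<forall>v\<in>V. n \<le> v"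
    "\<And>v. v \<in> V \<Longrightarrow> it v \<noteq> (p @ [i], a)" for i V E f it L den Bd
  proof -
    have "net \<psi> x0 P Fb V E f it L den Bd" using net_drop[OF N(1)] N(3) by blast
    then have "net \<psi> x0 (insert (p, a) P) Fb V E f it L den Bd" by (rule net_weaken) auto
    then show ?thesis using N(2) by blast
  qed
  obtain V1 E1 f1 it1 L1 den1 Bd1 where N1: "net \<psi> x0 (insert (p @ [False], a) P) Fb V1 E1 f1 it1 L1 den1 Bd1" "\<forall>v\<in>V1. n \<le> v"
    using H[of False] unfolding has_net_def by blast
  obtain V2 E2 f2 it2 L2 den2 Bd2 where N2: "net \<psi> x0 (insert (p @ [True], a) P) Fb V2 E2 f2 it2 L2 den2 Bd2"
    "\<forall>v\<in>V2. Suc (n + Max V1) \<le> v"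
    using H[of True] unfolding has_net_def by blast
  have n2: "\<forall>v\<in>V2. n \<le> v" using N2(2) by auto
  show ?goal
  proof (cases "(\<exists>v\<in>V1. it1 v = (p @ [False], a)) \<and> (\<exists>v\<in>V2. it2 v = (p @ [True], a))")
    case False
    then show ?thesis using drop[OF N1] drop[OF N2(1) n2] by blast
  next
    case True
    then obtain v1 v2 where v: "v1 \<in> V1" "it1 v1 = (p @ [False], a)" "v2 \<in> V2" "it2 v2 = (p @ [True], a)" by blast
    have d: "V1 \<inter> V2 = {}" using N2(2) Max_ge[OF net.fin[OF N1(1)]] by fastforce
    define f where "f v = (if v \<in> V1 then f1 v else f2 v)" for v
    define it where "it v = (if v \<in> V1 then it1 v else it2 v)" for v
    define den where "den v = (if v \<in> V1 then den1 v else den2 v)" for v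
    define Bd where "Bd v = (if v \<in> V1 then Bd1 v else Bd2 v)" for v
    have 1: "net \<psi> x0 (insert (p @ [False], a) P) Fb V1 E1 f it L1 den Bd"
      by (rule net_cong[OF N1(1)]) (auto simp: f_def it_def den_def Bd_def)
    have 2: "net \<psi> x0 (insert (p @ [True], a) P) Fb V2 E2 f it L2 den Bd"
      by (rule net_cong[OF N2(1)]) (use d in \<open>auto simp: f_def it_def den_def Bd_def\<close>)
    define V where "V i = (if i then V2 else V1)" for i
    define E where "E i = (if i then E2 else E1)" for i
    define L where "L i = (if i then L2 else L1)" for i
    have net: "net \<psi> x0 (insert (p @ [i], a) P) Fb (V i) (E i) f it (L i) den Bd" for i
      using 1 2 unfolding V_def E_def L_def by (cases i) auto
    have w: "(if i then v2 else v1) \<in> V i \<and> it (if i then v2 else v1) = (p @ [i], a)" for i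
      using v d unfolding V_def it_def by (cases i) auto
    have d': "V False \<inter> V True = {}" using d unfolding V_def by simp
    have "\<forall>v\<in>(\<Union>i. V i). n \<le> v" using N1(2) n2 unfolding V_def by auto
    with net_Conj[OF net p w new pending d'] show ?thesis by blast
  qed
qed

text \<open>It also contains positions of other connectives. This does no harm where it serves as
  \<open>Fb\<close>, since \<open>univ_Fb\<close> restricts universal binders only.\<close>

definition opened :: "(bool list \<times> 'v) set \<Rightarrow> bool list set" where
  "opened \<Gamma> = {p. \<exists>a. (p @ [True], a) \<in> \<Gamma>}"

lemma search_state_extend:
  assumes s: "search_state \<psi> x0 \<Gamma> P" and N: "N \<subseteq> positions \<psi> \<times> insert x0 (set (bound_vars \<psi>))"
    and j: "j \<in> P" and dec: "decomposed (\<Gamma> \<union> N) j (sub \<psi> (fst j)) \<or> j \<in> P'"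
    and P': "P - {j} \<subseteq> P'" "P' \<subseteq> P \<union> N" "N - \<Gamma> \<subseteq> P'"
    and w: "\<And>a. a \<in> snd ` N \<Longrightarrow> a \<in> snd ` \<Gamma> \<or> (\<exists>p \<xi>. sub \<psi> p = Some (All a \<xi>) \<and> (p @ [True], a) \<in> N)"
    and o: "\<And>p b x \<xi>. (p @ [True], b) \<in> N \<Longrightarrow> sub \<psi> p = Some (All x \<xi>) \<Longrightarrow> b = x"
  shows "search_state \<psi> x0 (\<Gamma> \<union> N) P'"
  unfolding search_state_def
proof (intro conjI ballI allI impI)
  note S = search_stateD[OF s]
  show "P' \<subseteq> \<Gamma> \<union> N" using S(1) P'(2) by blast
  show "\<Gamma> \<union> N \<subseteq> positions \<psi> \<times> insert x0 (set (bound_vars \<psi>))" using S(2) N by (rule Un_least)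
  show "decomposed (\<Gamma> \<union> N) k (sub \<psi> (fst k))" if k: "k \<in> \<Gamma> \<union> N - P'" for k
  proof (cases "k = j")
    case True
    then show ?thesis using dec k by blast
  next
    case False
    then have "k \<in> \<Gamma>" "k \<notin> P" using k P' by blast+
    then have "decomposed \<Gamma> k (sub \<psi> (fst k))" by (rule S(3))
    then show ?thesis using decomposed_mono by blast
  qed
  show "a = x0 \<or> (\<exists>p \<xi>. sub \<psi> p = Some (All a \<xi>) \<and> (p @ [True], a) \<in> \<Gamma> \<union> N)" if "a \<in> snd ` (\<Gamma> \<union> N)" for a
  proof (cases "a \<in> snd ` \<Gamma>")
    case True
    then show ?thesis using S(4) by blast
  next
    case False
    then show ?thesis using that w[of a] by blast
  qed
  show "b = x" if "(p @ [True], b) \<in> \<Gamma> \<union> N \<and> sub \<psi> p = Some (All x \<xi>)" for p b x \<xi>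
    using that o[of p b x \<xi>] S(5)[of p b x \<xi>] by blast
qed

text \<open>Each step adds an item to the branch or, if there is nothing new to add, removes one
  from \<open>P\<close>; so the number of missing items and then the size of \<open>P\<close>
  decrease lexicographically. Rules are tried in the order disjunction, universal, conjunction,
  existential, axiom, because \<open>has_net_Conj\<close> needs a \<open>P\<close> without
  disjunctions and universal formulas.\<close>

lemma search:
  assumes mf: "modal_form x0 \<phi> \<psi>" and dist: "distinct (bound_vars \<psi>)" and x0: "x0 \<notin> set (bound_vars \<psi>)"
  shows "search_state \<psi> x0 \<Gamma> P \<Longrightarrow>
    has_net \<psi> x0 P (opened \<Gamma>) \<or> (\<exists>\<Gamma>'. \<Gamma> \<subseteq> \<Gamma>' \<and> \<Gamma>' \<subseteq> positions \<psi> \<times> insert x0 (set (bound_vars \<psi>)) \<and> saturated \<psi> \<Gamma>')"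
proof (induction "(card (positions \<psi> \<times> insert x0 (set (bound_vars \<psi>)) - \<Gamma>), card P)" arbitrary: \<Gamma> P
    rule: wf_induct_rule[OF wf_lex_prod[OF wf_less_than wf_less_than]])
  case 1
  let ?U = "positions \<psi> \<times> insert x0 (set (bound_vars \<psi>))"
  let ?sat = "\<lambda>\<Gamma>. \<exists>\<Gamma>'. \<Gamma> \<subseteq> \<Gamma>' \<and> \<Gamma>' \<subseteq> ?U \<and> saturated \<psi> \<Gamma>'"
  note s = 1(2)
  note S = search_stateD[OF s]
  note PG = S(1) and GU = S(2)
  have finU: "finite ?U" using finite_positions by blast
  have finP: "finite P" by (rule finite_subset[OF subset_trans[OF PG GU] finU])
  have IH: "has_net \<psi> x0 P' (opened (\<Gamma> \<union> N)) \<or> ?sat \<Gamma>"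
    if "search_state \<psi> x0 (\<Gamma> \<union> N) P'" "\<not> N \<subseteq> \<Gamma> \<or> N \<subseteq> \<Gamma> \<and> P' \<subset> P" for N P'
  proof -
    have "((card (?U - (\<Gamma> \<union> N)), card P'), (card (?U - \<Gamma>), card P)) \<in> less_than <*lex*> less_than"
    proof (cases "N \<subseteq> \<Gamma>")
      case True
      then have "\<Gamma> \<union> N = \<Gamma>" by blast
      moreover have "card P' < card P" using that(2) True finP psubset_card_mono by blast
      ultimately show ?thesis by simp
    next
      case False
      have "\<Gamma> \<union> N \<subseteq> ?U" by (rule search_stateD(2)[OF that(1)])
      then have "?U - (\<Gamma> \<union> N) \<subset> ?U - \<Gamma>" using False by blast
      then have "card (?U - (\<Gamma> \<union> N)) < card (?U - \<Gamma>)" using finU by (meson finite_Diff psubset_card_mono)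
      then show ?thesis by simp
    qed
    from 1(1)[OF this that(1)] show ?thesis by blast
  qed
  have pos: "p @ [i] \<in> positions \<psi>" if "sub \<psi> p = Some \<chi>" "\<exists>\<xi>. sub \<chi> [i] = Some \<xi>" for p i \<chi>
    using that unfolding positions_def by (simp add: sub_append)
  have memU: "a \<in> insert x0 (set (bound_vars \<psi>))" "a \<in> snd ` \<Gamma>" "(p, a) \<in> \<Gamma>" if "(p, a) \<in> P" for p a
    using that PG GU by force+
  have opened_sub: "opened \<Gamma> \<subseteq> opened (\<Gamma> \<union> N)" for N unfolding opened_def by blast
  show ?case
  proof (cases "\<exists>p a \<chi> \<chi>'. (p, a) \<in> P \<and> sub \<psi> p = Some (Disj \<chi> \<chi>')")
    case True
    then obtain p a \<chi> \<chi>' where p: "(p, a) \<in> P" "sub \<psi> p = Some (Disj \<chi> \<chi>')" by blast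
    define N where "N = {(p @ [False], a), (p @ [True], a)}"
    define P' where "P' = (P - {(p, a)}) \<union> (N - \<Gamma>)"
    have st: "search_state \<psi> x0 (\<Gamma> \<union> N) P'"
    proof (rule search_state_extend[OF s _ p(1)])
      show "N \<subseteq> ?U" using pos[OF p(2)] memU(1)[OF p(1)] unfolding N_def by auto
      have "(p @ [i], a) \<in> N" for i unfolding N_def by (cases i) auto
      then show "decomposed (\<Gamma> \<union> N) (p, a) (sub \<psi> (fst (p, a))) \<or> (p, a) \<in> P'" using p(2) by auto
      show "a' \<in> snd ` \<Gamma> \<or> (\<exists>p \<xi>. sub \<psi> p = Some (All a' \<xi>) \<and> (p @ [True], a') \<in> N)" if "a' \<in> snd ` N" for a'
        using that memU(2)[OF p(1)] unfolding N_def by auto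
      show "b = x" if "(q @ [True], b) \<in> N" "sub \<psi> q = Some (All x \<xi>)" for q b x \<xi>
        using that p(2) unfolding N_def by auto
    qed (auto simp: P'_def)
    have "\<not> N \<subseteq> \<Gamma> \<or> N \<subseteq> \<Gamma> \<and> P' \<subset> P" using p(1) unfolding P'_def by blast
    from IH[OF st this] show ?thesis
    proof
      assume "has_net \<psi> x0 P' (opened (\<Gamma> \<union> N))"
      then have "has_net \<psi> x0 (insert (p @ [False], a) (insert (p @ [True], a) (P - {(p, a)}))) (opened \<Gamma>)"
        by (rule has_net_weaken[OF _ _ opened_sub]) (auto simp: P'_def N_def)
      from has_net_Disj[OF this p(2)] show ?thesis using p(1) by (simp add: insert_absorb)
    qed blast
  next
    case noDisj: False
    show ?thesis
    proof (cases "\<exists>p a x \<xi>. (p, a) \<in> P \<and> sub \<psi> p = Some (All x \<xi>)")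
      case True
      then obtain p a x \<xi> where p: "(p, a) \<in> P" "sub \<psi> p = Some (All x \<xi>)" by blast
      have q: "quantifies (All x \<xi>) x \<xi>" unfolding quantifies_def by blast
      have xb: "x \<in> set (bound_vars \<psi>)" using bound_vars_sub[OF p(2) q] .
      define N where "N = {(p @ [True], x)}"
      define P' where "P' = (P - {(p, a)}) \<union> (N - \<Gamma>)"
      have st: "search_state \<psi> x0 (\<Gamma> \<union> N) P'"
      proof (rule search_state_extend[OF s _ p(1)])
        show "N \<subseteq> ?U" using pos[OF p(2)] xb unfolding N_def by auto
        show "decomposed (\<Gamma> \<union> N) (p, a) (sub \<psi> (fst (p, a))) \<or> (p, a) \<in> P'" using p(2) unfolding N_def by auto
        show "a' \<in> snd ` \<Gamma> \<or> (\<exists>p \<xi>. sub \<psi> p = Some (All a' \<xi>) \<and> (p @ [True], a') \<in> N)" if "a' \<in> snd ` N" for a'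
          using that p(2) unfolding N_def by auto
        show "b = y" if "(q @ [True], b) \<in> N" "sub \<psi> q = Some (All y \<xi>')" for q b y \<xi>'
          using that p(2) unfolding N_def by auto
      qed (auto simp: P'_def)
      have "\<not> N \<subseteq> \<Gamma> \<or> N \<subseteq> \<Gamma> \<and> P' \<subset> P" using p(1) unfolding P'_def by blast
      from IH[OF st this] show ?thesis
      proof
        assume H: "has_net \<psi> x0 P' (opened (\<Gamma> \<union> N))"
        show ?thesis
        \<comment> \<open>If the quantifier was opened before on this branch, possibly for an item
          at another world, the present item is dropped and no second binder arises.\<close>
        proof (cases "(p @ [True], x) \<in> \<Gamma>")
          case True
          then have "has_net \<psi> x0 P (opened \<Gamma>)"
            using has_net_weaken[OF H _ opened_sub] unfolding P'_def N_def by blast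
          then show ?thesis by blast
        next
          case False
          then have P': "P' = insert (p @ [True], x) (P - {(p, a)})" unfolding P'_def N_def by auto
          have op: "insert p (opened \<Gamma>) \<subseteq> opened (\<Gamma> \<union> N)" unfolding opened_def N_def by blast
          have H': "has_net \<psi> x0 (insert (p @ [True], x) (P - {(p, a)})) (if False then opened \<Gamma> else insert p (opened \<Gamma>))"
            using has_net_weaken[OF H _ op] P' by auto
          \<comment> \<open>A name other than \<open>x0\<close> is on the branch only if its own
            quantifier has been opened, so \<open>x\<close> is still fresh.\<close>
          have "snd j \<noteq> x" if "j \<in> P" for j
          proof
            assume "snd j = x"
            then have "x \<in> snd ` \<Gamma>" using that PG by blast
            then obtain p' \<xi>' where "sub \<psi> p' = Some (All x \<xi>')" "(p' @ [True], x) \<in> \<Gamma>"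
              using S(4) x0 xb by metis
            moreover have "p' = p" using bound_position_unique[OF dist calculation(1) _ p(2) q] unfolding quantifies_def by blast
            ultimately show False using False by blast
          qed
          moreover have "p \<notin> opened \<Gamma>" using S(5)[OF _ p(2)] False unfolding opened_def by blast
          ultimately have "has_net \<psi> x0 (insert (p, a) (P - {(p, a)})) (opened \<Gamma>)"
            using False PG by (intro has_net_quantifier[OF H' p(2) q]) auto
          then show ?thesis using p(1) by (simp add: insert_absorb)
        qed
      qed blast
    next
      case noAll: False
      show ?thesis
      proof (cases "\<exists>p a \<chi> \<chi>'. (p, a) \<in> P \<and> sub \<psi> p = Some (Conj \<chi> \<chi>')")
        case True
        then obtain p a \<chi> \<chi>' where p: "(p, a) \<in> P" "sub \<psi> p = Some (Conj \<chi> \<chi>')" by blast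
        have st: "search_state \<psi> x0 (\<Gamma> \<union> N) ((P - {(p, a)}) \<union> (N - \<Gamma>))" if N: "N = {(p @ [i], a)}" for N i
        proof (rule search_state_extend[OF s _ p(1)])
          show "N \<subseteq> ?U" using pos[OF p(2), of i] memU(1)[OF p(1)] unfolding N by auto
          show "decomposed (\<Gamma> \<union> N) (p, a) (sub \<psi> (fst (p, a))) \<or> (p, a) \<in> (P - {(p, a)}) \<union> (N - \<Gamma>)"
            using p(2) unfolding N by auto
          show "a' \<in> snd ` \<Gamma> \<or> (\<exists>p \<xi>. sub \<psi> p = Some (All a' \<xi>) \<and> (p @ [True], a') \<in> N)" if "a' \<in> snd ` N" for a'
            using that memU(2)[OF p(1)] unfolding N by auto
          show "b = x" if "(q @ [True], b) \<in> N" "sub \<psi> q = Some (All x \<xi>)" for q b x \<xi>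
            using that p(2) unfolding N by auto
        qed auto
        show ?thesis
        \<comment> \<open>If a conjunct is on the branch already, the item is dropped without
          branching. Otherwise both conjuncts are new, as \<open>has_net_Conj\<close>
          demands.\<close>
        proof (cases "\<exists>i. (p @ [i], a) \<in> \<Gamma>")
          case True
          then obtain i where i: "(p @ [i], a) \<in> \<Gamma>" by blast
          then have "\<not> {(p @ [i], a)} \<subseteq> \<Gamma> \<or> {(p @ [i], a)} \<subseteq> \<Gamma> \<and> (P - {(p, a)}) \<union> ({(p @ [i], a)} - \<Gamma>) \<subset> P"
            using p(1) by blast
          from IH[OF st[OF refl] this] show ?thesis
          proof
            assume H: "has_net \<psi> x0 ((P - {(p, a)}) \<union> ({(p @ [i], a)} - \<Gamma>)) (opened (\<Gamma> \<union> {(p @ [i], a)}))"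
            have "has_net \<psi> x0 P (opened \<Gamma>)"
              by (rule has_net_weaken[OF H _ opened_sub]) (use i in auto)
            then show ?thesis by blast
          qed blast
        next
          case False
          have "has_net \<psi> x0 (insert (p @ [i], a) (P - {(p, a)})) (opened \<Gamma>) \<or> ?sat \<Gamma>" for i
          proof -
            have "\<not> {(p @ [i], a)} \<subseteq> \<Gamma> \<or> {(p @ [i], a)} \<subseteq> \<Gamma> \<and> (P - {(p, a)}) \<union> ({(p @ [i], a)} - \<Gamma>) \<subset> P"
              using False by blast
            from IH[OF st[OF refl] this] show ?thesis
            proof
              assume H: "has_net \<psi> x0 ((P - {(p, a)}) \<union> ({(p @ [i], a)} - \<Gamma>)) (opened (\<Gamma> \<union> {(p @ [i], a)}))"
              have "has_net \<psi> x0 (insert (p @ [i], a) (P - {(p, a)})) (opened \<Gamma>)"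
                by (rule has_net_weaken[OF H _ opened_sub]) auto
              then show ?thesis by blast
            qed blast
          qed
          then have "?sat \<Gamma> \<or> (\<forall>i. has_net \<psi> x0 (insert (p @ [i], a) (P - {(p, a)})) (opened \<Gamma>))" by blast
          then show ?thesis
          proof
            assume H: "\<forall>i. has_net \<psi> x0 (insert (p @ [i], a) (P - {(p, a)})) (opened \<Gamma>)"
            have "has_net \<psi> x0 (insert (p, a) (P - {(p, a)})) (opened \<Gamma>)"
            proof (rule has_net_Conj[OF _ p(2)])
              show "has_net \<psi> x0 (insert (p @ [i], a) (P - {(p, a)})) (opened \<Gamma>)" for i using H by blast
              show "(p @ [i], a) \<notin> P - {(p, a)}" for i using False PG by blast
              show "sub \<psi> (fst j) \<noteq> Some (All x \<xi>) \<and> sub \<psi> (fst j) \<noteq> Some (Disj \<xi> \<xi>')" if "j \<in> P - {(p, a)}" for j x \<xi> \<xi>'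
                using that noAll noDisj by (metis DiffD1 prod.collapse)
            qed
            then show ?thesis using p(1) by (simp add: insert_absorb)
          qed blast
        qed
      next
        case noConj: False
        show ?thesis
        proof (cases "\<exists>p a x \<xi> b. (p, a) \<in> P \<and> sub \<psi> p = Some (Ex x \<xi>) \<and> b \<in> snd ` \<Gamma> \<and> (p @ [True], b) \<notin> \<Gamma>")
          case True
          then obtain p a x \<xi> b where p: "(p, a) \<in> P" "sub \<psi> p = Some (Ex x \<xi>)" "b \<in> snd ` \<Gamma>" "(p @ [True], b) \<notin> \<Gamma>" by blast
          have q: "quantifies (Ex x \<xi>) x \<xi>" unfolding quantifies_def by blast
          define N where "N = {(p @ [True], b)}"
          \<comment> \<open>The existential item stays in \<open>P\<close>, since it has to be
            instantiated with every name of the branch.\<close>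
          have st: "search_state \<psi> x0 (\<Gamma> \<union> N) (P \<union> N)"
          proof (rule search_state_extend[OF s _ p(1)])
            have "b \<in> insert x0 (set (bound_vars \<psi>))" using p(3) GU by auto
            then show "N \<subseteq> ?U" using pos[OF p(2), of True] unfolding N_def by auto
            show "decomposed (\<Gamma> \<union> N) (p, a) (sub \<psi> (fst (p, a))) \<or> (p, a) \<in> P \<union> N" using p(1) by blast
            show "a' \<in> snd ` \<Gamma> \<or> (\<exists>p \<xi>. sub \<psi> p = Some (All a' \<xi>) \<and> (p @ [True], a') \<in> N)" if "a' \<in> snd ` N" for a'
              using that p(3) unfolding N_def by auto
            show "b = x" if "(q @ [True], b) \<in> N" "sub \<psi> q = Some (All x \<xi>)" for q b x \<xi>
              using that p(2) unfolding N_def by auto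
          qed auto
          have "\<not> N \<subseteq> \<Gamma> \<or> N \<subseteq> \<Gamma> \<and> P \<union> N \<subset> P" using p(4) unfolding N_def by blast
          from IH[OF st this] show ?thesis
          proof
            assume H: "has_net \<psi> x0 (P \<union> N) (opened (\<Gamma> \<union> N))"
            have "has_net \<psi> x0 (insert (p @ [True], b) P) (opened \<Gamma>)"
              by (rule has_net_weaken[OF H _ opened_sub]) (auto simp: N_def)
            then have H': "has_net \<psi> x0 (insert (p @ [True], b) P) (if True then opened \<Gamma> else insert p (opened \<Gamma>))"
              by simp
            have "has_net \<psi> x0 (insert (p, a) P) (opened \<Gamma>)"
              using p(4) PG by (intro has_net_quantifier[OF H' p(2) q]) auto
            then show ?thesis using p(1) by (simp add: insert_absorb)
          qed blast
        next
          case noEx: False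
          show ?thesis
          proof (cases "saturated \<psi> \<Gamma>")
            case True
            then show ?thesis using GU by blast
          next
            case False
            then obtain p a where pa: "(p, a) \<in> \<Gamma>" "\<not> saturated_at \<psi> \<Gamma> (p, a) (sub \<psi> p)"
              unfolding saturated_def by auto
            obtain \<chi> where \<chi>: "sub \<psi> p = Some \<chi>" using pa(1) GU unfolding positions_def by blast
            \<comment> \<open>Atoms are never decomposed, so every atom of the branch is still
              available for an axiom.\<close>
            have inP: "(q, b) \<in> P" if "(q, b) \<in> \<Gamma>" "sub \<psi> q = Some (Atm A)" for q b A
              using S(3)[of "(q, b)"] that by (cases "(q, b) \<in> P") auto
            have dec: "(p, a) \<notin> P \<Longrightarrow> decomposed \<Gamma> (p, a) (Some \<chi>)" using S(3)[OF pa(1)] \<chi> by auto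
            have "\<exists>A. \<chi> = Atm A"
            proof (cases \<chi>)
              case (Ex x \<xi>)
              then have "(p, a) \<in> P" using dec by auto
              then show ?thesis using noEx pa(2) \<chi> Ex by auto
            next
              case (Conj \<xi> \<xi>')
              then have "(p, a) \<notin> P" using noConj \<chi> by blast
              then show ?thesis using dec pa(2) \<chi> Conj by simp
            next
              case (Disj \<xi> \<xi>')
              then have "(p, a) \<notin> P" using noDisj \<chi> by blast
              then show ?thesis using dec pa(2) \<chi> Disj by simp
            next
              case (All x \<xi>)
              then have "(p, a) \<notin> P" using noAll \<chi> by blast
              then show ?thesis using dec pa(2) \<chi> All by simp
            qed blast
            then obtain A where A: "sub \<psi> p = Some (Atm A)" using \<chi> by blast
            have paP: "(p, a) \<in> P" using inP[OF pa(1) A] .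
            have "has_net \<psi> x0 P (opened \<Gamma>)"
            proof (cases A)
              case Tru
              then show ?thesis
                unfolding has_net_def using net_Tru[OF _ paP] A by (metis order_refl singletonD)
            next
              case Fls
              then show ?thesis using pa(2) A by simp
            next
              case (Pred Q ts)
              then obtain q us where q: "(q, a) \<in> \<Gamma>" "sub \<psi> q = Some (Atm (Pred (dual_psym Q) us))"
                using pa(2) A by auto
              note ax = net_axiom[OF mf A[unfolded Pred] q(2) paP inP[OF q]]
              show ?thesis
                unfolding has_net_def
              proof
                fix n
                have "\<forall>v\<in>{n, Suc n}. n \<le> v" by auto
                with ax[of "opened \<Gamma>" n] show "\<exists>V E f it L den Bd. net \<psi> x0 P (opened \<Gamma>) V E f it L den Bd \<and> (\<forall>v\<in>V. n \<le> v)" by blast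
              qed
            qed
            then show ?thesis by blast
          qed
        qed
      qed
    qed
  qed
qed

subsection \<open>Countermodels\<close>

text \<open>A positive atom is false exactly at the worlds where the branch has it as an item. A
  negative atom on the branch is then false as well, because saturation forbids dual atoms under one
  name and \<open>h\<close> keeps names apart. One false world, named after the bound variable,
  serves a box at all worlds, since all worlds are related.\<close>

lemma saturated_countermodel:
  assumes sat: "saturated \<psi> \<Gamma>" and inj: "inj_on h (snd ` \<Gamma>)"
  defines "W \<equiv> h ` snd ` \<Gamma>"
  defines "V \<equiv> \<lambda>w P. \<not> (\<exists>q a us. (q, a) \<in> \<Gamma> \<and> h a = w \<and> sub \<psi> q = Some (Atm (Pred (Pos P) us)))"
  shows "modal_form z \<phi> \<chi> \<Longrightarrow> sub \<psi> p = Some \<chi> \<Longrightarrow> (p, a) \<in> \<Gamma> \<Longrightarrow> \<not> Defs.sat (W \<times> W) V (h a) \<phi>"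
proof (induction \<phi> arbitrary: z \<chi> p a)
  case (MPred Q)
  then have s: "saturated_at \<psi> \<Gamma> (p, a) (Some (Atm (Pred Q [Var z])))" using sat unfolding saturated_def by force
  show ?case
  proof (cases Q)
    case (Pos P)
    then show ?thesis using MPred unfolding V_def by auto
  next
    case (Neg P)
    have "V (h a) P"
      unfolding V_def
    proof
      assume "\<exists>q b us. (q, b) \<in> \<Gamma> \<and> h b = h a \<and> sub \<psi> q = Some (Atm (Pred (Pos P) us))"
      then obtain q b us where q: "(q, b) \<in> \<Gamma>" "h b = h a" "sub \<psi> q = Some (Atm (Pred (Pos P) us))" by blast
      have "a \<in> snd ` \<Gamma>" "b \<in> snd ` \<Gamma>" using q(1) MPred(3) by force+
      then have "b = a" using inj_onD[OF inj q(2)] by blast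
      then show False using s q Neg by auto
    qed
    then show ?thesis using Neg by simp
  qed
next
  case MTru
  then show ?case using sat unfolding saturated_def by force
next
  case MFls
  then show ?case by simp
next
  case (MConj \<phi>1 \<phi>2)
  then obtain \<chi>1 \<chi>2 where \<chi>: "\<chi> = Conj \<chi>1 \<chi>2" "modal_form z \<phi>1 \<chi>1" "modal_form z \<phi>2 \<chi>2" by auto
  have "saturated_at \<psi> \<Gamma> (p, a) (Some \<chi>)" using sat MConj.prems unfolding saturated_def by force
  then obtain i where i: "(p @ [i], a) \<in> \<Gamma>" using \<chi>(1) by auto
  have "sub \<psi> (p @ [i]) = Some (if i then \<chi>2 else \<chi>1)" using MConj.prems(2) \<chi>(1) by (simp add: sub_append)
  then show ?case using MConj.IH(1)[OF \<chi>(2) _, of "p @ [i]" a] MConj.IH(2)[OF \<chi>(3) _, of "p @ [i]" a] i by (cases i) auto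
next
  case (MDisj \<phi>1 \<phi>2)
  then obtain \<chi>1 \<chi>2 where \<chi>: "\<chi> = Disj \<chi>1 \<chi>2" "modal_form z \<phi>1 \<chi>1" "modal_form z \<phi>2 \<chi>2" by auto
  have "saturated_at \<psi> \<Gamma> (p, a) (Some \<chi>)" using sat MDisj.prems unfolding saturated_def by force
  then have i: "(p @ [i], a) \<in> \<Gamma>" for i using \<chi>(1) by auto
  have "sub \<psi> (p @ [i]) = Some (if i then \<chi>2 else \<chi>1)" for i using MDisj.prems(2) \<chi>(1) by (simp add: sub_append)
  from this[of False] this[of True]
  show ?case using MDisj.IH(1)[OF \<chi>(2) _ i[of False]] MDisj.IH(2)[OF \<chi>(3) _ i[of True]] by auto
next
  case (Box \<phi>)
  then obtain y \<xi> where \<chi>: "\<chi> = All y \<xi>" "modal_form y \<phi> \<xi>" by auto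
  have "saturated_at \<psi> \<Gamma> (p, a) (Some \<chi>)" using sat Box.prems unfolding saturated_def by force
  then have i: "(p @ [True], y) \<in> \<Gamma>" using \<chi>(1) by auto
  have "sub \<psi> (p @ [True]) = Some \<xi>" using Box.prems(2) \<chi>(1) by (simp add: sub_append)
  then have "\<not> Defs.sat (W \<times> W) V (h y) \<phi>" using Box.IH[OF \<chi>(2) _ i] by blast
  moreover have "h a \<in> W" "h y \<in> W" using i Box.prems(3) unfolding W_def by force+
  ultimately show ?case by auto
next
  case (Dia \<phi>)
  then obtain y \<xi> where \<chi>: "\<chi> = Ex y \<xi>" "modal_form y \<phi> \<xi>" by auto
  have "saturated_at \<psi> \<Gamma> (p, a) (Some \<chi>)" using sat Dia.prems unfolding saturated_def by force
  then have i: "\<forall>b\<in>snd ` \<Gamma>. (p @ [True], b) \<in> \<Gamma>" using \<chi>(1) by auto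
  have "sub \<psi> (p @ [True]) = Some \<xi>" using Dia.prems(2) \<chi>(1) by (simp add: sub_append)
  then have "\<not> Defs.sat (W \<times> W) V w \<phi>" if "w \<in> W" for w
    using Dia.IH[OF \<chi>(2)] i that unfolding W_def by blast
  then show ?case by auto
qed

lemma valid_has_net:
  assumes inf: "infinite (UNIV :: 'w set)" and valid: "S5_valid TYPE('w) \<phi>"
    and mf: "modal_form x0 \<phi> \<psi>" and dist: "distinct (bound_vars \<psi>)" and x0: "x0 \<notin> set (bound_vars \<psi>)"
  shows "has_net \<psi> x0 {([], x0)} {}"
proof -
  have "search_state \<psi> x0 {([], x0)} {([], x0)}"
    unfolding search_state_def positions_def by auto
  from search[OF mf dist x0 this] show ?thesis
  proof
    assume "has_net \<psi> x0 {([], x0)} (opened {([], x0)})"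
    then show ?thesis by (rule has_net_weaken) auto
  next
    assume "\<exists>\<Gamma>'. {([], x0)} \<subseteq> \<Gamma>' \<and> \<Gamma>' \<subseteq> positions \<psi> \<times> insert x0 (set (bound_vars \<psi>)) \<and> saturated \<psi> \<Gamma>'"
    then obtain \<Gamma> where G: "([], x0) \<in> \<Gamma>" "\<Gamma> \<subseteq> positions \<psi> \<times> insert x0 (set (bound_vars \<psi>))" "saturated \<psi> \<Gamma>" by blast
    have "finite \<Gamma>" using G(2) finite_positions by (meson finite_SigmaI finite_insert finite_set finite_subset)
    then have fin: "finite (snd ` \<Gamma>)" by blast
    \<comment> \<open>The worlds are the finitely many names of the branch, carried over to the type
      of worlds; its infinity provides enough of them.\<close>
    obtain B :: "'w set" where B: "finite B" "card B = card (snd ` \<Gamma>)"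
      using infinite_arbitrarily_large[OF inf] by blast
    then obtain h where h: "bij_betw h (snd ` \<Gamma>) B" using finite_same_card_bij[OF fin] by metis
    then have inj: "inj_on h (snd ` \<Gamma>)" unfolding bij_betw_def by blast
    let ?W = "h ` snd ` \<Gamma>"
    have "equiv ?W (?W \<times> ?W)" unfolding equiv_def refl_on_def sym_def trans_def by auto
    moreover have "h x0 \<in> ?W" using G(1) by force
    ultimately have "Defs.sat (?W \<times> ?W) V (h x0) \<phi>" for V
      using valid unfolding S5_valid_def by blast
    then show ?thesis using saturated_countermodel[OF G(3) inj mf _ G(1)] by auto
  qed
qed

subsection \<open>From nets to combinatorial proofs\<close>

lemma fograph_rename:
  assumes "fograph G" "inj_on r (binders G)"
  shows "fograph (rename_binders r G)"
  unfolding fograph_def logical_cograph_def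
proof (intro conjI ballI)
  show "cograph (rename_binders r G)"
    using fographD(1)[OF assms(1)] unfolding cograph_def graph_def by simp
  show "literals (rename_binders r G) \<noteq> {}" using fographD(4)[OF assms(1)] by simp
  fix b assume "b \<in> binders (rename_binders r G)"
  then have b: "b \<in> binders G" by simp
  have lab: "label (rename_binders r G) c = Binder (r c)" if "c \<in> binders G" for c
    using that label_rename_Binder unfolding binders_def by fast
  show "legal (rename_binders r G) b"
    unfolding legal_def
  proof (intro conjI ballI impI)
    show "scope (rename_binders r G) b \<inter> literals (rename_binders r G) \<noteq> {}"
      using fographD(5)[OF assms(1) b] unfolding legal_def by simp
    fix c assume c: "c \<in> scope (rename_binders r G) b \<inter> binders (rename_binders r G)"
      "label (rename_binders r G) c = label (rename_binders r G) b"
    then have cb: "c \<in> binders G" by simp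
    then have "r c = r b" using c(2) lab[OF cb] lab[OF b] by simp
    then show "c = b" using inj_onD[OF assms(2)] cb b by blast
  qed
qed

text \<open>Binding in \<open>N\<close> has to be recovered from modules: a body is inside its scope
  by \<open>body_subset_scope\<close>, and a larger scope does no harm because distinct bound
  variables make the label of a binder determine its position. The dualizer is read off
  \<open>den\<close>.\<close>

lemma combinatorial_proof_of_net:
  fixes \<psi> :: "('f, 'p, nat) fm"
  assumes net: "net \<psi> x0 {([], x0)} {} V E f it L den Bd"
    and mf: "modal_form x0 \<phi> \<psi>" and dist: "distinct (bound_vars \<psi>)" and x0: "x0 \<notin> set (bound_vars \<psi>)"
  defines "N \<equiv> \<lparr>verts = V, edges = {{u, v} |u v. E u v}, label = (\<lambda>v. label (graph_of \<psi>) (f v))\<rparr>"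
  shows "fonet N L" "skew_bifibration N (graph_of \<psi>) f"
proof -
  interpret net \<psi> x0 "{([], x0)}" "{}" V E f it L den Bd by fact
  let ?H = "graph_of \<psi>"
  have NV [simp]: "verts N = V" unfolding N_def by simp
  have NE: "adj N u v \<longleftrightarrow> E u v" for u v
    unfolding N_def using E_sym by (auto simp: doubleton_eq_iff)
  have Nl: "label N v = label ?H (f v)" for v unfolding N_def by simp
  have itv: "fst (it v) = []" "snd (it v) = x0" if "v \<in> V" for v using it_P[OF that] by auto
  have fV: "f v \<in> fverts \<psi>" if "v \<in> V" for v using f_H[OF that] by blast
  have lab: "label N v = l \<longleftrightarrow> (\<exists>\<chi>. sub \<psi> (f v) = Some \<chi> \<and> vlab \<chi> = Some l)" if "v \<in> V" for v l
    unfolding Nl by (rule flabel_iff[OF fV[OF that]])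
  have labL: "label N v = Literal a \<longleftrightarrow> sub \<psi> (f v) = Some (Atm a)" if "v \<in> V" for v a
    unfolding lab[OF that] vlab_Literal by blast
  have labB: "label N v = Binder x \<longleftrightarrow> (\<exists>\<chi> \<xi>. sub \<psi> (f v) = Some \<chi> \<and> quantifies \<chi> x \<xi>)" if "v \<in> V" for v x
    unfolding lab[OF that] vlab_Binder by blast
  have same: "f b = f c" if "b \<in> V" "c \<in> V" "label N b = Binder x" "label N c = Binder x" for b c x
    using that bound_position_unique[OF dist] unfolding labB[OF that(1)] labB[OF that(2)] by blast
  have x0b: "label N b \<noteq> Binder x0" if "b \<in> V" for b
    using x0 bound_vars_sub[of \<psi>] unfolding labB[OF that] by blast
  have graphN: "graph N"
    unfolding graph_def
  proof (intro conjI ballI)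
    show "finite (verts N)" using fin by simp
    fix e assume "e \<in> edges N"
    then obtain u v where e: "e = {u, v}" "E u v" unfolding N_def by auto
    then show "e \<subseteq> verts N" using E_V by simp
    have "u \<noteq> v" using e(2) E_irrefl by blast
    then show "card e = 2" using e(1) by simp
  qed
  have cographN: "cograph N"
    unfolding cograph_def
  proof (intro conjI notI graphN)
    assume "\<exists>a b c d. {a, b, c, d} \<subseteq> verts N \<and> distinct [a, b, c, d] \<and>
          {a, b} \<in> edges N \<and> {b, c} \<in> edges N \<and> {c, d} \<in> edges N \<and>
          {a, c} \<notin> edges N \<and> {b, d} \<notin> edges N \<and> {a, d} \<notin> edges N"
    then obtain a b c d where h: "{a, b, c, d} \<subseteq> V" "distinct [a, b, c, d]" "E a b" "E b c" "E c d"
      "\<not> E a c" "\<not> E b d" "\<not> E a d" unfolding NE NV by blast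
    then show False using p4_freeD[OF p4, of a b c d] by blast
  qed
  have body': "insert b (Bd b) \<subseteq> scope N b" "b \<notin> Bd b" "Bd b \<subseteq> V" "\<exists>l\<in>Bd b. l \<in> literals N"
    "\<And>u. u \<in> Bd b \<Longrightarrow> E b u \<longleftrightarrow> (\<exists>x \<xi>. sub \<psi> (f b) = Some (Ex x \<xi>))" if b: "b \<in> binders N" for b
  proof -
    obtain x where bV: "b \<in> V" and bx: "label N b = Binder x" using b unfolding binders_def by auto
    then obtain \<chi> \<xi> where \<chi>: "sub \<psi> (f b) = Some \<chi>" "quantifies \<chi> x \<xi>" using labB[OF bV] by blast
    note bd = body[OF bV \<chi>]
    show BV: "Bd b \<subseteq> V" and "b \<notin> Bd b" using bd by blast+
    obtain l a where l: "l \<in> Bd b" "sub \<psi> (f l) = Some (Atm a)" using bd by blast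
    then have "label N l = Literal a" using labL BV by blast
    then show "\<exists>l\<in>Bd b. l \<in> literals N" using l(1) BV unfolding literals_def by auto
    have out: "E u w \<longleftrightarrow> E b w" if "u \<in> Bd b" "w \<in> V" "w \<notin> Bd b" "w \<noteq> b" for u w
      using bd that E_sym by metis
    have bu: "E b u \<longleftrightarrow> \<chi> = Ex x \<xi>" if "u \<in> Bd b" for u using bd that by blast
    then show "E b u \<longleftrightarrow> (\<exists>x \<xi>. sub \<psi> (f b) = Some (Ex x \<xi>))" if "u \<in> Bd b" for u
      using that \<chi> unfolding quantifies_def by auto
    show "insert b (Bd b) \<subseteq> scope N b"
    proof (rule body_subset_scope[OF graphN])
      show "graph_module N (Bd b)"
        unfolding graph_module_iff NE NV
      proof (intro conjI ballI BV)
        fix u v w assume u: "u \<in> Bd b" "v \<in> Bd b" "w \<in> V - Bd b"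
        show "E u w \<longleftrightarrow> E v w"
        proof (cases "w = b")
          case True
          then show ?thesis using bu[OF u(1)] bu[OF u(2)] E_sym by blast
        next
          case False
          then show ?thesis using out u by blast
        qed
      qed
      show "graph_module N (insert b (Bd b))"
        unfolding graph_module_iff NE NV
      proof (intro conjI ballI)
        show "insert b (Bd b) \<subseteq> V" using BV bV by blast
        fix u v w assume u: "u \<in> insert b (Bd b)" "v \<in> insert b (Bd b)" "w \<in> V - insert b (Bd b)"
        then have "E u w \<longleftrightarrow> E b w" "E v w \<longleftrightarrow> E b w" using out by blast+
        then show "E u w \<longleftrightarrow> E v w" by blast
      qed
    qed (use bd in blast)+
  qed
  have legalN: "legal N b" if b: "b \<in> binders N" for b
    unfolding legal_def
  proof (intro conjI ballI impI)
    show "scope N b \<inter> literals N \<noteq> {}" using body'(1,4)[OF b] by blast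
    fix c assume c: "c \<in> scope N b \<inter> binders N" "label N c = label N b"
    obtain x where x: "b \<in> V" "label N b = Binder x" using b unfolding binders_def by auto
    have cV: "c \<in> V" using c(1) unfolding binders_def by auto
    have fbc: "f b = f c" using same[OF x(1) cV x(2)] c(2) x(2) by simp
    obtain l where l: "l \<in> Bd b" using body'(4)[OF b] by blast
    have "card {b, l} \<le> card (verts N)"
      using x(1) l body'(3)[OF b] fin by (intro card_mono) auto
    then have card: "card (verts N) \<ge> 2" using l body'(2)[OF b] by (auto simp: card_insert_if split: if_splits)
    have bV: "b \<in> verts N" using x(1) by simp
    note dich = scope_dichotomy[OF cographN card bV]
    \<comment> \<open>If \<open>b\<close> is existential, it is adjacent to the rest of its scope,
      but not to \<open>c\<close>, which has the same image. If \<open>b\<close> is universal, it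
      has no neighbour in its scope; so the neighbour from \<open>univ_sep\<close> lies outside and,
      the scope being a module, would have to be adjacent to \<open>c\<close>.\<close>
    show "c = b"
    proof (rule ccontr)
      assume ne: "c \<noteq> b"
      have lS: "l \<in> scope N b - {b}" using body'(1,2)[OF b] l by blast
      have cS: "c \<in> scope N b - {b}" using c(1) ne by blast
      obtain \<chi> \<xi> where \<chi>: "sub \<psi> (f b) = Some \<chi>" "quantifies \<chi> x \<xi>" using labB[OF x(1)] x(2) by blast
      show False
      proof (cases "\<chi> = Ex x \<xi>")
        case True
        then have "E b l" using body'(5)[OF b l] \<chi>(1) by blast
        then have "E b c" using dich lS cS unfolding NE by blast
        then have "fadj \<psi> (f b) (f c)" by (rule hom)
        then show False using fbc fadj_irrefl by metis
      next
        case False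
        then have all: "sub \<psi> (f b) = Some (All x \<xi>)" using \<chi> unfolding quantifies_def by blast
        then have "\<not> E b l" using body'(5)[OF b l] by simp
        then have nonadj: "\<not> E b v" if "v \<in> scope N b - {b}" for v using dich lS that unfolding NE by blast
        obtain u where u: "E u b" "\<not> E u c" using univ_sep[OF x(1) cV ne[symmetric] fbc all] by blast
        have uV: "u \<in> verts N" "u \<noteq> b" using E_V[OF u(1)] u(1) E_irrefl by auto
        have "u \<notin> scope N b" using nonadj[of u] u(1) uV(2) E_sym by blast
        moreover have "graph_module N (scope N b)" "b \<in> scope N b"
          using scope_least(1,2)[OF graphN card bV] strong_moduleD unfolding proper_strong_module_def by blast+
        ultimately have "adj N c u"
          using graph_moduleD[of N "scope N b" b c u] c(1) uV(1) u(1) E_sym unfolding NE by blast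
        then show False using u(2) E_sym unfolding NE by blast
      qed
    qed
  qed
  have fN: "fograph N"
    unfolding fograph_def logical_cograph_def
  proof (intro conjI ballI cographN legalN)
    obtain v where "v \<in> V" using ne by blast
    then obtain l a where "l \<in> V" "sub \<psi> (f l) = Some (Atm a)" using literal_in_item by blast
    then show "literals N \<noteq> {}" using labL unfolding literals_def by fastforce
  qed
  have fH: "fograph ?H" using fograph_graph_of[OF dist] .
  have exN: "existential N b \<longleftrightarrow> (\<exists>x \<xi>. sub \<psi> (f b) = Some (Ex x \<xi>))" if b: "b \<in> binders N" for b
  proof -
    obtain l where l: "l \<in> Bd b" using body'(4)[OF b] by blast
    have lS: "l \<in> scope N b" "l \<noteq> b" using body'(1,2)[OF b] l by blast+
    show ?thesis
      using existential_adj[OF _ lS] existential_if_adj_body[OF fN b lS(1)] body'(5)[OF b l]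
      unfolding NE by blast
  qed
  have exb: "b \<in> binders N" if "existential N b" for b using that unfolding existential_def by blast
  have atom: "ts = [Var (cur x0 \<psi> (f v))]" if "sub \<psi> (f v) = Some (Atm (Pred Q ts))" for v Q ts
    using modal_form_Atm[OF mf that] .
  have lit: "\<exists>Q. sub \<psi> (f v) = Some (Atm (Pred Q [Var z])) \<and> label N v = Literal (Pred Q [Var z])"
    if "v \<in> V" "label N v = Literal a" "z \<in> atom_vars a" for v a z
  proof (cases a)
    case (Pred Q ts)
    then have s: "sub \<psi> (f v) = Some (Atm (Pred Q ts))" using that labL by simp
    from atom[OF s] have "ts = [Var z]" using that(3) Pred by simp
    then show ?thesis using s Pred that(2) by blast
  qed (use that in auto)
  \<comment> \<open>Over the single item \<open>([], x0)\<close>, a variable left without a binder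
    in the net can only be \<open>x0\<close>.\<close>
  have bound: "(\<exists>b\<in>V. binds_var N b z v \<and> den v = (if existential N b then den b else Inr b)) \<or> (z = x0 \<and> den v = Inl x0)"
    if v: "v \<in> V" "sub \<psi> (f v) = Some (Atm (Pred Q [Var z]))" for v Q z
  proof -
    from binding[OF v] show ?thesis
    proof (elim disjE bexE exE conjE)
      fix b \<chi> \<xi> assume b: "b \<in> V" "sub \<psi> (f b) = Some \<chi>" "quantifies \<chi> z \<xi>" "v \<in> Bd b"
        "den v = (if \<chi> = Ex z \<xi> then den b else Inr b)"
      then have lb: "label N b = Binder z" using labB by blast
      then have bb: "b \<in> binders N" using b(1) unfolding binders_def by auto
      have "existential N b \<longleftrightarrow> \<chi> = Ex z \<xi>" using exN[OF bb] b(2,3) unfolding quantifies_def by auto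
      moreover have "v \<in> scope N b" using body'(1)[OF bb] b(4) by blast
      moreover have lv: "label N v = Literal (Pred Q [Var z])" using labL[OF v(1)] v(2) by blast
      moreover have "v \<in> literals N" using v(1) lv unfolding literals_def by auto
      ultimately show ?thesis using b(1,5) bb lb unfolding binds_var_def binds_def by auto
    qed (use itv[OF v(1)] in auto)
  qed
  show skewbi: "skew_bifibration N ?H f"
    unfolding skew_bifibration_def skew_fibration_iff
  proof (intro conjI ballI impI fN fH)
    show "label ?H (f v) = label N v" for v unfolding Nl by simp
    show "existential ?H (f b)" if "existential N b" for b
      using exN[OF exb[OF that]] that existential_graph_of[OF dist] by blast
    show "skew_fib (verts N) (adj N) (fverts \<psi>) (fadj \<psi>) f"
      unfolding skew_fib_def NE NV
    proof (intro conjI ballI impI)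
      show "f ` V \<subseteq> fverts \<psi>" using fV by blast
      show "fadj \<psi> (f u) (f v)" if "E u v" for u v using hom that by blast
      show "\<exists>u\<in>V. E u v \<and> \<not> fadj \<psi> (f u) w" if "v \<in> V" "fadj \<psi> w (f v)" for v w
        using skew[OF that(1), of w] that(2) itv(1)[OF that(1)] E_V by auto
    qed
    show "directed_fibration (verts N) (binding_graph N) (fverts \<psi>) (binding_graph ?H) f"
      unfolding directed_fibration_def
    proof (intro conjI)
      show "f ` verts N \<subseteq> fverts \<psi>" using fV by auto
      have "binds ?H (f b) (f l)" if bl: "binds N b l" for b l
      proof -
        obtain x a where x: "b \<in> binders N" "label N b = Binder x" "l \<in> literals N" "label N l = Literal a" "x \<in> atom_vars a"
          using bl unfolding binds_def by blast
        have bV: "b \<in> V" "l \<in> V" using x unfolding binders_def literals_def by auto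
        obtain Q where Q: "sub \<psi> (f l) = Some (Atm (Pred Q [Var x]))" using lit[OF bV(2) x(4,5)] by blast
        have "x \<noteq> x0" using x0b[OF bV(1)] x(2) by blast
        from atom_bound_in_graph_of[OF mf Q this] obtain p \<chi> \<xi>
          where p: "sub \<psi> p = Some \<chi>" "quantifies \<chi> x \<xi>" "binds ?H p (f l)" by blast
        obtain \<chi>' \<xi>' where "sub \<psi> (f b) = Some \<chi>'" "quantifies \<chi>' x \<xi>'" using labB[OF bV(1)] x(2) by blast
        then have "f b = p" using bound_position_unique[OF dist _ _ p(1,2)] by blast
        then show ?thesis using p(3) by simp
      qed
      then show "\<forall>(v, w)\<in>binding_graph N. (f v, f w) \<in> binding_graph ?H" unfolding binding_graph_def by auto
      show "\<forall>v\<in>verts N. \<forall>w\<in>fverts \<psi>. (w, f v) \<in> binding_graph ?H \<longrightarrow>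
        (\<exists>!w'. w' \<in> verts N \<and> (w', v) \<in> binding_graph N \<and> f w' = w)"
      proof (intro ballI impI)
        fix v w assume v: "v \<in> verts N" and w: "w \<in> fverts \<psi>" "(w, f v) \<in> binding_graph ?H"
        have vV: "v \<in> V" using v by simp
        have bw: "binds ?H w (f v)" using w(2) unfolding binding_graph_def by auto
        then obtain x a where x: "label ?H w = Binder x" "label N v = Literal a" "x \<in> atom_vars a"
          unfolding binds_def Nl by blast
        obtain Q where Q: "sub \<psi> (f v) = Some (Atm (Pred Q [Var x]))" using lit[OF vV x(2,3)] by blast
        have wq: "\<exists>\<chi> \<xi>. sub \<psi> w = Some \<chi> \<and> quantifies \<chi> x \<xi>" using flabel_iff[OF w(1)] x(1) vlab_Binder by metis
        then have "x \<noteq> x0" using bound_vars_sub x0 by metis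
        then obtain b where b: "b \<in> V" "binds_var N b x v" using bound[OF vV Q] by blast
        then have bb: "binds N b v" "label N b = Binder x" unfolding binds_var_def by auto
        have "\<exists>\<chi> \<xi>. sub \<psi> (f b) = Some \<chi> \<and> quantifies \<chi> x \<xi>" using labB[OF b(1)] bb(2) by blast
        then have fb: "f b = w" using wq bound_position_unique[OF dist] by blast
        show "\<exists>!w'. w' \<in> verts N \<and> (w', v) \<in> binding_graph N \<and> f w' = w"
        proof (rule ex1I[of _ b])
          show "b \<in> verts N \<and> (b, v) \<in> binding_graph N \<and> f b = w"
            using b(1) bb(1) fb unfolding binding_graph_def by simp
          fix c assume c: "c \<in> verts N \<and> (c, v) \<in> binding_graph N \<and> f c = w"
          then have "binds N c v" "label N c = label N b" unfolding binding_graph_def Nl using fb by auto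
          then show "c = b" using binds_unique[OF fN] bb(1) by blast
        qed
      qed
    qed
  qed
  have linked: "linked_fograph N L"
    unfolding linked_fograph_def
  proof (intro conjI ballI impI fN)
    fix k assume "k \<in> L"
    from link[OF this] obtain v w Q ts us where k: "k = {v, w} \<and> v \<noteq> w \<and> v \<in> V \<and> w \<in> V \<and> \<not> E v w \<and>
      sub \<psi> (f v) = Some (Atm (Pred Q ts)) \<and> sub \<psi> (f w) = Some (Atm (Pred (dual_psym Q) us)) \<and> den v = den w"
      by (elim exE) (rule that)
    have "length us = length ts" using atom[of v Q ts] atom[of w "dual_psym Q" us] k by simp
    then have "k = {v, w} \<and> v \<noteq> w \<and> v \<in> verts N \<and> w \<in> verts N \<and> {v, w} \<notin> edges N \<and>
        label N v = Literal (Pred Q ts) \<and> label N w = Literal (Pred (dual_psym Q) us) \<and>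
        predual (Pred Q ts) (Pred (dual_psym Q) us)"
      using k labL[of v] labL[of w] NE[of v w] by simp
    then show "\<exists>v w a b. k = {v, w} \<and> v \<noteq> w \<and> v \<in> verts N \<and> w \<in> verts N \<and> {v, w} \<notin> edges N \<and>
        label N v = Literal a \<and> label N w = Literal b \<and> predual a b"
      by (intro exI)
  next
    show "k \<inter> k' = {}" if "k \<in> L" "k' \<in> L" "k \<noteq> k'" for k k' using link_disj[OF that] .
  next
    fix v assume "v \<in> literals N"
    then obtain a where a: "v \<in> V" "label N v = Literal a" unfolding literals_def by auto
    then have "sub \<psi> (f v) = Some (Atm a)" using labL by blast
    from cover[OF a(1) this] show "label N v = Literal Tru \<or> v \<in> \<Union>L" using a(2) by auto
  qed
  \<comment> \<open>The vertices themselves serve as new variables, shifted beyond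
    \<open>x0\<close>, the only variable that can be free in \<open>N\<close>. Subtracting
    \<open>Suc x0\<close> recovers the vertex, which is how \<open>\<delta>\<close> is
    defined.\<close>
  define r where "r b = Suc x0 + b" for b
  define N' where "N' = rename_binders r N"
  have rinj: "inj_on r (binders N)" unfolding r_def inj_on_def by simp
  have free: "graph_free_vars N \<subseteq> {x0}"
  proof
    fix z assume "z \<in> graph_free_vars N"
    then obtain l a where l: "l \<in> literals N" "label N l = Literal a" "z \<in> atom_vars a" "\<nexists>b. binds_var N b z l"
      unfolding graph_free_vars_def by blast
    have lV: "l \<in> V" using l(1) unfolding literals_def by simp
    obtain Q where "sub \<psi> (f l) = Some (Atm (Pred Q [Var z]))" using lit[OF lV l(2,3)] by blast
    from bound[OF lV this] l(4) show "z \<in> {x0}" by blast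
  qed
  have rx0: "r b \<noteq> x0" for b unfolding r_def by simp
  have labN'B: "label N' b = Binder (r b)" if "b \<in> binders N" for b
    using that label_rename_Binder unfolding binders_def N'_def by fast
  have rect: "rectified_fograph N'"
    unfolding rectified_fograph_def
  proof (intro conjI ballI allI impI)
    show "fograph N'" unfolding N'_def by (rule fograph_rename[OF fN rinj])
    fix b x assume b: "b \<in> binders N'" "label N' b = Binder x"
    then have bb: "b \<in> binders N" unfolding N'_def by simp
    then have x: "x = r b" using labN'B[OF bb] b(2) by simp
    show "c = b" if "c \<in> binders N'" "label N' c = Binder x" for c
    proof -
      have "c \<in> binders N" using that(1) unfolding N'_def by simp
      from labN'B[OF this] show ?thesis using that(2) x unfolding r_def by simp
    qed
    fix l a assume l: "l \<in> literals N'" "label N' l = Literal a \<and> x \<in> atom_vars a"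
    then have lN: "l \<in> literals N" unfolding N'_def by simp
    then obtain a0 where a0: "l \<in> V" "label N l = Literal a0" unfolding literals_def by auto
    have "atom_vars a = (\<lambda>x. if \<exists>b. binds_var N b x l then r (THE b. binds_var N b x l) else x) ` atom_vars a0"
      using label_rename_Literal[OF a0(2), of r] l(2) unfolding N'_def by (auto simp: atom.set_map)
    then have "atom_vars a0 \<noteq> {}" using l(2) by auto
    then obtain z where z: "z \<in> atom_vars a0" by blast
    obtain Q where Q: "sub \<psi> (f l) = Some (Atm (Pred Q [Var z]))" "label N l = Literal (Pred Q [Var z])"
      using lit[OF a0(1,2) z] by blast
    show "binds N' b l"
    proof (cases "\<exists>c. binds_var N c z l")
      case True
      then obtain c where c: "binds_var N c z l" by blast
      have lab': "label N' l = Literal (Pred Q [Var (r c)])"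
        using label_rename_bound[OF fN c Q(2)] unfolding N'_def .
      then have "r c = r b" using l(2) x by simp
      then have "c = b" unfolding r_def by simp
      then show ?thesis
        using c lab' labN'B[OF bb] unfolding binds_def binds_var_def N'_def by auto
    next
      case False
      have "label N' l = Literal (Pred Q [Var z])" using label_rename_free[OF False Q(2)] unfolding N'_def .
      then have "z = r b" using l(2) x by simp
      moreover have "z \<in> graph_free_vars N"
        unfolding graph_free_vars_def using lN Q(2) False by fastforce
      ultimately show ?thesis using free rx0 by blast
    qed
  qed
  \<comment> \<open>A name that no universal vertex has resolved is sent to \<open>x0\<close>,
    whichever name it is. Equal values of \<open>den\<close> give equal terms, as links require, and
    a free literal denotes \<open>Inl x0\<close>, which becomes its own variable.\<close>
  define T :: "nat + nat \<Rightarrow> ('f, nat) tm" where "T d = (case d of Inl a \<Rightarrow> Var x0 | Inr c \<Rightarrow> Var (r c))" for d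
  define \<delta> where "\<delta> x = T (den (x - Suc x0))" for x
  have \<delta>r: "\<delta> (r b) = T (den b)" for b unfolding \<delta>_def r_def by simp
  define \<sigma> where "\<sigma> = (\<lambda>x. if x \<in> existential_vars N' then \<delta> x else Var x)"
  have evars: "r b \<in> existential_vars N' \<longleftrightarrow> existential N b" if "b \<in> binders N" for b
    using existential_vars_rename[OF rinj that] unfolding N'_def .
  have \<sigma>: "\<exists>t. label N' v = Literal (Pred Q [Var t]) \<and> \<sigma> t = T (den v)"
    if v: "v \<in> V" "sub \<psi> (f v) = Some (Atm (Pred Q ts))" for v Q ts
  proof -
    obtain z where z: "sub \<psi> (f v) = Some (Atm (Pred Q [Var z]))" using v atom by blast
    then have lv: "label N v = Literal (Pred Q [Var z])" using labL[OF v(1)] by blast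
    show ?thesis
    proof (cases "\<exists>b. binds_var N b z v")
      case True
      then obtain b where b: "binds_var N b z v" by blast
      then have bb: "b \<in> binders N" "label N b = Binder z" unfolding binds_var_def binds_def by auto
      then have "z \<noteq> x0" using x0b unfolding binders_def by auto
      then obtain c where c: "binds_var N c z v" "den v = (if existential N c then den c else Inr c)"
        using bound[OF v(1) z] by blast
      then have "c = b" using binds_var_unique[OF fN] b by blast
      then have "\<sigma> (r b) = T (den v)" using c(2) evars[OF bb(1)] \<delta>r unfolding \<sigma>_def T_def by auto
      moreover have "label N' v = Literal (Pred Q [Var (r b)])"
        using label_rename_bound[OF fN b lv] unfolding N'_def .
      ultimately show ?thesis by blast
    next
      case False
      then have x: "z = x0" "den v = Inl x0" using bound[OF v(1) z] by blast+
      have "x0 \<notin> existential_vars N'" using existential_vars_rename_range[of r N] rx0 unfolding N'_def by force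
      then have "\<sigma> z = T (den v)" using x unfolding \<sigma>_def T_def by simp
      moreover have "label N' v = Literal (Pred Q [Var z])" using label_rename_free[OF False lv] unfolding N'_def .
      ultimately show ?thesis by blast
    qed
  qed
  have dual: "dualizer N' L \<delta>"
    unfolding dualizer_def Let_def \<sigma>_def[symmetric]
  proof (intro allI impI)
    fix v w a b assume h: "{v, w} \<in> L \<and> label N' v = Literal a \<and> label N' w = Literal b"
    from link[OF conjunct1[OF h]] obtain v' w' Q ts us where k: "{v, w} = {v', w'} \<and> v' \<noteq> w' \<and> v' \<in> V \<and> w' \<in> V \<and> \<not> E v' w' \<and>
      sub \<psi> (f v') = Some (Atm (Pred Q ts)) \<and> sub \<psi> (f w') = Some (Atm (Pred (dual_psym Q) us)) \<and> den v' = den w'"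
      by (elim exE) (rule that)
    obtain t where t: "label N' v' = Literal (Pred Q [Var t])" "\<sigma> t = T (den v')" using \<sigma> k by blast
    obtain t' where t': "label N' w' = Literal (Pred (dual_psym Q) [Var t'])" "\<sigma> t' = T (den w')" using \<sigma> k by blast
    have dd: "dual_psym (dual_psym Q) = Q" by (cases Q) auto
    from k consider "v = v'" "w = w'" | "v = w'" "w = v'" by (auto simp: doubleton_eq_iff)
    then show "subst_atom \<sigma> b = dual_atom (subst_atom \<sigma> a)"
      by cases (use h t t' k dd in auto)
  qed
  have nobi: "\<nexists>W. induces_bimatching N' L W"
  proof
    assume "\<exists>W. induces_bimatching N' L W"
    then obtain W where W: "W \<subseteq> V" "induces_matching (edges N) W" "induces_matching (leap_edges N' L) W"
      unfolding induces_bimatching_def N'_def by auto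
    have "matched E W" using W(2) unfolding induces_matching_def matched_def NE .
    moreover have "matched (\<lambda>u v. {u, v} \<in> leap_edges N' L) W" using W(3) unfolding induces_matching_def matched_def .
    \<comment> \<open>A dependency holds for every dualizer, hence for \<open>\<delta>\<close>,
      whose terms are given by \<open>den\<close>. Other dualizers may remove some of these leaps,
      so an inclusion is all that is available and all that \<open>nobim\<close> needs.\<close>
    moreover have "leap_edges N' L \<subseteq> L \<union> {{b, c} |b c. b \<in> V \<and> den b = Inr c}"
    proof -
      have "k \<in> {{b, c} |b c. b \<in> V \<and> den b = Inr c}" if "k \<in> dependencies N' L" for k
      proof -
        from that obtain b c x y where k: "k = {b, c}" "existential N' b" "universal N' c" "label N' b = Binder x"
          "label N' c = Binder y" "\<And>\<delta>. dualizer N' L \<delta> \<Longrightarrow> y \<in> tm_vars (\<delta> x)"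
          unfolding dependencies_def by blast
        have bc: "b \<in> binders N" "c \<in> binders N" using k(2,3) exb unfolding universal_def N'_def by auto
        have xy: "x = r b" "y = r c" using labN'B[OF bc(1)] labN'B[OF bc(2)] k(4,5) by auto
        have "r c \<in> tm_vars (T (den b))" using k(6)[OF dual] xy \<delta>r by simp
        then have "den b = Inr c" using rx0 unfolding T_def by (auto simp: r_def split: sum.splits)
        moreover have "b \<in> V" using bc(1) unfolding binders_def by simp
        ultimately show ?thesis using k(1) by blast
      qed
      then show ?thesis unfolding leap_edges_def by blast
    qed
    ultimately show False using nobim[OF W(1)] by blast
  qed
  have "r ` binders N \<inter> graph_free_vars N = {}" using free rx0 by blast
  then have "rectified_form_graph N N'" using rect unfolding rectified_form_graph_def N'_def by blast
  then show "fonet N L" using linked dual nobi unfolding fonet_def by blast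
qed

theorem mainTheorem4:
  fixes \<phi> :: "'p modal" and x :: nat and \<psi> :: "('f, 'p, nat) fm"
  assumes "infinite (UNIV :: 'w set)"
    and "rectified_form (star x \<phi>) \<psi>"
  shows "S5_valid TYPE('w) \<phi> \<longleftrightarrow>
    (\<exists>(N :: (nat, 'f, 'p, nat) fograph) L f. fonet N L \<and> skew_bifibration N (graph_of \<psi>) f)"
proof -
  obtain x0 where x0: "modal_form x0 \<phi> \<psi>" "distinct (bound_vars \<psi>)" "x0 \<notin> set (bound_vars \<psi>)"
    using rectified_form_modal_form[OF assms(2)] by blast
  show ?thesis
  proof
    assume "S5_valid TYPE('w) \<phi>"
    from valid_has_net[OF assms(1) this x0] obtain V E f it L den Bd
      where "net \<psi> x0 {([], x0)} {} V E f it L den Bd" unfolding has_net_def by blast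
    from combinatorial_proof_of_net[OF this x0]
    show "\<exists>(N :: (nat, 'f, 'p, nat) fograph) L f. fonet N L \<and> skew_bifibration N (graph_of \<psi>) f" by blast
  next
    assume "\<exists>(N :: (nat, 'f, 'p, nat) fograph) L f. fonet N L \<and> skew_bifibration N (graph_of \<psi>) f"
    then obtain N :: "(nat, 'f, 'p, nat) fograph" and L f
      where net: "fonet N L" and bifib: "skew_bifibration N (graph_of \<psi>) f" by blast
    show "S5_valid TYPE('w) \<phi>"
      unfolding S5_valid_def by (intro allI impI ballI) (rule soundness[OF x0 net bifib])
  qed
qed

end
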